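(* Let $d\in\{1,2,3\}$, $m>0$ and let $V:\mathbb{R}^d\to\mathbb{R}$ satisfy the following. (i) If $d=1$, then $V\in L^1(\mathbb{R})$ and $V\ge 0$; if $d\in\{2,3\}$, then $V\in L^{d/2}(\mathbb{R}^d)$ and for each $\varepsilon\in(0,1)$ there exist $q_\varepsilon\in(d/2,\infty]$ and functions $V_{\varepsilon,1}\in L^{q_\varepsilon}(\mathbb{R}^d)$, $V_{\varepsilon,2}$ with $V=V_{\varepsilon,1}+V_{\varepsilon,2}$ and $\|V_{\varepsilon,2}\|_{d/2}<\varepsilon$. (ii) There exists $r_0>0$ with $\inf_{B(0,r_0)}V>0$. Then there exists $g_d^*(m)\ge 0$ such that: $g_d^*(m)=0$ if $d=1$ and $g_d^*(m)>0$ if $d\in\{2,3\}$; for $g>0$, $e(g,m)<0$ if and only if $g>g_d^*(m)$; for every $g>g_d^*(m)$ the problem $e(g,m)$ admits a minimizer; and if $0<g<g_d^*(m)$, then $e(g,m)$ has no minimizer.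
   Context: $H^1(\mathbb{R}^d)$ consists of real-valued functions and $\|\cdot\|_p$ is the $L^p$ norm. For $g>0$ and $u\in H^1(\mathbb{R}^d)$, $$\mathcal{E}_g(u)=\frac12\int_{\mathbb{R}^d}|\nabla u|^2\,dx-\frac g4\iint_{\mathbb{R}^d\times\mathbb{R}^d}|u(x)|^2V(x-y)|u(y)|^2\,dx\,dy.$$ For $m>0$, $S_m=\{u\in H^1(\mathbb{R}^d):\|u\|_2^2=m\}$ and $e(g,m)=\inf\{\mathcal{E}_g(u):u\in S_m\}$. A minimizer for $e(g,m)$ is a $u\in S_m$ with $\mathcal{E}_g(u)=e(g,m)$. *)

theory Defs
  imports "HOL-Analysis.Analysis"
begin

text \<open>
  \<open>\<real>\<^sup>d\<close> is a type \<open>'a::euclidean_space\<close> with \<open>DIM('a) = d\<close>, and all integrals are taken with respect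
  to \<^term>\<open>lebesgue\<close>. Elements of \<open>L\<^sup>p\<close> and \<open>H\<^sup>1\<close> are represented by functions, not by
  classes modulo almost everywhere equality.
\<close>

definition Lp_space :: "ereal \<Rightarrow> ('a::euclidean_space \<Rightarrow> real) set" where
  "Lp_space p = {f \<in> borel_measurable lebesgue.
     if p = \<infinity> then \<exists>C. AE x in lebesgue. \<bar>f x\<bar> \<le> C
     else integrable lebesgue (\<lambda>x. \<bar>f x\<bar> powr real_of_ereal p)}"

text \<open>
  Meaningful only for \<open>f \<in> Lp_space p\<close>: the Bochner integral of a non-integrable function is \<open>0\<close>.
\<close>

definition Lp_norm :: "real \<Rightarrow> ('a::euclidean_space \<Rightarrow> real) \<Rightarrow> real" where
  "Lp_norm p f = (LINT x|lebesgue. \<bar>f x\<bar> powr p) powr (1 / p)"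

definition locally_integrable :: "('a::euclidean_space \<Rightarrow> real) \<Rightarrow> bool" where
  "locally_integrable f \<longleftrightarrow> (\<forall>K. compact K \<longrightarrow> set_integrable lebesgue K f)"

definition partial_deriv :: "'a::euclidean_space \<Rightarrow> ('a \<Rightarrow> real) \<Rightarrow> 'a \<Rightarrow> real" where
  "partial_deriv b f x = frechet_derivative f (at x) b"

primrec C_k :: "nat \<Rightarrow> ('a::euclidean_space \<Rightarrow> real) \<Rightarrow> bool" where
  "C_k 0 f \<longleftrightarrow> continuous_on UNIV f"
| "C_k (Suc k) f \<longleftrightarrow>
     (\<forall>x. f differentiable at x) \<and> (\<forall>b\<in>Basis. C_k k (partial_deriv b f))"

definition test_function :: "('a::euclidean_space \<Rightarrow> real) \<Rightarrow> bool" where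
  "test_function \<phi> \<longleftrightarrow> (\<forall>k. C_k k \<phi>) \<and> compact (closure {x. \<phi> x \<noteq> 0})"

definition has_weak_gradient ::
  "('a::euclidean_space \<Rightarrow> real) \<Rightarrow> ('a \<Rightarrow> 'a) \<Rightarrow> bool" where
  "has_weak_gradient u G \<longleftrightarrow> locally_integrable u \<and>
     (\<forall>b\<in>Basis. locally_integrable (\<lambda>x. G x \<bullet> b) \<and>
        (\<forall>\<phi>. test_function \<phi> \<longrightarrow>
           (LINT x|lebesgue. u x * partial_deriv b \<phi> x) =
           - (LINT x|lebesgue. (G x \<bullet> b) * \<phi> x)))"

text \<open>
  A weak gradient is unique up to a null set, so integrals of \<open>weak_gradient u\<close> do not depend on
  the choice.
\<close>

definition weak_gradient :: "('a::euclidean_space \<Rightarrow> real) \<Rightarrow> 'a \<Rightarrow> 'a" where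
  "weak_gradient u = (SOME G. has_weak_gradient u G)"

definition H1 :: "('a::euclidean_space \<Rightarrow> real) set" where
  "H1 = {u \<in> Lp_space 2. \<exists>G. has_weak_gradient u G \<and>
           (\<forall>b\<in>Basis. (\<lambda>x. G x \<bullet> b) \<in> Lp_space 2)}"

text \<open>
  The double integral is over \<^term>\<open>lebesgue\<close> on \<open>'a \<times> 'a\<close>, because \<open>(x, y) \<mapsto> V (x - y)\<close> need not
  be measurable for the (incomplete) product of two copies of \<^term>\<open>lebesgue\<close> on \<open>'a\<close>.
\<close>

definition energy ::
  "('a::euclidean_space \<Rightarrow> real) \<Rightarrow> real \<Rightarrow> ('a \<Rightarrow> real) \<Rightarrow> real" where
  "energy V g u =
     1 / 2 * (LINT x|lebesgue. (norm (weak_gradient u x))\<^sup>2)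
     - g / 4 * (LINT (x, y)|lebesgue. \<bar>u x\<bar>\<^sup>2 * V (x - y) * \<bar>u y\<bar>\<^sup>2)"

definition mass_sphere :: "real \<Rightarrow> ('a::euclidean_space \<Rightarrow> real) set" where
  "mass_sphere m = {u \<in> H1. (Lp_norm 2 u)\<^sup>2 = m}"

text \<open>
  The infimum is taken in the extended reals, so that an energy unbounded below would give \<open>-\<infinity>\<close>.
\<close>

definition ground_energy :: "('a::euclidean_space \<Rightarrow> real) \<Rightarrow> real \<Rightarrow> real \<Rightarrow> ereal" where
  "ground_energy V g m = (INF u\<in>mass_sphere m. ereal (energy V g u))"

definition is_minimizer ::
  "('a::euclidean_space \<Rightarrow> real) \<Rightarrow> real \<Rightarrow> real \<Rightarrow> ('a \<Rightarrow> real) \<Rightarrow> bool" where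
  "is_minimizer V g m u \<longleftrightarrow>
     u \<in> mass_sphere m \<and> ereal (energy V g u) = ground_energy V g m"

end

theory Submission
  imports Defs "HOL-Complex_Analysis.Great_Picard" "HOL-Library.Diagonal_Subsequence"
begin

text \<open>
  Write \<open>K\<close> for the double integral. Bounding \<open>u\<^sup>2\<close> by integrals along the lines parallel to
  the axes and applying the Loomis--Whitney inequality gives \<open>K u \<le> C * \<parallel>V\<parallel> * \<parallel>u\<parallel>\<^sup>2 * \<parallel>\<nabla>u\<parallel>\<^sup>2\<close> for \<open>d \<in> {2, 3}\<close>, with
  \<open>\<parallel>V\<parallel>\<close> the norm in \<open>L\<^sup>d\<^sup>/\<^sup>2\<close>, and a bound for \<open>K\<close> by the \<open>H\<^sup>1\<close> norm for \<open>d = 1\<close>. Hence the energy is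
  coercive after truncating the potential to a bounded function with compact support. If the infimum \<open>e\<close>
  is negative, a minimizing sequence cannot vanish, so up to translations and passing to a subsequence it has a nonzero weak limit \<open>u\<close>, of mass
  \<open>\<alpha> \<le> m\<close>. The splitting of the energy into the parts of \<open>u\<close> and of the remainder, together with the scaling
  of the quartic term, gives \<open>e \<ge> E u + ((m - \<alpha>) / m) * e\<close>, whereas \<open>E u > (\<alpha> / m) * e\<close> if \<open>\<alpha> < m\<close>; so
  no mass is lost and \<open>u\<close> is a minimizer.

  The critical coupling is the infimum of the couplings with negative energy. It vanishes for \<open>d = 1\<close>
  since the gradient term of a spread-out trial function decays like the square of the dilation parameter and \<open>K\<close> only
  linearly; it is positive for \<open>d \<in> {2, 3}\<close> by the bound on \<open>K\<close>. Below it a minimizer would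
  have energy \<open>0\<close>, and, its gradient being nonzero, negative energy for a slightly larger coupling that is still
  below the critical one.
\<close>

section \<open>Integrals and square integrable functions\<close>

text \<open>The obstacle is to work with weak gradients alone, without density of smooth functions.
  The analysis rests on one identity, proved by testing: almost everywhere, u(x + z) - u(x) is the
  integral of G(x + s z) . z over s in [0, 1]. Squared, it bounds increments along coordinate lines,
  which feeds Loomis--Whitney, and it bounds the L2 distance of u from its translates. The latter
  makes averages over small balls equicontinuous and close to u, so that local compactness follows
  from Arzela--Ascoli. Weak limits of gradients come from a minimal norm argument. A function
  travels together with its gradient, as a pair of Borel functions; only the last section translates
  this to the given notions. Vanishing is excluded quantitatively: negative energy bounds the
  interaction from below, the truncated potential keeps half of this bound and has finite range, so
  some ball of fixed radius carries a fixed amount of mass.\<close>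

lemma nn_integral_translate:
  fixes f :: "'a::euclidean_space \<Rightarrow> ennreal"
  assumes [measurable]: "f \<in> borel_measurable borel"
  shows "(\<integral>\<^sup>+x. f (x + z) \<partial>lborel) = (\<integral>\<^sup>+x. f x \<partial>lborel)"
proof -
  have "(\<integral>\<^sup>+x. f x \<partial>lborel) = (\<integral>\<^sup>+x. f x \<partial>distr lborel borel ((+) z))"
    by (simp add: lborel_distr_plus)
  also have "\<dots> = (\<integral>\<^sup>+x. f (x + z) \<partial>lborel)"
    by (subst nn_integral_distr) (auto simp: add.commute)
  finally show ?thesis by simp
qed

lemma integrable_translate_iff:
  fixes f :: "'a::euclidean_space \<Rightarrow> 'b::{banach,second_countable_topology}"
  assumes [measurable]: "f \<in> borel_measurable borel"
  shows "integrable lborel (\<lambda>x. f (x + z)) \<longleftrightarrow> integrable lborel f"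
proof -
  have "integrable lborel f \<longleftrightarrow> integrable (distr lborel borel ((+) z)) f"
    by (simp add: lborel_distr_plus)
  also have "\<dots> \<longleftrightarrow> integrable lborel (\<lambda>x. f (x + z))"
    by (subst integrable_distr_eq) (auto simp: add.commute)
  finally show ?thesis by simp
qed

lemma integral_translate:
  fixes f :: "'a::euclidean_space \<Rightarrow> 'b::{banach,second_countable_topology}"
  assumes [measurable]: "f \<in> borel_measurable borel"
  shows "(\<integral>x. f (x + z) \<partial>lborel) = (\<integral>x. f x \<partial>lborel)"
proof -
  have "(\<integral>x. f x \<partial>lborel) = (\<integral>x. f x \<partial>distr lborel borel ((+) z))"
    by (simp add: lborel_distr_plus)
  also have "\<dots> = (\<integral>x. f (x + z) \<partial>lborel)"
    by (subst integral_distr) (auto simp: add.commute)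
  finally show ?thesis by simp
qed

lemma integral_scale:
  fixes f :: "'a::euclidean_space \<Rightarrow> 'b::{banach,second_countable_topology}"
  assumes [measurable]: "f \<in> borel_measurable borel" and "c > 0"
  shows "(\<integral>x. f (c *\<^sub>R x) \<partial>lborel) = (1 / c^DIM('a)) *\<^sub>R (\<integral>x. f x \<partial>lborel)"
proof -
  have "(\<integral>x. f x \<partial>lborel) = (\<integral>x. f x \<partial>density (distr lborel borel (\<lambda>x. 0 + c *\<^sub>R x)) (\<lambda>_. ennreal (\<bar>c\<bar>^DIM('a))))"
    using assms lborel_affine[of c "0::'a"] by simp
  also have "\<dots> = (\<integral>x. (\<bar>c\<bar>^DIM('a)) *\<^sub>R f (c *\<^sub>R x) \<partial>lborel)"
    by (subst integral_density) (auto simp: integral_distr)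
  finally show ?thesis using assms(2) by (simp add: field_simps)
qed

text \<open>Values in a Euclidean space let one theory serve functions and gradients. Borel
  measurability keeps shifts, compositions such as W(x - y) and functions on product spaces
  measurable without separate arguments about null sets.\<close>

definition L2 :: "('a::euclidean_space \<Rightarrow> 'b::euclidean_space) \<Rightarrow> bool" where
  "L2 f \<longleftrightarrow> f \<in> borel_measurable borel \<and> integrable lborel (\<lambda>x. (norm (f x))\<^sup>2)"

definition nsq :: "('a::euclidean_space \<Rightarrow> 'b::euclidean_space) \<Rightarrow> real" where
  "nsq f = (\<integral>x. (norm (f x))\<^sup>2 \<partial>lborel)"

definition ip :: "('a::euclidean_space \<Rightarrow> 'b::euclidean_space) \<Rightarrow> ('a \<Rightarrow> 'b) \<Rightarrow> real" where
  "ip f g = (\<integral>x. f x \<bullet> g x \<partial>lborel)"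

lemma L2_measurable: "L2 f \<Longrightarrow> f \<in> borel_measurable borel"
  and L2_integrable: "L2 f \<Longrightarrow> integrable lborel (\<lambda>x. (norm (f x))\<^sup>2)"
  by (auto simp: L2_def)

lemma nsq_nonneg [simp]: "0 \<le> nsq f"
  unfolding nsq_def by simp

lemma L2_integrable_inner:
  assumes "L2 f" "L2 g"
  shows "integrable lborel (\<lambda>x. f x \<bullet> g x)" "integrable lborel (\<lambda>x. norm (f x) * norm (g x))"
proof -
  note [measurable] = assms[THEN L2_measurable]
  have i: "integrable lborel (\<lambda>x. (norm (f x))\<^sup>2 + (norm (g x))\<^sup>2)"
    using assms by (auto simp: L2_def)
  have b: "norm (f x) * norm (g x) \<le> (norm (f x))\<^sup>2 + (norm (g x))\<^sup>2" for x
  proof -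
    have "0 \<le> (norm (f x) - norm (g x))\<^sup>2" "0 \<le> norm (f x) * norm (g x)" by simp_all
    thus ?thesis unfolding power2_diff by linarith
  qed
  show "integrable lborel (\<lambda>x. f x \<bullet> g x)"
    by (rule Bochner_Integration.integrable_bound[OF i])
      (use b in \<open>auto intro!: AE_I2 order_trans[OF Cauchy_Schwarz_ineq2]\<close>)
  show "integrable lborel (\<lambda>x. norm (f x) * norm (g x))"
    by (rule Bochner_Integration.integrable_bound[OF i]) (use b in auto)
qed

lemma L2_0 [simp]: "L2 (\<lambda>_. 0)"
  by (simp add: L2_def)

lemma L2_add: assumes "L2 f" "L2 g" shows "L2 (\<lambda>x. f x + g x)"
proof -
  note [measurable] = assms[THEN L2_measurable]
  have "integrable lborel (\<lambda>x. (norm (f x))\<^sup>2 + 2 * (f x \<bullet> g x) + (norm (g x))\<^sup>2)"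
    using assms L2_integrable_inner[OF assms] by (auto simp: L2_def)
  moreover have "(norm (f x + g x))\<^sup>2 = (norm (f x))\<^sup>2 + 2 * (f x \<bullet> g x) + (norm (g x))\<^sup>2" for x
    by (simp add: power2_norm_eq_inner inner_simps inner_commute)
  ultimately show ?thesis by (simp add: L2_def)
qed

lemma L2_scaleR: assumes "L2 f" shows "L2 (\<lambda>x. c *\<^sub>R f x)"
proof -
  note [measurable] = L2_measurable[OF assms]
  have "integrable lborel (\<lambda>x. \<bar>c\<bar>\<^sup>2 * (norm (f x))\<^sup>2)"
    by (rule integrable_mult_right[OF L2_integrable[OF assms]])
  moreover have "(\<lambda>x. c *\<^sub>R f x) \<in> borel_measurable borel" by measurable
  ultimately show ?thesis unfolding L2_def norm_scaleR power_mult_distrib by blast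
qed

lemma L2_mult: "L2 f \<Longrightarrow> L2 (\<lambda>x. c * f x :: real)"
  using L2_scaleR[of f c] by simp

lemma L2_diff: assumes "L2 f" "L2 g" shows "L2 (\<lambda>x. f x - g x)"
  using L2_add[OF assms(1) L2_scaleR[OF assms(2), of "-1"]] by simp

lemma L2_translate: assumes "L2 f" shows "L2 (\<lambda>x. f (x + z))"
  using assms integrable_translate_iff[of "\<lambda>x. (norm (f x))\<^sup>2" z] by (auto simp: L2_def)

lemma nsq_translate: assumes "L2 f" shows "nsq (\<lambda>x. f (x + z)) = nsq f"
  using assms integral_translate[of "\<lambda>x. (norm (f x))\<^sup>2" z] by (auto simp: L2_def nsq_def)

lemma nsq_add: assumes "L2 f" "L2 g" shows "nsq (\<lambda>x. f x + g x) = nsq f + 2 * ip f g + nsq g"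
proof -
  have "nsq (\<lambda>x. f x + g x) = (\<integral>x. (norm (f x))\<^sup>2 + 2 * (f x \<bullet> g x) + (norm (g x))\<^sup>2 \<partial>lborel)"
    unfolding nsq_def by (simp add: power2_norm_eq_inner inner_simps inner_commute algebra_simps)
  also have "\<dots> = nsq f + 2 * ip f g + nsq g"
    using assms L2_integrable_inner[OF assms] by (simp add: L2_def nsq_def ip_def)
  finally show ?thesis .
qed

lemma nsq_scaleR: "nsq (\<lambda>x. c *\<^sub>R f x) = c\<^sup>2 * nsq f"
  by (simp add: nsq_def power_mult_distrib)

lemma nsq_mult: "nsq (\<lambda>x. c * f x :: real) = c\<^sup>2 * nsq f"
  using nsq_scaleR[of c f] by simp

lemma ip_scaleR_right: "ip f (\<lambda>x. c *\<^sub>R g x) = c * ip f g"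
  by (simp add: ip_def)

lemma ip_add_right:
  assumes "L2 f" "L2 g" "L2 h" shows "ip f (\<lambda>x. g x + h x) = ip f g + ip f h"
  using assms by (simp add: ip_def inner_simps L2_integrable_inner)

lemma nsq_diff: assumes "L2 f" "L2 g" shows "nsq (\<lambda>x. f x - g x) = nsq f - 2 * ip f g + nsq g"
  using nsq_add[OF assms(1) L2_scaleR[OF assms(2), of "-1"]] nsq_scaleR[of "-1" g] ip_scaleR_right[of f "-1" g]
  by simp

lemma nsq_add_le: assumes "L2 f" "L2 g" shows "nsq (\<lambda>x. f x + g x) \<le> 2 * nsq f + 2 * nsq g"
  using nsq_add[OF assms] nsq_diff[OF assms] nsq_nonneg[of "\<lambda>x. f x - g x"] by linarith

lemma nsq_diff_le: assumes "L2 f" "L2 g" shows "nsq (\<lambda>x. f x - g x) \<le> 2 * nsq f + 2 * nsq g"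
  using nsq_add[OF assms] nsq_diff[OF assms] nsq_nonneg[of "\<lambda>x. f x + g x"] by linarith

lemma nn_integral_nsq: "L2 f \<Longrightarrow> (\<integral>\<^sup>+x. ennreal ((norm (f x))\<^sup>2) \<partial>lborel) = ennreal (nsq f)"
  by (simp add: L2_def nsq_def nn_integral_eq_integral)

text \<open>The way back from estimates by nonnegative integrals, which can be carried out before
  integrability is known.\<close>

lemma nn_integral_imp_L2:
  assumes "f \<in> borel_measurable borel" "(\<integral>\<^sup>+x. ennreal ((norm (f x))\<^sup>2) \<partial>lborel) \<le> ennreal C" "0 \<le> C"
  shows "L2 f" "nsq f \<le> C"
proof -
  note [measurable] = assms(1)
  have "(\<integral>\<^sup>+x. ennreal ((norm (f x))\<^sup>2) \<partial>lborel) < \<infinity>"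
    using assms(2) by (auto intro: le_less_trans)
  thus L: "L2 f"
    unfolding L2_def by (auto intro!: integrableI_bounded)
  show "nsq f \<le> C"
    using assms nn_integral_nsq[OF L] by simp
qed

lemma nsq_eq_0_iff: assumes "L2 f" shows "nsq f = 0 \<longleftrightarrow> (AE x in lborel. f x = 0)"
  unfolding nsq_def using assms by (subst integral_nonneg_eq_0_iff_AE) (auto simp: L2_def)

lemma ip_bound: assumes "L2 f" "L2 g" shows "(ip f g)\<^sup>2 \<le> nsq f * nsq g"
proof -
  have q: "0 \<le> nsq f + 2 * t * ip f g + t\<^sup>2 * nsq g" for t
    using nsq_add[OF assms(1) L2_scaleR[OF assms(2), of t]] nsq_nonneg[of "\<lambda>x. f x + t *\<^sub>R g x"]
    by (simp add: nsq_scaleR ip_scaleR_right mult_ac)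
  show ?thesis
  proof (cases "nsq g = 0")
    case True
    have "ip f g = 0"
    proof (rule ccontr)
      assume n: "ip f g \<noteq> 0"
      \<comment> \<open>With \<open>nsq g = 0\<close> the quadratic in t is linear; this t is chosen
        so that its value is -1.\<close>
      have "0 \<le> nsq f + 2 * (- (nsq f + 1) / (2 * ip f g)) * ip f g"
        using q[of "- (nsq f + 1) / (2 * ip f g)"] True by simp
      also have "\<dots> = -1" using n by (simp add: field_simps)
      finally show False by simp
    qed
    thus ?thesis using True by simp
  next
    case False
    hence p: "nsq g > 0" using nsq_nonneg[of g] by linarith
    \<comment> \<open>The quadratic in t is evaluated at its minimum.\<close>
    have "0 \<le> nsq f + 2 * (- ip f g / nsq g) * ip f g + (- ip f g / nsq g)\<^sup>2 * nsq g"
      by (rule q)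
    also have "\<dots> = nsq f - (ip f g)\<^sup>2 / nsq g" using p by (simp add: field_simps power2_eq_square)
    finally show ?thesis using p by (simp add: field_simps)
  qed
qed

text \<open>A form free of square roots: the hypothesis bounds a square by a product, and so does
  the conclusion, so one application can supply the hypothesis of the next. Loomis--Whitney in three
  dimensions iterates it three times.\<close>

lemma nn_integral_Cauchy_Schwarz:
  fixes f g h :: "'a \<Rightarrow> ennreal"
  assumes [measurable]: "f \<in> borel_measurable M" "g \<in> borel_measurable M" "h \<in> borel_measurable M"
    and le: "\<And>x. (h x)\<^sup>2 \<le> f x * g x"
  shows "(\<integral>\<^sup>+x. h x \<partial>M)\<^sup>2 \<le> (\<integral>\<^sup>+x. f x \<partial>M) * (\<integral>\<^sup>+x. g x \<partial>M)"
proof -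
  \<comment> \<open>A square root on the extended nonnegative reals, which reduces the claim to the
    inequality for a product of two functions.\<close>
  define s :: "ennreal \<Rightarrow> ennreal" where "s t = (if t = top then top else ennreal (sqrt (enn2real t)))" for t
  have sm [measurable]: "s \<in> borel_measurable borel" unfolding s_def by measurable
  have ss: "(s t)\<^sup>2 = t" for t
    by (cases t) (simp_all add: s_def ennreal_power power2_eq_square ennreal_mult[symmetric])
  have mono: "a \<le> b" if "a\<^sup>2 \<le> b\<^sup>2" for a b :: ennreal
  proof (cases b rule: ennreal_cases)
    case b: (real y)
    show ?thesis
    proof (cases a rule: ennreal_cases)
      case (real x)
      have "ennreal (x\<^sup>2) \<le> ennreal (y\<^sup>2)"
        using that unfolding b(2) real(2) ennreal_power[OF b(1)] ennreal_power[OF real(1)] .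
      hence "x\<^sup>2 \<le> y\<^sup>2" by (rule ennreal_le_iff[THEN iffD1, rotated]) simp
      hence "x \<le> y" using b(1) by (rule power2_le_imp_le)
      thus ?thesis unfolding b(2) real(2) by (rule ennreal_leI)
    next
      case top
      with that have "ennreal (y\<^sup>2) = top" unfolding b(2) ennreal_power[OF b(1)]
        by (simp add: power2_eq_square top_unique)
      thus ?thesis by simp
    qed
  qed simp
  have "h x \<le> s (f x) * s (g x)" for x
    by (rule mono) (use le[of x] in \<open>simp add: power_mult_distrib ss\<close>)
  hence "(\<integral>\<^sup>+x. h x \<partial>M) \<le> (\<integral>\<^sup>+x. s (f x) * s (g x) \<partial>M)"
    by (intro nn_integral_mono)
  hence "(\<integral>\<^sup>+x. h x \<partial>M)\<^sup>2 \<le> (\<integral>\<^sup>+x. s (f x) * s (g x) \<partial>M)\<^sup>2"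
    by (rule power_mono) simp
  also have "\<dots> \<le> (\<integral>\<^sup>+x. (s (f x))\<^sup>2 \<partial>M) * (\<integral>\<^sup>+x. (s (g x))\<^sup>2 \<partial>M)"
    by (rule Cauchy_Schwarz_nn_integral) measurable
  finally show ?thesis by (simp add: ss)
qed

text \<open>Riesz--Fischer. The almost everywhere convergent subsequence belongs to the conclusion
  because a later compactness proof applies Fatou's lemma along it.\<close>

lemma L2_complete:
  fixes f :: "nat \<Rightarrow> 'a::euclidean_space \<Rightarrow> 'b::euclidean_space"
  assumes L: "\<And>n. L2 (f n)"
    and cauchy: "\<And>e. e > 0 \<Longrightarrow> \<exists>N. \<forall>m\<ge>N. \<forall>n\<ge>N. nsq (\<lambda>x. f m x - f n x) \<le> e"
  obtains g r where "L2 g" "(\<lambda>n. nsq (\<lambda>x. f n x - g x)) \<longlonglongrightarrow> 0"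
    "strict_mono (r :: nat \<Rightarrow> nat)" "AE x in lborel. (\<lambda>n. f (r n) x) \<longlonglongrightarrow> g x"
proof -
  note [measurable] = L2_measurable[OF L]
  \<comment> \<open>The rate 8^-k leaves room for the weight 4^k: the series of
    \<open>4^k * nsq (d k)\<close> still converges, and finiteness of the weighted sum at x gives
    the geometric bound \<open>sqrt C * (1/2)^k\<close> for the steps.\<close>
  define P where "P k N \<longleftrightarrow> (\<forall>m\<ge>N. \<forall>n\<ge>N. nsq (\<lambda>x. f m x - f n x) \<le> (1/8)^k)" for k and N :: nat
  have "\<exists>N. P k N" for k using cauchy[of "(1/8)^k"] by (auto simp: P_def)
  then obtain N where N: "\<And>k. P k (N k)" by metis
  define r where "r = rec_nat (N 0) (\<lambda>k j. max (Suc j) (N (Suc k)))"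
  have r_Suc: "r (Suc k) = max (Suc (r k)) (N (Suc k))" and r0: "r 0 = N 0" for k by (auto simp: r_def)
  have r: "strict_mono r" by (intro strict_monoI_Suc) (simp add: r_Suc)
  have rN: "N k \<le> r k" for k by (cases k) (auto simp: r_Suc r0)
  define d where "d k x = f (r (Suc k)) x - f (r k) x" for k x
  have d_meas [measurable]: "d k \<in> borel_measurable borel" for k unfolding d_def by measurable
  have dL: "L2 (d k)" for k unfolding d_def by (intro L2_diff L)
  have dn: "nsq (d k) \<le> (1/8)^k" for k
    using N[of k] rN[of k] strict_mono_less_eq[OF r, of k "Suc k"] unfolding P_def d_def by auto
  have "(\<integral>\<^sup>+x. (\<Sum>k. ennreal (4^k * (norm (d k x))\<^sup>2)) \<partial>lborel) = (\<Sum>k. \<integral>\<^sup>+x. ennreal (4^k * (norm (d k x))\<^sup>2) \<partial>lborel)"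
    by (rule nn_integral_suminf) measurable
  also have "\<dots> = (\<Sum>k. ennreal (4^k * nsq (d k)))"
    by (intro suminf_cong) (simp add: ennreal_mult' nn_integral_cmult nn_integral_nsq[OF dL])
  also have "\<dots> \<le> (\<Sum>k. ennreal ((1/2)^k))"
  proof (intro suminf_le summableI ennreal_leI)
    fix k
    have "4^k * nsq (d k) \<le> 4^k * (1/8)^k" using dn[of k] by simp
    also have "\<dots> = (1/2::real)^k" by (simp add: power_mult_distrib[symmetric])
    finally show "4^k * nsq (d k) \<le> (1/2)^k" .
  qed
  also have "\<dots> < \<infinity>"
    by (subst suminf_ennreal2) (auto intro: summable_geometric)
  finally have fin: "AE x in lborel. (\<Sum>k. ennreal (4^k * (norm (d k x))\<^sup>2)) \<noteq> \<infinity>"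
    by (intro nn_integral_PInf_AE) auto
  define g where "g x = lim (\<lambda>n. f (r n) x)" for x
  have g_meas [measurable]: "g \<in> borel_measurable borel" unfolding g_def by measurable
  have conv: "AE x in lborel. (\<lambda>n. f (r n) x) \<longlonglongrightarrow> g x"
    using fin
  proof eventually_elim
    fix x assume "(\<Sum>k. ennreal (4^k * (norm (d k x))\<^sup>2)) \<noteq> \<infinity>"
    hence fin: "(\<Sum>k. ennreal (4^k * (norm (d k x))\<^sup>2)) < top" by (simp only: less_top infinity_ennreal_def)
    define C where "C = enn2real (\<Sum>k. ennreal (4^k * (norm (d k x))\<^sup>2))"
    have C: "C \<ge> 0" "(\<Sum>k. ennreal (4^k * (norm (d k x))\<^sup>2)) = ennreal C"
      unfolding C_def by (rule enn2real_nonneg, rule ennreal_enn2real[OF fin, symmetric])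
    have dk: "norm (d k x) \<le> sqrt C * (1/2)^k" for k
    proof -
      have "ennreal (4^k * (norm (d k x))\<^sup>2) \<le> ennreal C"
        unfolding C(2)[symmetric]
        by (rule order_trans[OF _ sum_le_suminf[of "\<lambda>k. ennreal (4^k * (norm (d k x))\<^sup>2)" "{k}"]])
          (auto intro: summableI)
      hence "4^k * (norm (d k x))\<^sup>2 \<le> C" by (rule ennreal_le_iff[OF C(1), THEN iffD1])
      moreover have "(2^k * norm (d k x))\<^sup>2 = 4^k * (norm (d k x))\<^sup>2"
        by (simp add: power_mult_distrib power_mult[symmetric] mult.commute[of k] power_mult)
      ultimately have "(2^k * norm (d k x))\<^sup>2 \<le> C" by simp
      hence "2^k * norm (d k x) \<le> sqrt C" by (rule real_le_rsqrt)
      hence "2^k * norm (d k x) * (1/2)^k \<le> sqrt C * (1/2)^k" by (rule mult_right_mono) simp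
      thus ?thesis by (simp add: power_divide)
    qed
    have "summable (\<lambda>k. d k x)"
      by (rule summable_comparison_test'[where g="\<lambda>k. sqrt C * (1/2)^k"]) (use dk in auto)
    hence "(\<lambda>n. \<Sum>k<n. d k x) \<longlonglongrightarrow> suminf (\<lambda>k. d k x)" by (rule summable_LIMSEQ)
    moreover have "(\<Sum>k<n. d k x) = f (r n) x - f (r 0) x" for n
      unfolding d_def by (rule sum_lessThan_telescope)
    ultimately have "(\<lambda>n. f (r n) x - f (r 0) x + f (r 0) x) \<longlonglongrightarrow> suminf (\<lambda>k. d k x) + f (r 0) x"
      by (intro tendsto_add tendsto_const) simp
    hence "convergent (\<lambda>n. f (r n) x)" by (auto simp: convergent_def)
    thus "(\<lambda>n. f (r n) x) \<longlonglongrightarrow> g x" unfolding g_def by (simp add: convergent_LIMSEQ_iff)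
  qed
  \<comment> \<open>Fatou's lemma along the subsequence turns the Cauchy estimate into an estimate
    for the distance from the limit.\<close>
  have est: "L2 (\<lambda>x. f n x - g x) \<and> nsq (\<lambda>x. f n x - g x) \<le> e"
    if e: "e > 0" and M: "\<forall>m\<ge>M. \<forall>n\<ge>M. nsq (\<lambda>x. f m x - f n x) \<le> e" and n: "n \<ge> M" for e M n
  proof -
    have "(\<integral>\<^sup>+x. ennreal ((norm (f n x - g x))\<^sup>2) \<partial>lborel)
        = (\<integral>\<^sup>+x. liminf (\<lambda>j. ennreal ((norm (f n x - f (r j) x))\<^sup>2)) \<partial>lborel)"
    proof (rule nn_integral_cong_AE)
      show "AE x in lborel. ennreal ((norm (f n x - g x))\<^sup>2) = liminf (\<lambda>j. ennreal ((norm (f n x - f (r j) x))\<^sup>2))"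
        using conv
      proof eventually_elim
        fix x assume "(\<lambda>n. f (r n) x) \<longlonglongrightarrow> g x"
        hence "(\<lambda>j. ennreal ((norm (f n x - f (r j) x))\<^sup>2)) \<longlonglongrightarrow> ennreal ((norm (f n x - g x))\<^sup>2)"
          by (intro tendsto_intros tendsto_ennrealI)
        thus "ennreal ((norm (f n x - g x))\<^sup>2) = liminf (\<lambda>j. ennreal ((norm (f n x - f (r j) x))\<^sup>2))"
          by (intro lim_imp_Liminf[symmetric]) auto
      qed
    qed
    also have "\<dots> \<le> liminf (\<lambda>j. \<integral>\<^sup>+x. ennreal ((norm (f n x - f (r j) x))\<^sup>2) \<partial>lborel)"
      by (rule nn_integral_liminf) measurable
    also have "\<dots> = liminf (\<lambda>j. ennreal (nsq (\<lambda>x. f n x - f (r j) x)))"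
      by (simp add: nn_integral_nsq[OF L2_diff[OF L L]])
    also have "\<dots> \<le> ennreal e"
    proof (rule Liminf_le)
      show "\<forall>\<^sub>F j in sequentially. ennreal (nsq (\<lambda>x. f n x - f (r j) x)) \<le> ennreal e"
        using eventually_ge_at_top[of M]
      proof eventually_elim
        fix j assume "M \<le> j"
        hence "M \<le> r j" using seq_suble[OF r, of j] by linarith
        thus "ennreal (nsq (\<lambda>x. f n x - f (r j) x)) \<le> ennreal e"
          using M n by (intro ennreal_leI) blast
      qed
    qed simp
    finally show ?thesis using nn_integral_imp_L2[of "\<lambda>x. f n x - g x" e] e by auto
  qed
  obtain M where M: "\<forall>m\<ge>M. \<forall>n\<ge>M. nsq (\<lambda>x. f m x - f n x) \<le> 1" using cauchy[of 1] by auto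
  have "L2 (\<lambda>x. f M x - g x)" using est[OF _ M, of M] by simp
  from L2_diff[OF L[of M] this] have gL: "L2 g" by simp
  have "(\<lambda>n. nsq (\<lambda>x. f n x - g x)) \<longlonglongrightarrow> 0"
  proof (rule LIMSEQ_I)
    fix e :: real assume "e > 0"
    obtain M where M: "\<forall>m\<ge>M. \<forall>n\<ge>M. nsq (\<lambda>x. f m x - f n x) \<le> e / 2" using cauchy[of "e/2"] \<open>e > 0\<close> by auto
    show "\<exists>no. \<forall>n\<ge>no. norm (nsq (\<lambda>x. f n x - g x) - 0) < e"
      using est[OF _ M] \<open>e > 0\<close> by (intro exI[of _ M]) fastforce
  qed
  with gL r conv show ?thesis by (intro that)
qed

section \<open>Test functions\<close>

lemma partial_deriv_has_derivative:
  assumes "(f has_derivative D) (at x)"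
  shows "partial_deriv b f x = D b"
  using frechet_derivative_at[OF assms] by (simp add: partial_deriv_def)

lemma C_k_continuous: "C_k k f \<Longrightarrow> continuous_on UNIV f"
  by (cases k) (auto intro!: differentiable_imp_continuous_on simp: differentiable_on_def intro: differentiable_at_withinI)

lemma C_k_Suc_imp: "C_k (Suc k) f \<Longrightarrow> C_k k f"
proof (induction k arbitrary: f)
  case 0 thus ?case using C_k_continuous[OF 0] by simp
next
  case (Suc k)
  show ?case unfolding C_k.simps(2)[of k]
    using Suc.prems Suc.IH by (auto simp only: C_k.simps(2)[of "Suc k"])
qed

lemma C_k_const: "C_k k (\<lambda>_. c)"
proof (induction k arbitrary: c)
  case (Suc k)
  have "partial_deriv b (\<lambda>_. c) = (\<lambda>_. 0)" for b :: 'a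
    by (auto simp: partial_deriv_def)
  thus ?case using Suc by simp
qed simp

lemma C_k_add: "C_k k f \<Longrightarrow> C_k k g \<Longrightarrow> C_k k (\<lambda>x. f x + g x)"
proof (induction k arbitrary: f g)
  case 0 thus ?case by (auto intro: continuous_intros)
next
  case (Suc k)
  have "partial_deriv b (\<lambda>x. f x + g x) = (\<lambda>x. partial_deriv b f x + partial_deriv b g x)" for b
  proof
    fix x
    have "((\<lambda>x. f x + g x) has_derivative (\<lambda>h. frechet_derivative f (at x) h + frechet_derivative g (at x) h)) (at x)"
      using Suc.prems by (intro has_derivative_add) (auto simp: frechet_derivative_works[symmetric])
    from partial_deriv_has_derivative[OF this]
    show "partial_deriv b (\<lambda>x. f x + g x) x = partial_deriv b f x + partial_deriv b g x"
      by (simp add: partial_deriv_def)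
  qed
  thus ?case using Suc by auto
qed

lemma partial_deriv_mult:
  assumes "f differentiable at x" "g differentiable at x"
  shows "partial_deriv b (\<lambda>x. f x * g x) x = f x * partial_deriv b g x + partial_deriv b f x * g x"
proof -
  have "((\<lambda>x. f x * g x) has_derivative (\<lambda>h. f x * frechet_derivative g (at x) h + frechet_derivative f (at x) h * g x)) (at x)"
    using assms by (intro has_derivative_mult) (auto simp: frechet_derivative_works[symmetric])
  from partial_deriv_has_derivative[OF this] show ?thesis by (simp add: partial_deriv_def)
qed

lemma C_k_mult: "C_k k f \<Longrightarrow> C_k k g \<Longrightarrow> C_k k (\<lambda>x. f x * g x)"
proof (induction k arbitrary: f g)
  case 0 thus ?case by (auto intro: continuous_intros)
next
  case (Suc k)
  have "partial_deriv b (\<lambda>x. f x * g x) = (\<lambda>x. f x * partial_deriv b g x + partial_deriv b f x * g x)" for b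
    using Suc.prems by (intro ext partial_deriv_mult) auto
  moreover have "C_k k f" "C_k k g" using Suc.prems by (auto intro: C_k_Suc_imp)
  ultimately show ?case using Suc by (auto intro!: C_k_add)
qed

lemma C_k_prod: "finite A \<Longrightarrow> (\<And>i. i \<in> A \<Longrightarrow> C_k k (f i)) \<Longrightarrow> C_k k (\<lambda>x. \<Prod>i\<in>A. f i x)"
  by (induction A rule: finite_induct) (auto intro!: C_k_const C_k_mult)

lemma partial_deriv_affine:
  assumes "f differentiable at (c *\<^sub>R x + z)"
  shows "partial_deriv b (\<lambda>x. f (c *\<^sub>R x + z)) x = c * partial_deriv b f (c *\<^sub>R x + z)"
proof -
  have D: "(f has_derivative frechet_derivative f (at (c *\<^sub>R x + z))) (at (c *\<^sub>R x + z))"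
    using assms by (simp add: frechet_derivative_works[symmetric])
  have "((\<lambda>x. c *\<^sub>R x + z) has_derivative (\<lambda>h. c *\<^sub>R h)) (at x)"
    by (auto intro!: derivative_eq_intros)
  from has_derivative_compose[OF this D]
  have "partial_deriv b (\<lambda>x. f (c *\<^sub>R x + z)) x = frechet_derivative f (at (c *\<^sub>R x + z)) (c *\<^sub>R b)"
    by (rule partial_deriv_has_derivative)
  also have "\<dots> = c * frechet_derivative f (at (c *\<^sub>R x + z)) b"
    using linear_frechet_derivative[OF assms] by (simp add: linear_cmul)
  finally show ?thesis by (simp add: partial_deriv_def)
qed

lemma C_k_affine: "C_k k f \<Longrightarrow> C_k k (\<lambda>x. f (c *\<^sub>R x + z))"
proof (induction k arbitrary: f)
  case 0
  have "continuous_on UNIV (f \<circ> (\<lambda>x. c *\<^sub>R x + z))"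
    using 0 by (intro continuous_on_compose continuous_intros) (auto intro: continuous_on_subset)
  thus ?case by (simp add: o_def)
next
  case (Suc k)
  have "partial_deriv b (\<lambda>x. f (c *\<^sub>R x + z)) = (\<lambda>x. c * partial_deriv b f (c *\<^sub>R x + z))" for b
    using Suc.prems by (intro ext partial_deriv_affine) auto
  moreover have "(\<lambda>x. f (c *\<^sub>R x + z)) differentiable at x" for x
  proof -
    have "f \<circ> (\<lambda>x. c *\<^sub>R x + z) differentiable at x"
      using Suc.prems by (intro differentiable_chain_at) (auto intro!: derivative_intros)
    thus ?thesis by (simp add: o_def)
  qed
  ultimately show ?case using Suc by (auto intro!: C_k_mult C_k_const)
qed

text \<open>Abbreviates `continuous with compact support'.\<close>

definition cc :: "('a::euclidean_space \<Rightarrow> real) \<Rightarrow> bool" where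
  "cc f \<longleftrightarrow> continuous_on UNIV f \<and> (\<exists>R. \<forall>x. norm x > R \<longrightarrow> f x = 0)"

lemma cc_measurable [measurable_dest]: "cc f \<Longrightarrow> f \<in> borel_measurable borel"
  by (auto simp: cc_def intro: borel_measurable_continuous_onI)

lemma cc_bounded: assumes "cc f" obtains M where "M > 0" "\<And>x. \<bar>f x\<bar> \<le> M"
proof -
  obtain R where R: "\<And>x. norm x > R \<Longrightarrow> f x = 0" using assms by (auto simp: cc_def)
  have "compact (f ` cball 0 R)"
    using assms by (intro compact_continuous_image) (auto simp: cc_def intro: continuous_on_subset)
  then obtain M where M: "M > 0" "\<And>x. x \<in> cball 0 R \<Longrightarrow> norm (f x) \<le> M"
    using compact_imp_bounded[THEN bounded_pos[THEN iffD1]] by (metis imageI)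
  have "\<bar>f x\<bar> \<le> M" for x using M R[of x] by (cases "norm x \<le> R") auto
  with M show ?thesis by (intro that) auto
qed

lemma cc_continuous: "cc f \<Longrightarrow> continuous_on UNIV f" by (simp add: cc_def)

lemma cc_mult: "cc f \<Longrightarrow> continuous_on UNIV g \<Longrightarrow> cc (\<lambda>x. f x * g x)"
  by (auto simp: cc_def intro: continuous_on_mult)

lemma cc_add: assumes "cc f" "cc g" shows "cc (\<lambda>x. f x + g x)"
proof -
  obtain R S where "\<And>x. norm x > R \<Longrightarrow> f x = 0" "\<And>x. norm x > S \<Longrightarrow> g x = 0" using assms by (auto simp: cc_def)
  thus ?thesis using assms by (auto simp: cc_def intro!: continuous_on_add exI[of _ "max R S"])
qed

lemma cc_cmult: "cc f \<Longrightarrow> cc (\<lambda>x. c * f x)"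
  by (auto simp: cc_def intro: continuous_on_mult continuous_intros)

lemma cc_0: "cc (\<lambda>x. 0)" by (simp add: cc_def)

lemma cc_sum: "finite A \<Longrightarrow> (\<And>i. i \<in> A \<Longrightarrow> cc (f i)) \<Longrightarrow> cc (\<lambda>x. \<Sum>i\<in>A. f i x)"
  by (induction A rule: finite_induct) (auto intro: cc_0 cc_add)

lemma integrable_bounded_support:
  fixes f :: "'a::euclidean_space \<Rightarrow> real"
  assumes "f \<in> borel_measurable borel" "\<And>x. \<bar>f x\<bar> \<le> M" "\<And>x. norm x > R \<Longrightarrow> f x = 0"
  shows "integrable lborel f"
proof (rule Bochner_Integration.integrable_bound)
  show "integrable lborel (\<lambda>x::'a. M * indicator (cball 0 R) x)"
    by (intro integrable_mult_right integrable_real_indicator) (use emeasure_lborel_cball_finite[of 0 R] in auto)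
  show "AE x in lborel. norm (f x) \<le> norm (M * indicator (cball 0 R) x)"
    using assms(2,3) by (intro AE_I2) (auto simp: indicator_def intro: order_trans[OF _ abs_ge_self])
qed (use assms in auto)

lemma cc_integrable: assumes "cc f" shows "integrable lborel f"
proof -
  obtain M where "\<And>x. \<bar>f x\<bar> \<le> M" using cc_bounded[OF assms] by blast
  moreover obtain R where "\<And>x. norm x > R \<Longrightarrow> f x = 0" using assms by (auto simp: cc_def)
  ultimately show ?thesis using cc_measurable[OF assms] by (intro integrable_bounded_support)
qed

lemma cc_L2: assumes "cc f" shows "L2 f"
proof -
  have "cc (\<lambda>x. f x * f x)" using assms by (intro cc_mult cc_continuous)
  from cc_integrable[OF this] show ?thesis using cc_measurable[OF assms]
    by (simp add: L2_def power2_eq_square)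
qed

lemma cc_affine: assumes "cc f" "c \<noteq> 0" shows "cc (\<lambda>x. f (c *\<^sub>R x + z))"
proof -
  obtain R where R: "\<And>x. norm x > R \<Longrightarrow> f x = 0" using assms by (auto simp: cc_def)
  have "f (c *\<^sub>R x + z) = 0" if "norm x > (\<bar>R\<bar> + norm z) / \<bar>c\<bar>" for x
  proof (rule R)
    have "\<bar>R\<bar> + norm z < \<bar>c\<bar> * norm x" using that assms(2) by (simp add: field_simps)
    also have "\<dots> \<le> norm (c *\<^sub>R x + z) + norm z" using norm_triangle_ineq4[of "c *\<^sub>R x + z" z] by simp
    finally show "R < norm (c *\<^sub>R x + z)" by simp
  qed
  moreover have "continuous_on UNIV (\<lambda>x. f (c *\<^sub>R x + z))"
    by (rule continuous_on_compose2[OF cc_continuous[OF assms(1)]]) (auto intro!: continuous_intros)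
  ultimately show ?thesis by (auto simp: cc_def)
qed

lemma cc_partial_deriv: assumes "C_k (Suc k) f" "cc f" "b \<in> Basis" shows "cc (partial_deriv b f)"
proof -
  obtain R where R: "\<And>x. norm x > R \<Longrightarrow> f x = 0" using assms by (auto simp: cc_def)
  have "partial_deriv b f x = 0" if "norm x > R" for x
  proof -
    have "((\<lambda>_. 0) has_derivative (\<lambda>_. 0)) (at x)" by simp
    hence "(f has_derivative (\<lambda>_. 0)) (at x)"
      by (rule has_derivative_transform_within_open[where s="- cball 0 R"]) (use that R in auto)
    thus ?thesis by (simp add: partial_deriv_has_derivative)
  qed
  thus ?thesis using assms by (auto simp: cc_def intro: C_k_continuous)
qed

lemma test_function_iff: "test_function f \<longleftrightarrow> (\<forall>k. C_k k f) \<and> cc f"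
proof
  assume t: "test_function f"
  hence "bounded (closure {x. f x \<noteq> 0})" by (auto simp: test_function_def intro: compact_imp_bounded)
  then obtain R where "\<And>x. x \<in> closure {x. f x \<noteq> 0} \<Longrightarrow> norm x \<le> R" by (auto simp: bounded_iff)
  hence "norm x > R \<longrightarrow> f x = 0" for x using closure_subset[of "{x. f x \<noteq> 0}"] by force
  thus "(\<forall>k. C_k k f) \<and> cc f" using t by (auto simp: test_function_def cc_def intro: C_k_continuous)
next
  assume t: "(\<forall>k. C_k k f) \<and> cc f"
  then obtain R where R: "\<And>x. norm x > R \<Longrightarrow> f x = 0" by (auto simp: cc_def)
  have "{x. f x \<noteq> 0} \<subseteq> cball 0 R" using R by (auto simp: not_less[symmetric])
  hence "bounded {x. f x \<noteq> 0}" by (rule bounded_subset[rotated]) simp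
  thus "test_function f" using t by (auto simp: test_function_def)
qed

lemma test_function_cc: "test_function f \<Longrightarrow> cc f"
  and test_function_differentiable: "test_function f \<Longrightarrow> f differentiable at x"
  and test_function_cc_partial: "test_function f \<Longrightarrow> b \<in> Basis \<Longrightarrow> cc (partial_deriv b f)"
  using C_k.simps(2)[of 0 f] by (auto simp: test_function_iff intro: cc_partial_deriv)

lemma test_function_affine: "test_function f \<Longrightarrow> c \<noteq> 0 \<Longrightarrow> test_function (\<lambda>x. f (c *\<^sub>R x + z))"
  by (auto simp: test_function_iff intro: cc_affine C_k_affine)

lemma frechet_derivative_eq_sum_partial:
  assumes "f differentiable at x"
  shows "frechet_derivative f (at x) z = (\<Sum>b\<in>Basis. (z \<bullet> b) * partial_deriv b f x)"
proof -
  have "frechet_derivative f (at x) (\<Sum>b\<in>Basis. (z \<bullet> b) *\<^sub>R b) = (\<Sum>b\<in>Basis. (z \<bullet> b) * partial_deriv b f x)"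
    using linear_frechet_derivative[OF assms]
    by (simp add: linear_sum linear_cmul partial_deriv_def)
  thus ?thesis by (simp add: euclidean_representation)
qed

section \<open>Smooth bumps supported in boxes\<close>

text \<open>The function t^-k exp(-1/t), extended by zero. The powers are included so that the
  family is closed under differentiation up to linear combinations; smoothness is then an induction
  on the order with k arbitrary.\<close>

definition exp_flat :: "nat \<Rightarrow> real \<Rightarrow> real" where
  "exp_flat k t = (if t > 0 then (1 / t) ^ k / exp (1 / t) else 0)"

lemma exp_flat_tendsto_0: "(exp_flat k \<longlongrightarrow> 0) (at 0)"
  unfolding filterlim_at_split
proof (rule conjI)
  have "eventually (\<lambda>t. exp_flat k t = 0) (at_left 0)"
    by (auto simp: eventually_at_filter exp_flat_def)
  thus "(exp_flat k \<longlongrightarrow> 0) (at_left 0)" by (rule tendsto_eventually)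
  have "((\<lambda>t. inverse t ^ k / exp (inverse t)) \<longlongrightarrow> 0) (at_right (0::real))"
    by (rule filterlim_compose[OF tendsto_power_div_exp_0 filterlim_inverse_at_top_right])
  moreover have "eventually (\<lambda>t. inverse t ^ k / exp (inverse t) = exp_flat k t) (at_right 0)"
    by (auto simp: eventually_at_filter exp_flat_def inverse_eq_divide)
  ultimately show "(exp_flat k \<longlongrightarrow> 0) (at_right 0)" by (rule Lim_transform_eventually)
qed

lemma exp_flat_deriv:
  "(exp_flat k has_real_derivative (exp_flat (k + 2) t - real k * exp_flat (k + 1) t)) (at t)"
proof -
  consider "t < 0" | "t = 0" | "t > 0" by linarith
  thus ?thesis
  proof cases
    case 1
    have "((\<lambda>_. 0) has_real_derivative 0) (at t)" by simp
    hence "(exp_flat k has_real_derivative 0) (at t)"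
      by (rule has_field_derivative_transform_within_open[where S="{..<0}"]) (use 1 in \<open>auto simp: exp_flat_def\<close>)
    thus ?thesis using 1 by (simp add: exp_flat_def)
  next
    case 2
    \<comment> \<open>The difference quotient of \<open>exp_flat k\<close> at 0 is
      \<open>exp_flat (Suc k)\<close>, which tends to 0 there.\<close>
    have "((\<lambda>h. (exp_flat k (0 + h) - exp_flat k 0) / h) \<longlongrightarrow> 0) (at 0)"
    proof (rule Lim_transform_eventually[OF exp_flat_tendsto_0[of "Suc k"]])
      show "\<forall>\<^sub>F h in at 0. exp_flat (Suc k) h = (exp_flat k (0 + h) - exp_flat k 0) / h"
        by (auto simp: exp_flat_def field_simps eventually_at intro!: exI[of _ 1])
    qed
    thus ?thesis using 2 by (simp add: DERIV_def exp_flat_def)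
  next
    case 3
    have "((\<lambda>t. (1 / t) ^ k / exp (1 / t)) has_real_derivative
        ((1 / t) ^ (k + 2) / exp (1 / t) - real k * ((1 / t) ^ (k + 1) / exp (1 / t)))) (at t)"
    proof -
      have "((\<lambda>t. 1 / t) has_real_derivative (- ((1 / t) * (1 / t)))) (at t)"
        using 3 by (auto intro!: derivative_eq_intros)
      moreover have "((\<lambda>s. s ^ k / exp s) has_real_derivative
          ((real k * s ^ (k - 1) * exp s - s ^ k * exp s) / (exp s * exp s))) (at s)" for s
        by (auto intro!: derivative_eq_intros)
      ultimately have "((\<lambda>t. (1 / t) ^ k / exp (1 / t)) has_real_derivative
         ((real k * (1 / t) ^ (k - 1) * exp (1 / t) - (1 / t) ^ k * exp (1 / t)) / (exp (1 / t) * exp (1 / t)))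
           * (- ((1 / t) * (1 / t)))) (at t)"
        by (intro DERIV_chain2[where f="\<lambda>s. s ^ k / exp s" and g="\<lambda>t. 1 / t"])
      moreover have "((real k * s ^ (k - 1) * e - s ^ k * e) / (e * e)) * (- (s * s))
          = s ^ (k + 2) / e - real k * (s ^ (k + 1) / e)" if "e > 0" for s e :: real
        using that by (cases k) (auto simp: field_simps)
      note this[of "exp (1 / t)" "1 / t"]
      ultimately show ?thesis by (simp only: exp_gt_zero)
    qed
    hence "(exp_flat k has_real_derivative
        ((1 / t) ^ (k + 2) / exp (1 / t) - real k * ((1 / t) ^ (k + 1) / exp (1 / t)))) (at t)"
      by (rule has_field_derivative_transform_within_open[where S="{0<..}"]) (use 3 in \<open>auto simp: exp_flat_def\<close>)
    thus ?thesis using 3 by (simp add: exp_flat_def)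
  qed
qed

lemma C_k_exp_flat:
  fixes v :: "'a::euclidean_space"
  shows "C_k n (\<lambda>x. exp_flat k (x \<bullet> v + \<beta>))"
proof (induction n arbitrary: k)
  case 0
  have "continuous_on UNIV (exp_flat k)" for k
    using exp_flat_deriv[of k] by (auto intro!: DERIV_continuous_on)
  from continuous_on_compose2[OF this[of k], of UNIV "\<lambda>x. x \<bullet> v + \<beta>"]
  show ?case unfolding C_k.simps by (simp add: continuous_on_add continuous_on_inner)
next
  case (Suc n)
  have d: "((\<lambda>x. exp_flat k (x \<bullet> v + \<beta>)) has_derivative
     (\<lambda>h. (h \<bullet> v) * (exp_flat (k + 2) (x \<bullet> v + \<beta>) - real k * exp_flat (k + 1) (x \<bullet> v + \<beta>)))) (at x)" for x
  proof -
    have "((\<lambda>x. x \<bullet> v + \<beta>) has_derivative (\<lambda>h. h \<bullet> v)) (at x)" by (auto intro!: derivative_eq_intros)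
    from has_derivative_compose[OF this exp_flat_deriv[unfolded has_field_derivative_def]]
    show ?thesis by (simp add: mult.commute)
  qed
  have "partial_deriv b (\<lambda>x. exp_flat k (x \<bullet> v + \<beta>)) =
     (\<lambda>x. (b \<bullet> v) * (exp_flat (k + 2) (x \<bullet> v + \<beta>) + (- real k) * exp_flat (k + 1) (x \<bullet> v + \<beta>)))" for b
    using partial_deriv_has_derivative[OF d] by auto
  moreover have "C_k n (\<lambda>x. (b \<bullet> v) * (exp_flat (k + 2) (x \<bullet> v + \<beta>) + (- real k) * exp_flat (k + 1) (x \<bullet> v + \<beta>)))" for b
    by (intro C_k_mult C_k_add C_k_const Suc.IH)
  ultimately show ?case using d unfolding C_k.simps by (auto simp: differentiable_def)
qed

text \<open>One rising and one falling flat factor per coordinate. The parameter n steepens the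
  flanks: as it grows, the product tends to the indicator of the open box with corners a and
  c.\<close>

definition bump :: "real \<Rightarrow> 'a::euclidean_space \<Rightarrow> 'a \<Rightarrow> 'a \<Rightarrow> real" where
  "bump n a c x = (\<Prod>b\<in>Basis. exp_flat 0 (n * (x \<bullet> b - a \<bullet> b)) * exp_flat 0 (n * (c \<bullet> b - x \<bullet> b)))"

lemma exp_flat_0_bounds: "0 \<le> exp_flat 0 t" "exp_flat 0 t \<le> 1"
  by (auto simp: exp_flat_def)

lemma bump_bounds: "0 \<le> bump n a c x" "bump n a c x \<le> 1"
  unfolding bump_def
  by (auto intro!: prod_nonneg prod_le_1 mult_nonneg_nonneg mult_le_one exp_flat_0_bounds)

lemma bump_eq_0: assumes "n > 0" "x \<notin> box a c" shows "bump n a c x = 0"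
proof -
  obtain b where "b \<in> Basis" "x \<bullet> b - a \<bullet> b \<le> 0 \<or> c \<bullet> b - x \<bullet> b \<le> 0" using assms(2) by (force simp: mem_box)
  thus ?thesis unfolding bump_def using assms(1)
    by (intro prod_zero) (auto simp: exp_flat_def mult_le_0_iff zero_less_mult_iff intro!: bexI[of _ b])
qed

lemma test_function_bump: assumes "n > 0" shows "test_function (bump n a c)"
proof -
  have 1: "exp_flat 0 (n * (x \<bullet> b - a \<bullet> b)) = exp_flat 0 (x \<bullet> (n *\<^sub>R b) + (- n * (a \<bullet> b)))"
    and 2: "exp_flat 0 (n * (c \<bullet> b - x \<bullet> b)) = exp_flat 0 (x \<bullet> (- n *\<^sub>R b) + n * (c \<bullet> b))" for x b
    by (simp_all add: algebra_simps)
  have C: "C_k k (bump n a c)" for k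
    unfolding bump_def 1 2 by (intro C_k_prod C_k_mult C_k_exp_flat) simp
  obtain R where "\<And>x. x \<in> box a c \<Longrightarrow> norm x \<le> R" using bounded_box[of a c] by (auto simp: bounded_iff)
  hence "norm x > R \<longrightarrow> bump n a c x = 0" for x using bump_eq_0[OF assms, of x a c] by force
  with C[of 0] have "cc (bump n a c)" by (auto simp: cc_def)
  thus ?thesis using C by (simp add: test_function_iff)
qed

lemma bump_tendsto: "(\<lambda>n. bump (real (Suc n)) a c x) \<longlonglongrightarrow> indicator (box a c) x"
proof (cases "x \<in> box a c")
  case False
  thus ?thesis using bump_eq_0[of "real (Suc _)" x a c] by simp
next
  case True
  have e: "(\<lambda>n. exp_flat 0 (real (Suc n) * t)) \<longlonglongrightarrow> 1" if "t > 0" for t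
  proof -
    have "(\<lambda>n. 1 / exp ((1 / t) * (1 / real (Suc n)))) \<longlonglongrightarrow> 1 / exp ((1 / t) * 0)"
      by (intro tendsto_intros LIMSEQ_Suc lim_1_over_n) auto
    thus ?thesis using that by (simp add: exp_flat_def mult.commute)
  qed
  have "(\<lambda>n. exp_flat 0 (real (Suc n) * (x \<bullet> b - a \<bullet> b)) * exp_flat 0 (real (Suc n) * (c \<bullet> b - x \<bullet> b))) \<longlonglongrightarrow> 1 * 1"
    if "b \<in> Basis" for b
    using True that by (intro tendsto_mult e) (auto simp: mem_box)
  hence "(\<lambda>n. bump (real (Suc n)) a c x) \<longlonglongrightarrow> (\<Prod>b\<in>(Basis::'a set). 1 * 1)"
    unfolding bump_def by (rule Limits.tendsto_prod)
  thus ?thesis using True by simp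
qed

text \<open>The fundamental lemma of the calculus of variations. Bumps approximate indicators, so
  all integrals of f over boxes vanish. Boxes form an intersection-stable generator, hence the
  measures whose densities are the positive and the negative part of f coincide.\<close>

lemma AE_eq_0_if_orthogonal_to_test_functions:
  fixes f :: "'a::euclidean_space \<Rightarrow> real"
  assumes [measurable]: "f \<in> borel_measurable borel"
    and int: "\<And>R. integrable lborel (\<lambda>x. indicator (cball 0 R) x * f x)"
    and orth: "\<And>\<phi>. test_function \<phi> \<Longrightarrow> (\<integral>x. f x * \<phi> x \<partial>lborel) = 0"
  shows "AE x in lborel. f x = 0"
proof -
  have ibox: "integrable lborel (\<lambda>x. indicator (box a c) x * f x)" for a c
  proof -
    obtain R where R: "\<And>x. x \<in> box a c \<Longrightarrow> norm x \<le> R" using bounded_box[of a c] by (auto simp: bounded_iff)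
    show ?thesis
      by (rule Bochner_Integration.integrable_bound[OF int[of R]]) (use R in \<open>auto simp: indicator_def\<close>)
  qed
  have 0: "(\<integral>x. indicator (box a c) x * f x \<partial>lborel) = 0" for a c
  proof -
    have "(\<lambda>n. \<integral>x. f x * bump (real (Suc n)) a c x \<partial>lborel) \<longlonglongrightarrow> (\<integral>x. f x * indicator (box a c) x \<partial>lborel)"
    proof (rule integral_dominated_convergence)
      show "integrable lborel (\<lambda>x. \<bar>indicator (box a c) x * f x\<bar>)" using ibox by (rule integrable_abs)
      show "(\<lambda>x. f x * bump (real (Suc n)) a c x) \<in> borel_measurable lborel" for n
        using cc_measurable[OF test_function_cc[OF test_function_bump[of "real (Suc n)" a c]]] by simp
      show "AE x in lborel. (\<lambda>n. f x * bump (real (Suc n)) a c x) \<longlonglongrightarrow> f x * indicator (box a c) x"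
        by (intro AE_I2 tendsto_mult tendsto_const bump_tendsto)
      show "AE x in lborel. norm (f x * bump (real (Suc n)) a c x) \<le> \<bar>indicator (box a c) x * f x\<bar>" for n
        using bump_eq_0[of "real (Suc n)" _ a c] bump_bounds[of "real (Suc n)" a c]
        by (intro AE_I2) (auto simp: indicator_def abs_mult mult_left_le)
    qed simp
    moreover have "(\<integral>x. f x * bump (real (Suc n)) a c x \<partial>lborel) = 0" for n
      by (intro orth test_function_bump) simp
    ultimately show ?thesis by (simp add: LIMSEQ_const_iff mult.commute)
  qed
  have sig: "sigma_finite_measure (density lborel (\<lambda>x. ennreal (f x)))"
    by (subst sigma_finite_measure.sigma_finite_iff_density_finite[OF sigma_finite_lborel]) auto
  \<comment> \<open>\<open>ennreal\<close> sends negative numbers to 0, so the two densities are the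
    positive and the negative part of f.\<close>
  have eq: "density lborel (\<lambda>x. ennreal (f x)) = density lborel (\<lambda>x. ennreal (- f x))"
  proof (rule measure_eqI_generator_eq)
    let ?E = "range (\<lambda>(a, b). box a b::'a set)"
    show "Int_stable ?E"
      by (auto simp: Int_stable_def box_Int_box)
    show "?E \<subseteq> Pow UNIV" "sets (density lborel (\<lambda>x. ennreal (f x))) = sigma_sets UNIV ?E"
      "sets (density lborel (\<lambda>x. ennreal (- f x))) = sigma_sets UNIV ?E"
      by (simp_all add: borel_eq_box)
    let ?A = "\<lambda>n::nat. box (- (real n *\<^sub>R One)) (real n *\<^sub>R One) :: 'a set"
    show "range ?A \<subseteq> ?E" "(\<Union>i. ?A i) = UNIV"
      unfolding UN_box_eq_UNIV by auto
    have em: "emeasure (density lborel (\<lambda>x. ennreal (g x))) (box a c) = (\<integral>\<^sup>+x. ennreal (indicator (box a c) x * g x) \<partial>lborel)"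
      if [measurable]: "g \<in> borel_measurable borel" for g a c
      by (subst emeasure_density) (auto intro!: nn_integral_cong simp: indicator_def)
    have fin: "(\<integral>\<^sup>+x. ennreal (indicator (box a c) x * f x) \<partial>lborel) \<noteq> \<infinity>"
      "(\<integral>\<^sup>+x. ennreal (indicator (box a c) x * (- f x)) \<partial>lborel) \<noteq> \<infinity>" for a c
      using ibox[of a c] by (auto simp: real_integrable_def)
    show "emeasure (density lborel (\<lambda>x. ennreal (f x))) (?A i) \<noteq> \<infinity>" for i
      using fin by (simp add: em)
    fix X assume "X \<in> ?E"
    then obtain a c where X: "X = box a c" by auto
    have e: "I = J" if "0 = enn2real I - enn2real J" "I \<noteq> \<infinity>" "J \<noteq> \<infinity>" for I J :: ennreal
    proof -
      have "ennreal (enn2real I) = I" "ennreal (enn2real J) = J"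
        using that(2,3) by (auto intro!: ennreal_enn2real simp: less_top)
      thus ?thesis using that(1) by (metis eq_iff_diff_eq_0)
    qed
    have "0 = enn2real (\<integral>\<^sup>+x. ennreal (indicator (box a c) x * f x) \<partial>lborel)
        - enn2real (\<integral>\<^sup>+x. ennreal (indicator (box a c) x * (- f x)) \<partial>lborel)"
      using 0[of a c] ibox[of a c] by (simp add: real_lebesgue_integral_def)
    hence "(\<integral>\<^sup>+x. ennreal (indicator (box a c) x * f x) \<partial>lborel)
        = (\<integral>\<^sup>+x. ennreal (indicator (box a c) x * (- f x)) \<partial>lborel)"
      by (rule e[OF _ fin])
    thus "emeasure (density lborel (\<lambda>x. ennreal (f x))) X = emeasure (density lborel (\<lambda>x. ennreal (- f x))) X"
      unfolding X by (subst (1 2) em) auto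
  qed
  have "AE x in lborel. ennreal (f x) = ennreal (- f x)"
    using eq by (subst (asm) sigma_finite_density_unique[OF _ _ sig]) auto
  thus ?thesis
  proof eventually_elim
    fix x assume eq: "ennreal (f x) = ennreal (- f x)"
    show "f x = 0"
    proof (cases "f x \<ge> 0")
      case True
      hence "ennreal (f x) = 0" unfolding eq by (simp add: ennreal_neg)
      with True show ?thesis by simp
    next
      case False
      hence "ennreal (- f x) = 0" unfolding eq[symmetric] by (simp add: ennreal_neg)
      with False show ?thesis by simp
    qed
  qed
qed

section \<open>Weak gradients along lines\<close>

text \<open>The gradient is explicit data here. Carrying the pair postpones the arbitrary choice
  inside \<open>weak_gradient\<close> to the very end, and sums, translations and limits act on both
  components at once.\<close>

definition sobolev :: "('a::euclidean_space \<Rightarrow> real) \<Rightarrow> ('a \<Rightarrow> 'a) \<Rightarrow> bool" where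
  "sobolev u G \<longleftrightarrow> L2 u \<and> L2 G \<and>
     (\<forall>b\<in>Basis. \<forall>\<phi>. test_function \<phi> \<longrightarrow>
        (\<integral>x. u x * partial_deriv b \<phi> x \<partial>lborel) = - (\<integral>x. (G x \<bullet> b) * \<phi> x \<partial>lborel))"

lemma sobolev_L2: "sobolev u G \<Longrightarrow> L2 u" "sobolev u G \<Longrightarrow> L2 G"
  and sobolev_ibp: "sobolev u G \<Longrightarrow> b \<in> Basis \<Longrightarrow> test_function \<phi> \<Longrightarrow>
     (\<integral>x. u x * partial_deriv b \<phi> x \<partial>lborel) = - (\<integral>x. (G x \<bullet> b) * \<phi> x \<partial>lborel)"
  by (auto simp: sobolev_def)

lemma L2_inner: assumes "L2 G" shows "L2 (\<lambda>x. G x \<bullet> z)"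
proof -
  note [measurable] = L2_measurable[OF assms]
  have "integrable lborel (\<lambda>x. (norm z)\<^sup>2 * (norm (G x))\<^sup>2)"
    by (rule integrable_mult_right[OF L2_integrable[OF assms]])
  hence "integrable lborel (\<lambda>x. (norm (G x \<bullet> z))\<^sup>2)"
  proof (rule Bochner_Integration.integrable_bound)
    show "AE x in lborel. norm ((norm (G x \<bullet> z))\<^sup>2) \<le> norm ((norm z)\<^sup>2 * (norm (G x))\<^sup>2)"
    proof (rule AE_I2)
      fix x
      have "(norm (G x \<bullet> z))\<^sup>2 \<le> (norm (G x) * norm z)\<^sup>2"
        by (intro power_mono) (auto simp: Cauchy_Schwarz_ineq2)
      thus "norm ((norm (G x \<bullet> z))\<^sup>2) \<le> norm ((norm z)\<^sup>2 * (norm (G x))\<^sup>2)"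
        by (simp add: power_mult_distrib mult.commute)
    qed
  qed measurable
  thus ?thesis by (simp add: L2_def)
qed

lemma L2_mult_integrable: "L2 f \<Longrightarrow> L2 g \<Longrightarrow> integrable lborel (\<lambda>x. f x * g x :: real)"
  using L2_integrable_inner(1)[of f g] by simp

lemma L2_indicator_cball: "L2 (indicator (cball c R) :: 'a::euclidean_space \<Rightarrow> real)"
proof -
  have "(\<lambda>x. (norm (indicator (cball c R) x :: real))\<^sup>2) = (indicator (cball c R) :: 'a \<Rightarrow> real)"
    by (auto simp: indicator_def)
  thus ?thesis unfolding L2_def
    using emeasure_lborel_cball_finite[of c R] by (auto intro!: integrable_real_indicator borel_measurable_indicator)
qed

text \<open>Two different shifts are allowed because in the applications one factor moves along the
  segment while the other stays at x, with shift 0.\<close>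

lemma integrable_L2_along_segment:
  fixes f g :: "'a::euclidean_space \<Rightarrow> real"
  assumes "L2 f" "L2 g"
  shows "integrable (lborel \<Otimes>\<^sub>M lborel) (\<lambda>(s::real, x). indicator {0..1} s * (f (x + s *\<^sub>R a) * g (x + s *\<^sub>R b)))"
proof -
  note [measurable] = assms[THEN L2_measurable]
  have main: "integrable (lborel \<Otimes>\<^sub>M lborel) (\<lambda>(s::real, x). indicator {0..1} s * (h (x + s *\<^sub>R c))\<^sup>2)"
    if h: "L2 h" for h :: "'a \<Rightarrow> real" and c
  proof (rule lborel_pair.Fubini_integrable)
    note [measurable] = L2_measurable[OF h]
    show "(\<lambda>(s::real, x). indicator {0..1} s * (h (x + s *\<^sub>R c))\<^sup>2) \<in> borel_measurable (lborel \<Otimes>\<^sub>M lborel)"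
      by measurable
    have i: "integrable lborel (\<lambda>x. (h (x + z))\<^sup>2)" and e: "(\<integral>x. (h (x + z))\<^sup>2 \<partial>lborel) = nsq h" for z
      using L2_integrable[OF L2_translate[OF h, of z]] nsq_translate[OF h, of z] by (auto simp: nsq_def)
    have "(\<lambda>s::real. \<integral>x. norm (indicator {0..1} s * (h (x + s *\<^sub>R c))\<^sup>2) \<partial>lborel) = (\<lambda>s. indicator {0..1} s * nsq h)"
      by (auto simp: e abs_mult)
    thus "integrable lborel (\<lambda>s::real. \<integral>x. norm (case (s, x) of (s, x) \<Rightarrow> indicator {0..1} s * (h (x + s *\<^sub>R c))\<^sup>2) \<partial>lborel)"
      by simp
    show "AE s in lborel. integrable lborel (\<lambda>x. case (s, x) of (s::real, x) \<Rightarrow> indicator {0..1} s * (h (x + s *\<^sub>R c))\<^sup>2)"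
      using i by simp
  qed
  have "integrable (lborel \<Otimes>\<^sub>M lborel) (\<lambda>p. (case p of (s::real, x) \<Rightarrow> indicator {0..1} s * (f (x + s *\<^sub>R a))\<^sup>2)
      + (case p of (s, x) \<Rightarrow> indicator {0..1} s * (g (x + s *\<^sub>R b))\<^sup>2))"
    using main[OF assms(1)] main[OF assms(2)] by (rule Bochner_Integration.integrable_add)
  thus ?thesis
  proof (rule Bochner_Integration.integrable_bound)
    have "\<bar>p * q\<bar> \<le> p\<^sup>2 + q\<^sup>2" for p q :: real
    proof -
      have "0 \<le> (\<bar>p\<bar> - \<bar>q\<bar>)\<^sup>2" "0 \<le> \<bar>p\<bar> * \<bar>q\<bar>" by simp_all
      thus ?thesis unfolding power2_diff abs_mult power2_abs by linarith
    qed
    thus "AE p in lborel \<Otimes>\<^sub>M lborel. norm (case p of (s, x) \<Rightarrow> indicator {0..1} s * (f (x + s *\<^sub>R a) * g (x + s *\<^sub>R b)))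
        \<le> norm ((case p of (s, x) \<Rightarrow> indicator {0..1} s * (f (x + s *\<^sub>R a))\<^sup>2)
      + (case p of (s, x) \<Rightarrow> indicator {0..1} s * (g (x + s *\<^sub>R b))\<^sup>2))"
      by (intro AE_I2) (auto simp: indicator_def)
  qed measurable
qed

lemma integral_swap_segment:
  fixes f g :: "'a::euclidean_space \<Rightarrow> real"
  assumes "L2 f" "L2 g"
  shows "(\<integral>x. (\<integral>s. indicator {0..1} s * (f (x + s *\<^sub>R a) * g (x + s *\<^sub>R b)) \<partial>lborel) \<partial>lborel)
       = (\<integral>s. indicator {0..1} s * (\<integral>x. f (x + s *\<^sub>R a) * g (x + s *\<^sub>R b) \<partial>lborel) \<partial>lborel)"
  using lborel_pair.Fubini_integral[OF integrable_L2_along_segment[OF assms, of a b]]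
  by simp

lemma FTC_segment:
  fixes f :: "'a::euclidean_space \<Rightarrow> real"
  assumes "C_k (Suc 0) f"
  shows "f (x + z) - f x = (\<integral>s. indicator {0..1} s * (\<Sum>b\<in>Basis. (z \<bullet> b) * partial_deriv b f (x + s *\<^sub>R z)) \<partial>lborel)"
proof -
  have d: "f differentiable at y" and c: "b \<in> Basis \<Longrightarrow> continuous_on UNIV (partial_deriv b f)" for y b
    using assms by auto
  have "(\<integral>s. (\<Sum>b\<in>Basis. (z \<bullet> b) * partial_deriv b f (x + s *\<^sub>R z)) * indicator {0..1} s \<partial>lborel)
      = f (x + 1 *\<^sub>R z) - f (x + 0 *\<^sub>R z)"
  proof (rule integral_FTC_Icc_real)
    fix s :: real
    have "((\<lambda>s. x + s *\<^sub>R z) has_derivative (\<lambda>h. h *\<^sub>R z)) (at s)" by (auto intro!: derivative_eq_intros)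
    moreover have "(f has_derivative frechet_derivative f (at (x + s *\<^sub>R z))) (at (x + s *\<^sub>R z))"
      using d by (simp add: frechet_derivative_works[symmetric])
    ultimately have "((\<lambda>s. f (x + s *\<^sub>R z)) has_derivative (\<lambda>h. frechet_derivative f (at (x + s *\<^sub>R z)) (h *\<^sub>R z))) (at s)"
      by (rule has_derivative_compose)
    moreover have "frechet_derivative f (at (x + s *\<^sub>R z)) (h *\<^sub>R z) = (\<Sum>b\<in>Basis. (z \<bullet> b) * partial_deriv b f (x + s *\<^sub>R z)) * h" for h
      unfolding frechet_derivative_eq_sum_partial[OF d] by (simp add: sum_distrib_left sum_distrib_right mult_ac)
    ultimately show "((\<lambda>s. f (x + s *\<^sub>R z)) has_real_derivative (\<Sum>b\<in>Basis. (z \<bullet> b) * partial_deriv b f (x + s *\<^sub>R z))) (at s)"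
      by (simp add: has_field_derivative_def mult_commute_abs)
    have "continuous_on UNIV (\<lambda>s::real. \<Sum>b\<in>Basis. (z \<bullet> b) * partial_deriv b f (x + s *\<^sub>R z))"
      by (intro continuous_on_sum continuous_on_mult continuous_on_const
         continuous_on_compose2[OF c, of _ UNIV "\<lambda>s. x + s *\<^sub>R z"] continuous_intros) auto
    thus "isCont (\<lambda>s. \<Sum>b\<in>Basis. (z \<bullet> b) * partial_deriv b f (x + s *\<^sub>R z)) s"
      by (simp add: continuous_on_eq_continuous_at)
  qed simp
  thus ?thesis by (simp add: mult.commute)
qed

text \<open>The increment f(x + b) - f(x) integrates to zero by translation invariance. Written as
  an integral of the derivative over a segment, with the order of integration exchanged, the same
  quantity is the integral of the derivative.\<close>

lemma integral_partial_deriv_eq_0: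
  assumes "C_k (Suc 0) f" "cc f" "b \<in> Basis"
  shows "(\<integral>x. partial_deriv b f x \<partial>lborel) = 0"
proof -
  let ?d = "partial_deriv b f"
  have cd: "cc ?d" by (rule cc_partial_deriv[OF assms])
  note m [measurable] = cc_measurable[OF cd] cc_measurable[OF assms(2)]
  obtain R where R: "\<And>x. norm x > R \<Longrightarrow> ?d x = 0" using cd by (auto simp: cc_def)
  \<comment> \<open>Equal to 1 wherever the shifted derivative is nonzero: the shift by
    \<open>s *\<^sub>R b\<close> has length at most 1, whence R + 1. The indicator supplies the
    second square integrable factor for the exchange of integrals.\<close>
  define h :: "'a \<Rightarrow> real" where "h = indicator (cball 0 (R + 1))"
  have hL: "L2 h" unfolding h_def by (rule L2_indicator_cball)
  have "0 = (\<integral>x. f (x + b) - f x \<partial>lborel)"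
    using cc_integrable[OF assms(2)] by (simp add: integrable_translate_iff integral_translate)
  also have "\<dots> = (\<integral>x. (\<integral>s. indicator {0..1} s * (h (x + s *\<^sub>R 0) * ?d (x + s *\<^sub>R b)) \<partial>lborel) \<partial>lborel)"
  proof (intro Bochner_Integration.integral_cong refl)
    fix x :: 'a
    have "?d (x + s *\<^sub>R b) = h x * ?d (x + s *\<^sub>R b)" if "s \<in> {0..1}" for s
    proof (cases "norm x \<le> R + 1")
      case False
      have "norm (s *\<^sub>R b) \<le> 1" using that assms(3) by simp
      hence "norm (x + s *\<^sub>R b) > R" using False norm_triangle_ineq4[of "x + s *\<^sub>R b" "s *\<^sub>R b"] by simp
      thus ?thesis using R by simp
    qed (simp add: h_def)
    moreover have "(\<Sum>c\<in>Basis. (b \<bullet> c) * partial_deriv c f y) = ?d y" for y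
      using assms(3) by (simp add: inner_Basis if_distrib[of "\<lambda>x. x * _"] cong: if_cong)
    ultimately show "f (x + b) - f x = (\<integral>s. indicator {0..1} s * (h (x + s *\<^sub>R 0) * ?d (x + s *\<^sub>R b)) \<partial>lborel)"
      unfolding FTC_segment[OF assms(1)]
      by (intro Bochner_Integration.integral_cong refl) (auto simp: indicator_def)
  qed
  also have "\<dots> = (\<integral>s. indicator {0..1} s * (\<integral>x. h (x + s *\<^sub>R 0) * ?d (x + s *\<^sub>R b) \<partial>lborel) \<partial>lborel)"
    by (rule integral_swap_segment[OF hL cc_L2[OF cd]])
  also have "\<dots> = (\<integral>s. indicator {0..1} s * (\<integral>x. ?d x \<partial>lborel) \<partial>(lborel::real measure))"
  proof (intro Bochner_Integration.integral_cong refl)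
    fix s :: real
    have hd: "h x * ?d (x + s *\<^sub>R b) = ?d (x + s *\<^sub>R b)" if "s \<in> {0..1}" for x
    proof (cases "norm x \<le> R + 1")
      case False
      have "norm (s *\<^sub>R b) \<le> 1" using that assms(3) by simp
      hence "norm (x + s *\<^sub>R b) > R" using False norm_triangle_ineq4[of "x + s *\<^sub>R b" "s *\<^sub>R b"] by simp
      thus ?thesis using R by simp
    qed (simp add: h_def)
    have "(\<integral>x. h x * ?d (x + s *\<^sub>R b) \<partial>lborel) = (\<integral>x. ?d x \<partial>lborel)" if "s \<in> {0..1}"
      unfolding hd[OF that] by (rule integral_translate[OF m(1)])
    thus "indicator {0..1} s * (\<integral>x. h (x + s *\<^sub>R 0) * ?d (x + s *\<^sub>R b) \<partial>lborel) = indicator {0..1} s * (\<integral>x. ?d x \<partial>lborel)"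
      by (cases "s \<in> {0..1}") simp_all
  qed
  finally show ?thesis by simp
qed

text \<open>Integration by parts: the partial derivatives of a product of two test functions
  integrate to zero.\<close>

lemma test_function_sobolev:
  assumes "test_function f"
  shows "sobolev f (\<lambda>x. \<Sum>b\<in>Basis. partial_deriv b f x *\<^sub>R b)"
  unfolding sobolev_def
proof (intro conjI ballI allI impI)
  show "L2 f" using assms by (intro cc_L2 test_function_cc)
  have L: "L2 (\<lambda>x. partial_deriv b f x)" if "b \<in> Basis" for b
    using assms that by (intro cc_L2 test_function_cc_partial)
  have [measurable]: "partial_deriv b f \<in> borel_measurable borel" if "b \<in> Basis" for b
    using L2_measurable[OF L[OF that]] .
  have e: "(norm (\<Sum>b\<in>Basis. partial_deriv b f x *\<^sub>R b))\<^sup>2 = (\<Sum>b\<in>Basis. (norm (partial_deriv b f x))\<^sup>2)" for x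
    unfolding power2_norm_eq_inner
    by (subst euclidean_inner) (simp add: inner_sum_left inner_Basis if_distrib power2_eq_square cong: if_cong)
  show "L2 (\<lambda>x. \<Sum>b\<in>Basis. partial_deriv b f x *\<^sub>R b)"
    unfolding L2_def e using L by (auto intro!: Bochner_Integration.integrable_sum simp: L2_def)
  fix b :: 'a and \<phi> :: "'a \<Rightarrow> real" assume b: "b \<in> Basis" and \<phi>: "test_function \<phi>"
  have "C_k (Suc 0) (\<lambda>x. f x * \<phi> x)" using assms \<phi> unfolding test_function_iff by (intro C_k_mult) auto
  moreover have "cc (\<lambda>x. f x * \<phi> x)"
    using assms \<phi> by (intro cc_mult test_function_cc cc_continuous)
  ultimately have "0 = (\<integral>x. partial_deriv b (\<lambda>x. f x * \<phi> x) x \<partial>lborel)"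
    using integral_partial_deriv_eq_0 b by metis
  also have "\<dots> = (\<integral>x. f x * partial_deriv b \<phi> x + partial_deriv b f x * \<phi> x \<partial>lborel)"
    using assms \<phi> by (simp add: partial_deriv_mult test_function_differentiable)
  also have "\<dots> = (\<integral>x. f x * partial_deriv b \<phi> x \<partial>lborel) + (\<integral>x. partial_deriv b f x * \<phi> x \<partial>lborel)"
    using assms \<phi> b by (intro Bochner_Integration.integral_add L2_mult_integrable cc_L2 test_function_cc test_function_cc_partial)
  finally show "(\<integral>x. f x * partial_deriv b \<phi> x \<partial>lborel)
      = - (\<integral>x. ((\<Sum>b\<in>Basis. partial_deriv b f x *\<^sub>R b) \<bullet> b) * \<phi> x \<partial>lborel)"
    using b by (simp add: inner_sum_left inner_Basis if_distrib cong: if_cong)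
qed

text \<open>Linearity in the direction, together with testing against a translate of \<phi>.\<close>

lemma sobolev_ibp_direction:
  assumes "sobolev u G" "test_function \<phi>"
  shows "(\<integral>x. u x * (\<Sum>b\<in>Basis. (z \<bullet> b) * partial_deriv b \<phi> (x + y)) \<partial>lborel) = - (\<integral>x. (G x \<bullet> z) * \<phi> (x + y) \<partial>lborel)"
proof -
  define \<psi> where "\<psi> x = \<phi> (1 *\<^sub>R x + y)" for x
  have \<psi>: "test_function \<psi>" unfolding \<psi>_def by (rule test_function_affine[OF assms(2)]) simp
  have p: "partial_deriv b \<psi> x = partial_deriv b \<phi> (x + y)" for b x
    using partial_deriv_affine[of \<phi> 1 x y b] test_function_differentiable[OF assms(2)]
    by (simp add: \<psi>_def[abs_def])
  have "(\<integral>x. u x * (\<Sum>b\<in>Basis. (z \<bullet> b) * partial_deriv b \<phi> (x + y)) \<partial>lborel)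
      = (\<integral>x. (\<Sum>b\<in>Basis. (z \<bullet> b) * (u x * partial_deriv b \<psi> x)) \<partial>lborel)"
    by (simp add: p sum_distrib_left mult_ac)
  also have "\<dots> = (\<Sum>b\<in>Basis. (z \<bullet> b) * (\<integral>x. u x * partial_deriv b \<psi> x \<partial>lborel))"
    using L2_mult_integrable[OF sobolev_L2(1)[OF assms(1)] cc_L2[OF test_function_cc_partial[OF \<psi>]]]
    by (subst Bochner_Integration.integral_sum) auto
  also have "\<dots> = (\<Sum>b\<in>Basis. (z \<bullet> b) * (- (\<integral>x. (G x \<bullet> b) * \<psi> x \<partial>lborel)))"
    using sobolev_ibp[OF assms(1) _ \<psi>] by simp
  also have "\<dots> = - (\<integral>x. (\<Sum>b\<in>Basis. (z \<bullet> b) * ((G x \<bullet> b) * \<psi> x)) \<partial>lborel)"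
    using L2_mult_integrable[OF L2_inner[OF sobolev_L2(2)[OF assms(1)]] cc_L2[OF test_function_cc[OF \<psi>]]]
    by (subst Bochner_Integration.integral_sum) (auto simp: sum_negf)
  also have "(\<lambda>x. \<Sum>b\<in>Basis. (z \<bullet> b) * ((G x \<bullet> b) * \<psi> x)) = (\<lambda>x. (G x \<bullet> z) * \<phi> (x + y))"
    by (auto simp: \<psi>_def euclidean_inner[of "G _" z] sum_distrib_right sum_distrib_left mult_ac intro!: sum.cong)
  finally show ?thesis .
qed

lemma ennreal_integral_segment_square_le:
  fixes g :: "real \<Rightarrow> real"
  assumes [measurable]: "g \<in> borel_measurable borel"
  shows "ennreal ((\<integral>s. indicator {0..1} s * g s \<partial>lborel)\<^sup>2) \<le> (\<integral>\<^sup>+s. indicator {0..1} s * ennreal ((g s)\<^sup>2) \<partial>lborel)"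
proof -
  \<comment> \<open>If the integrand is not integrable, the left-hand side is 0 by the convention
    for the Bochner integral.\<close>
  have "ennreal \<bar>\<integral>s. indicator {0..1} s * g s \<partial>lborel\<bar> \<le> (\<integral>\<^sup>+s. indicator {0..1} s * ennreal \<bar>g s\<bar> \<partial>lborel)"
  proof (cases "integrable lborel (\<lambda>s. indicator {0..1} s * g s)")
    case True
    from integral_norm_bound_ennreal[OF this]
    have "ennreal \<bar>\<integral>s. indicator {0..1} s * g s \<partial>lborel\<bar> \<le> (\<integral>\<^sup>+s. ennreal \<bar>indicator {0..1} s * g s\<bar> \<partial>lborel)" by simp
    also have "\<dots> = (\<integral>\<^sup>+s. indicator {0..1} s * ennreal \<bar>g s\<bar> \<partial>lborel)"
      by (intro nn_integral_cong) (auto simp: indicator_def)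
    finally show ?thesis .
  qed (simp add: not_integrable_integral_eq)
  hence "(ennreal \<bar>\<integral>s. indicator {0..1} s * g s \<partial>lborel\<bar>)\<^sup>2 \<le> (\<integral>\<^sup>+s. indicator {0..1} s * ennreal \<bar>g s\<bar> \<partial>lborel)\<^sup>2"
    by (rule power_mono) simp
  also have "\<dots> \<le> (\<integral>\<^sup>+s. indicator {0..1::real} s \<partial>lborel) * (\<integral>\<^sup>+s. indicator {0..1} s * ennreal ((g s)\<^sup>2) \<partial>lborel)"
    by (rule nn_integral_Cauchy_Schwarz) (auto simp: indicator_def ennreal_power)
  finally show ?thesis by (simp add: ennreal_power)
qed

lemma nn_integral_segment:
  assumes "L2 G"
  shows "(\<integral>\<^sup>+x. (\<integral>\<^sup>+s. indicator {0..1} s * ennreal ((G (x + s *\<^sub>R z) \<bullet> z)\<^sup>2) \<partial>(lborel::real measure)) \<partial>lborel)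
      \<le> ennreal ((norm z)\<^sup>2 * nsq G)"
proof -
  note [measurable] = L2_measurable[OF assms]
  have "(\<integral>\<^sup>+x. (\<integral>\<^sup>+s. indicator {0..1} s * ennreal ((G (x + s *\<^sub>R z) \<bullet> z)\<^sup>2) \<partial>(lborel::real measure)) \<partial>lborel)
      = (\<integral>\<^sup>+s. (\<integral>\<^sup>+x. indicator {0..1} s * ennreal ((G (x + s *\<^sub>R z) \<bullet> z)\<^sup>2) \<partial>lborel) \<partial>(lborel::real measure))"
    by (rule lborel_pair.Fubini') measurable
  also have "\<dots> \<le> (\<integral>\<^sup>+s. indicator {0..1} s * ennreal ((norm z)\<^sup>2 * nsq G) \<partial>(lborel::real measure))"
  proof (rule nn_integral_mono)
    fix s :: real
    have "(\<integral>\<^sup>+x. ennreal ((G (x + s *\<^sub>R z) \<bullet> z)\<^sup>2) \<partial>lborel) \<le> (\<integral>\<^sup>+x. ennreal ((norm z)\<^sup>2) * ennreal ((norm (G (x + s *\<^sub>R z)))\<^sup>2) \<partial>lborel)"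
    proof (rule nn_integral_mono)
      fix x
      have "\<bar>G (x + s *\<^sub>R z) \<bullet> z\<bar>\<^sup>2 \<le> (norm (G (x + s *\<^sub>R z)) * norm z)\<^sup>2"
        by (intro power_mono) (auto simp: Cauchy_Schwarz_ineq2)
      thus "ennreal ((G (x + s *\<^sub>R z) \<bullet> z)\<^sup>2) \<le> ennreal ((norm z)\<^sup>2) * ennreal ((norm (G (x + s *\<^sub>R z)))\<^sup>2)"
        by (simp add: ennreal_mult[symmetric] power_mult_distrib mult.commute)
    qed
    also have "\<dots> = ennreal ((norm z)\<^sup>2 * nsq G)"
      using nn_integral_nsq[OF L2_translate[OF assms]] nsq_translate[OF assms]
      by (simp add: nn_integral_cmult ennreal_mult)
    finally show "(\<integral>\<^sup>+x. indicator {0..1} s * ennreal ((G (x + s *\<^sub>R z) \<bullet> z)\<^sup>2) \<partial>lborel) \<le> indicator {0..1} s * ennreal ((norm z)\<^sup>2 * nsq G)"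
      by (auto simp: indicator_def)
  qed
  also have "\<dots> = ennreal ((norm z)\<^sup>2 * nsq G)" by (simp add: nn_integral_multc)
  finally show ?thesis .
qed

lemma L2_loc_integrable:
  fixes f :: "'a::euclidean_space \<Rightarrow> real"
  assumes "L2 f" shows "integrable lborel (\<lambda>x. indicator (cball 0 R) x * f x)"
  by (rule L2_mult_integrable[OF L2_indicator_cball assms])

text \<open>Both sides are tested against \<phi>. Moving the shift over to \<phi>, applying the
  fundamental theorem of calculus to \<phi> along the segment, integrating by parts in the direction
  z and shifting back turns the left-hand side into the right-hand side. No approximation of u by
  smooth functions enters.\<close>

lemma sobolev_line_identity:
  assumes "sobolev u G"
  shows "AE x in lborel. u (x + z) - u x = (\<integral>s. indicator {0..1} s * (G (x + s *\<^sub>R z) \<bullet> z) \<partial>lborel)"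
proof -
  have uL: "L2 u" and GL: "L2 G" using assms by (auto dest: sobolev_L2)
  note [measurable] = L2_measurable[OF uL] L2_measurable[OF GL]
  define \<gamma> where "\<gamma> x = (\<integral>s. indicator {0..1} s * (G (x + s *\<^sub>R z) \<bullet> z) \<partial>lborel)" for x
  have [measurable]: "\<gamma> \<in> borel_measurable borel"
    unfolding \<gamma>_def by measurable
  \<comment> \<open>Square integrability provides the local integrability that the fundamental lemma
    asks for.\<close>
  have \<gamma>L: "L2 \<gamma>"
  proof (rule nn_integral_imp_L2)
    have "(\<integral>\<^sup>+x. ennreal ((norm (\<gamma> x))\<^sup>2) \<partial>lborel) \<le> (\<integral>\<^sup>+x. (\<integral>\<^sup>+s. indicator {0..1} s * ennreal ((G (x + s *\<^sub>R z) \<bullet> z)\<^sup>2) \<partial>(lborel::real measure)) \<partial>lborel)"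
      unfolding \<gamma>_def real_norm_def power2_abs
      by (intro nn_integral_mono ennreal_integral_segment_square_le) measurable
    also note nn_integral_segment[OF GL]
    finally show "(\<integral>\<^sup>+x. ennreal ((norm (\<gamma> x))\<^sup>2) \<partial>lborel) \<le> ennreal ((norm z)\<^sup>2 * nsq G)" .
  qed auto
  have dL: "L2 (\<lambda>x. (u (x + z) - u x) - \<gamma> x)"
    by (intro L2_diff L2_translate uL \<gamma>L)
  have "AE x in lborel. (u (x + z) - u x) - \<gamma> x = 0"
  proof (rule AE_eq_0_if_orthogonal_to_test_functions)
    show "(\<lambda>x. (u (x + z) - u x) - \<gamma> x) \<in> borel_measurable borel" by measurable
    show "integrable lborel (\<lambda>x. indicator (cball 0 R) x * ((u (x + z) - u x) - \<gamma> x))" for R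
      by (rule L2_loc_integrable[OF dL])
    fix \<phi> :: "'a \<Rightarrow> real" assume \<phi>: "test_function \<phi>"
    have \<phi>L: "L2 \<phi>" using \<phi> by (intro cc_L2 test_function_cc)
    note [measurable] = L2_measurable[OF \<phi>L]
    \<comment> \<open>The derivative of \<phi> in the direction -z.\<close>
    define k where "k x = (\<Sum>b\<in>Basis. ((- z) \<bullet> b) * partial_deriv b \<phi> x)" for x
    have kL: "L2 k" unfolding k_def using \<phi> by (intro cc_L2 cc_sum cc_cmult test_function_cc_partial) auto
    have C1: "C_k (Suc 0) \<phi>" using \<phi> unfolding test_function_iff by blast
    have "(\<integral>x. (u (x + z) - u x) * \<phi> x \<partial>lborel) = (\<integral>x. u (x + z) * \<phi> x \<partial>lborel) - (\<integral>x. u x * \<phi> x \<partial>lborel)"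
      using L2_mult_integrable[OF L2_translate[OF uL] \<phi>L] L2_mult_integrable[OF uL \<phi>L] by (simp add: left_diff_distrib)
    also have "(\<integral>x. u (x + z) * \<phi> x \<partial>lborel) = (\<integral>x. u x * \<phi> (x + - z) \<partial>lborel)"
      using integral_translate[of "\<lambda>x. u x * \<phi> (x + - z)" z] by simp
    also have "(\<integral>x. u x * \<phi> (x + - z) \<partial>lborel) - (\<integral>x. u x * \<phi> x \<partial>lborel) = (\<integral>x. u x * (\<phi> (x + - z) - \<phi> x) \<partial>lborel)"
      using L2_mult_integrable[OF uL L2_translate[OF \<phi>L, of "-z"]] L2_mult_integrable[OF uL \<phi>L] by (simp add: right_diff_distrib)
    also have "\<dots> = (\<integral>x. (\<integral>s. indicator {0..1} s * (u (x + s *\<^sub>R 0) * k (x + s *\<^sub>R (- z))) \<partial>lborel) \<partial>lborel)"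
    proof (intro Bochner_Integration.integral_cong refl)
      fix x
      have "u x * (\<phi> (x + - z) - \<phi> x) = u x * (\<integral>s. indicator {0..1} s * k (x + s *\<^sub>R (- z)) \<partial>lborel)"
        unfolding FTC_segment[OF C1] k_def ..
      also have "\<dots> = (\<integral>s. u x * (indicator {0..1} s * k (x + s *\<^sub>R (- z))) \<partial>lborel)"
        by (rule integral_mult_right_zero[symmetric])
      finally show "u x * (\<phi> (x + - z) - \<phi> x) = (\<integral>s. indicator {0..1} s * (u (x + s *\<^sub>R 0) * k (x + s *\<^sub>R (- z))) \<partial>lborel)"
        by (simp add: mult_ac)
    qed
    also have "\<dots> = (\<integral>s. indicator {0..1} s * (\<integral>x. u (x + s *\<^sub>R 0) * k (x + s *\<^sub>R (- z)) \<partial>lborel) \<partial>lborel)"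
      by (rule integral_swap_segment[OF uL kL])
    also have "\<dots> = (\<integral>s. indicator {0..1} s * (\<integral>x. (G (x + s *\<^sub>R z) \<bullet> z) * \<phi> (x + s *\<^sub>R 0) \<partial>lborel) \<partial>lborel)"
    proof (rule Bochner_Integration.integral_cong[OF refl])
      fix s :: real
      have "(\<integral>x. u (x + s *\<^sub>R 0) * k (x + s *\<^sub>R (- z)) \<partial>lborel) = - (\<integral>x. (G x \<bullet> (- z)) * \<phi> (x + s *\<^sub>R (- z)) \<partial>lborel)"
        unfolding k_def using sobolev_ibp_direction[OF assms \<phi>, of "-z" "s *\<^sub>R (- z)"] by simp
      also have "\<dots> = (\<integral>x. (G x \<bullet> z) * \<phi> (x + - (s *\<^sub>R z)) \<partial>lborel)" by simp
      also have "\<dots> = (\<integral>x. (G (x + s *\<^sub>R z) \<bullet> z) * \<phi> (x + s *\<^sub>R 0) \<partial>lborel)"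
        using integral_translate[of "\<lambda>x. (G x \<bullet> z) * \<phi> (x + - (s *\<^sub>R z))" "s *\<^sub>R z"] by simp
      finally show "indicator {0..1} s * (\<integral>x. u (x + s *\<^sub>R 0) * k (x + s *\<^sub>R (- z)) \<partial>lborel)
          = indicator {0..1} s * (\<integral>x. (G (x + s *\<^sub>R z) \<bullet> z) * \<phi> (x + s *\<^sub>R 0) \<partial>lborel)"
        by (rule arg_cong)
    qed
    also have "\<dots> = (\<integral>x. (\<integral>s. indicator {0..1} s * ((G (x + s *\<^sub>R z) \<bullet> z) * \<phi> (x + s *\<^sub>R 0)) \<partial>lborel) \<partial>lborel)"
      by (rule integral_swap_segment[OF L2_inner[OF GL] \<phi>L, symmetric])
    also have "\<dots> = (\<integral>x. \<gamma> x * \<phi> x \<partial>lborel)"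
      unfolding \<gamma>_def by (simp add: mult.assoc[symmetric] del: mult.assoc)
    finally show "(\<integral>x. ((u (x + z) - u x) - \<gamma> x) * \<phi> x \<partial>lborel) = 0"
      using L2_mult_integrable[OF \<gamma>L \<phi>L] L2_mult_integrable[OF L2_diff[OF L2_translate[OF uL, of z] uL] \<phi>L]
      by (simp add: left_diff_distrib[of "u (_ + z) - u _"])
  qed
  thus ?thesis unfolding \<gamma>_def by eventually_elim simp
qed

lemma sobolev_line_square_le:
  assumes "sobolev u G"
  shows "AE x in lborel. ennreal ((u (x + z) - u x)\<^sup>2)
     \<le> (\<integral>\<^sup>+s. indicator {0..1} s * ennreal ((G (x + s *\<^sub>R z) \<bullet> z)\<^sup>2) \<partial>lborel)"
proof -
  note [measurable] = L2_measurable[OF sobolev_L2(2)[OF assms]]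
  show ?thesis using sobolev_line_identity[OF assms, of z]
    by eventually_elim (simp add: ennreal_integral_segment_square_le)
qed

text \<open>Translations are continuous in mean at a rate governed by the gradient alone; this is
  the input for compactness.\<close>

lemma nsq_translate_diff_le:
  assumes "sobolev u G"
  shows "nsq (\<lambda>x. u (x + z) - u x) \<le> (norm z)\<^sup>2 * nsq G"
proof (rule nn_integral_imp_L2(2))
  note [measurable] = L2_measurable[OF sobolev_L2(1)[OF assms]]
  show "(\<lambda>x. u (x + z) - u x) \<in> borel_measurable borel" by measurable
  have "(\<integral>\<^sup>+x. ennreal ((norm (u (x + z) - u x))\<^sup>2) \<partial>lborel)
    \<le> (\<integral>\<^sup>+x. (\<integral>\<^sup>+s. indicator {0..1} s * ennreal ((G (x + s *\<^sub>R z) \<bullet> z)\<^sup>2) \<partial>(lborel::real measure)) \<partial>lborel)"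
    using sobolev_line_square_le[OF assms, of z] by (intro nn_integral_mono_AE) simp
  also note nn_integral_segment[OF sobolev_L2(2)[OF assms]]
  finally show "(\<integral>\<^sup>+x. ennreal ((norm (u (x + z) - u x))\<^sup>2) \<partial>lborel) \<le> ennreal ((norm z)\<^sup>2 * nsq G)" .
qed simp

section \<open>The Gagliardo inequality for the square of a Sobolev function\<close>

text \<open>The integrand that remains after u(x)^2 is bounded by 2 u(x + t b)^2 plus twice the
  squared increment and t is averaged over (0, l]. The length l stays free; its optimization later
  turns the sum of the two norms into a product.\<close>

definition line_weight :: "real \<Rightarrow> ('a::euclidean_space \<Rightarrow> real) \<Rightarrow> ('a \<Rightarrow> 'a) \<Rightarrow> 'a \<Rightarrow> ennreal" where
  "line_weight l u G x = ennreal (2 / l * (u x)\<^sup>2 + 2 * l * (norm (G x))\<^sup>2)"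

lemma ennreal_mult_add_mult:
  "0 \<le> a \<Longrightarrow> 0 \<le> b \<Longrightarrow> 0 \<le> c \<Longrightarrow> 0 \<le> d \<Longrightarrow> ennreal (a * b + c * d) = ennreal a * ennreal b + ennreal c * ennreal d"
  by (simp add: ennreal_mult ennreal_plus)

lemma line_weight_measurable:
  assumes "sobolev u G" shows "line_weight l u G \<in> borel_measurable borel"
proof -
  note [measurable] = L2_measurable[OF sobolev_L2(1)[OF assms]] L2_measurable[OF sobolev_L2(2)[OF assms]]
  show ?thesis unfolding line_weight_def by measurable
qed

lemma nn_integral_line_weight:
  assumes "sobolev u G" "l > 0"
  shows "(\<integral>\<^sup>+x. line_weight l u G x \<partial>lborel) = ennreal (2 / l * nsq u + 2 * l * nsq G)"
proof -
  note [measurable] = L2_measurable[OF sobolev_L2(1)[OF assms(1)]] L2_measurable[OF sobolev_L2(2)[OF assms(1)]]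
  have "(\<integral>\<^sup>+x. line_weight l u G x \<partial>lborel)
      = (\<integral>\<^sup>+x. ennreal (2 / l) * ennreal ((norm (u x))\<^sup>2) + ennreal (2 * l) * ennreal ((norm (G x))\<^sup>2) \<partial>lborel)"
    unfolding line_weight_def real_norm_def power2_abs using assms(2) by (intro nn_integral_cong ennreal_mult_add_mult) auto
  also have "\<dots> = ennreal (2 / l) * ennreal (nsq u) + ennreal (2 * l) * ennreal (nsq G)"
  proof -
    have "(\<integral>\<^sup>+x. ennreal (2 / l) * ennreal ((norm (u x))\<^sup>2) + ennreal (2 * l) * ennreal ((norm (G x))\<^sup>2) \<partial>lborel)
        = (\<integral>\<^sup>+x. ennreal (2 / l) * ennreal ((norm (u x))\<^sup>2) \<partial>lborel) + (\<integral>\<^sup>+x. ennreal (2 * l) * ennreal ((norm (G x))\<^sup>2) \<partial>lborel)"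
      by (rule nn_integral_add) measurable
    also have "(\<integral>\<^sup>+x. ennreal (2 / l) * ennreal ((norm (u x))\<^sup>2) \<partial>lborel) = ennreal (2 / l) * (\<integral>\<^sup>+x. ennreal ((norm (u x))\<^sup>2) \<partial>lborel)"
      by (rule nn_integral_cmult) measurable
    also have "(\<integral>\<^sup>+x. ennreal (2 * l) * ennreal ((norm (G x))\<^sup>2) \<partial>lborel) = ennreal (2 * l) * (\<integral>\<^sup>+x. ennreal ((norm (G x))\<^sup>2) \<partial>lborel)"
      by (rule nn_integral_cmult) measurable
    finally show ?thesis unfolding nn_integral_nsq[OF sobolev_L2(1)[OF assms(1)]] nn_integral_nsq[OF sobolev_L2(2)[OF assms(1)]] .
  qed
  finally show ?thesis using assms(2) by (subst ennreal_mult_add_mult) auto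
qed

text \<open>For t in (0, l], Cauchy--Schwarz bounds the squared increment from x to x + t b by t
  times the integral of the squared gradient over the whole line through x. Averaging over t gives
  the claim.\<close>

lemma sobolev_square_le_line:
  fixes u :: "'a::euclidean_space \<Rightarrow> real"
  assumes s: "sobolev u G" and b: "b \<in> Basis" and l: "l > 0"
  shows "AE x in lborel. ennreal ((u x)\<^sup>2) \<le> (\<integral>\<^sup>+r. line_weight l u G (x + r *\<^sub>R b) \<partial>lborel)"
proof -
  note [measurable] = L2_measurable[OF sobolev_L2(1)[OF s]] L2_measurable[OF sobolev_L2(2)[OF s]]
  define Q where "Q x = (\<integral>\<^sup>+r. ennreal ((norm (G (x + r *\<^sub>R b)))\<^sup>2) \<partial>lborel)" for x
  have [measurable]: "Q \<in> borel_measurable borel" unfolding Q_def by measurable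
  have Qt: "(\<integral>\<^sup>+s. indicator {0..1} s * ennreal ((G (x + s *\<^sub>R (t *\<^sub>R b)) \<bullet> (t *\<^sub>R b))\<^sup>2) \<partial>lborel) \<le> ennreal t * Q x"
    if t: "t > 0" for t x
  proof -
    have "(\<integral>\<^sup>+s. indicator {0..1} s * ennreal ((G (x + s *\<^sub>R (t *\<^sub>R b)) \<bullet> (t *\<^sub>R b))\<^sup>2) \<partial>lborel)
        \<le> (\<integral>\<^sup>+s. ennreal (t\<^sup>2) * ennreal ((norm (G (x + (0 + t * s) *\<^sub>R b)))\<^sup>2) \<partial>lborel)"
    proof (rule nn_integral_mono)
      fix s :: real
      let ?g = "G (x + s *\<^sub>R (t *\<^sub>R b))"
      have "(?g \<bullet> (t *\<^sub>R b))\<^sup>2 \<le> (norm ?g * norm (t *\<^sub>R b))\<^sup>2"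
        using Cauchy_Schwarz_ineq2[of ?g "t *\<^sub>R b"] by (metis abs_ge_zero power2_abs power_mono)
      also have "\<dots> = t\<^sup>2 * (norm (G (x + (0 + t * s) *\<^sub>R b)))\<^sup>2"
        using b by (simp add: power_mult_distrib mult.commute)
      finally have "ennreal ((?g \<bullet> (t *\<^sub>R b))\<^sup>2) \<le> ennreal (t\<^sup>2) * ennreal ((norm (G (x + (0 + t * s) *\<^sub>R b)))\<^sup>2)"
        by (simp add: ennreal_mult[symmetric])
      thus "indicator {0..1} s * ennreal ((?g \<bullet> (t *\<^sub>R b))\<^sup>2) \<le> ennreal (t\<^sup>2) * ennreal ((norm (G (x + (0 + t * s) *\<^sub>R b)))\<^sup>2)"
        by (cases "s \<in> {0..1}") simp_all
    qed
    also have "\<dots> = ennreal (t\<^sup>2) * (\<integral>\<^sup>+s. ennreal ((norm (G (x + (0 + t * s) *\<^sub>R b)))\<^sup>2) \<partial>lborel)"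
      by (rule nn_integral_cmult) measurable
    \<comment> \<open>One of the two factors t is absorbed by the substitution of t s for s.\<close>
    also have "\<dots> = ennreal t * (ennreal \<bar>t\<bar> * (\<integral>\<^sup>+s. ennreal ((norm (G (x + (0 + t * s) *\<^sub>R b)))\<^sup>2) \<partial>lborel))"
      using t by (simp add: power2_eq_square ennreal_mult mult.assoc)
    also have "ennreal \<bar>t\<bar> * (\<integral>\<^sup>+s. ennreal ((norm (G (x + (0 + t * s) *\<^sub>R b)))\<^sup>2) \<partial>lborel) = Q x"
      unfolding Q_def by (rule nn_integral_real_affine[symmetric]) (use t in auto)
    finally show ?thesis .
  qed
  have "AE t in lborel. AE x in lborel. t \<in> {0<..l} \<longrightarrow> ennreal ((u x)\<^sup>2) \<le> ennreal (2 * (u (x + t *\<^sub>R b))\<^sup>2) + ennreal (2 * l) * Q x"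
  proof (rule AE_I2)
    fix t :: real
    show "AE x in lborel. t \<in> {0<..l} \<longrightarrow> ennreal ((u x)\<^sup>2) \<le> ennreal (2 * (u (x + t *\<^sub>R b))\<^sup>2) + ennreal (2 * l) * Q x"
      using sobolev_line_square_le[OF s, of "t *\<^sub>R b"]
    proof eventually_elim
      fix x assume A: "ennreal ((u (x + t *\<^sub>R b) - u x)\<^sup>2)
         \<le> (\<integral>\<^sup>+s. indicator {0..1} s * ennreal ((G (x + s *\<^sub>R t *\<^sub>R b) \<bullet> t *\<^sub>R b)\<^sup>2) \<partial>lborel)"
      show "t \<in> {0<..l} \<longrightarrow> ennreal ((u x)\<^sup>2) \<le> ennreal (2 * (u (x + t *\<^sub>R b))\<^sup>2) + ennreal (2 * l) * Q x"
      proof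
        assume t: "t \<in> {0<..l}"
        have "(u x)\<^sup>2 \<le> 2 * (u (x + t *\<^sub>R b))\<^sup>2 + 2 * (u (x + t *\<^sub>R b) - u x)\<^sup>2"
          using zero_le_power2[of "2 * u (x + t *\<^sub>R b) - u x"] by (simp add: power2_eq_square algebra_simps)
        hence "ennreal ((u x)\<^sup>2) \<le> ennreal (2 * (u (x + t *\<^sub>R b))\<^sup>2) + ennreal 2 * ennreal ((u (x + t *\<^sub>R b) - u x)\<^sup>2)"
          by (simp add: ennreal_mult[symmetric] ennreal_plus[symmetric] del: ennreal_plus ennreal_numeral)
        also have "\<dots> \<le> ennreal (2 * (u (x + t *\<^sub>R b))\<^sup>2) + ennreal 2 * (ennreal t * Q x)"
          using A Qt[of t x] t by (intro add_left_mono mult_left_mono order_trans[OF A]) auto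
        also have "\<dots> \<le> ennreal (2 * (u (x + t *\<^sub>R b))\<^sup>2) + ennreal 2 * (ennreal l * Q x)"
          using t by (intro add_left_mono mult_left_mono mult_right_mono ennreal_leI) auto
        also have "ennreal 2 * (ennreal l * Q x) = ennreal (2 * l) * Q x"
          using l by (simp add: ennreal_mult mult.assoc)
        finally show "ennreal ((u x)\<^sup>2) \<le> ennreal (2 * (u (x + t *\<^sub>R b))\<^sup>2) + ennreal (2 * l) * Q x" .
      qed
    qed
  qed
  moreover have "{p \<in> space (lborel \<Otimes>\<^sub>M lborel). fst p \<in> {0<..l} \<longrightarrow>
      ennreal ((u (snd p))\<^sup>2) \<le> ennreal (2 * (u (snd p + fst p *\<^sub>R b))\<^sup>2) + ennreal (2 * l) * Q (snd p)} \<in> sets (lborel \<Otimes>\<^sub>M lborel)"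
    by measurable
  \<comment> \<open>The exceptional set of points x depends on t. As the joint condition is
    measurable, the quantifiers can be exchanged, which allows t to be averaged at fixed x.\<close>
  ultimately have "AE x in lborel. AE t in lborel. t \<in> {0<..l} \<longrightarrow> ennreal ((u x)\<^sup>2) \<le> ennreal (2 * (u (x + t *\<^sub>R b))\<^sup>2) + ennreal (2 * l) * Q x"
    by (rule lborel_pair.AE_commute[THEN iffD1, rotated])
  thus ?thesis
  proof eventually_elim
    fix x assume A: "AE t in lborel. t \<in> {0<..l} \<longrightarrow> ennreal ((u x)\<^sup>2) \<le> ennreal (2 * (u (x + t *\<^sub>R b))\<^sup>2) + ennreal (2 * l) * Q x"
    define P where "P = (\<integral>\<^sup>+t. ennreal ((u (x + t *\<^sub>R b))\<^sup>2) \<partial>lborel)"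
    have "ennreal l * ennreal ((u x)\<^sup>2) = (\<integral>\<^sup>+t. ennreal ((u x)\<^sup>2) * indicator {0<..l} t \<partial>lborel)"
      using l by (simp add: nn_integral_cmult_indicator mult.commute[of "ennreal l"])
    also have "\<dots> \<le> (\<integral>\<^sup>+t. ennreal 2 * ennreal ((u (x + t *\<^sub>R b))\<^sup>2) + ennreal (2 * l) * Q x * indicator {0<..l} t \<partial>lborel)"
    proof (rule nn_integral_mono_AE)
      show "AE t in lborel. ennreal ((u x)\<^sup>2) * indicator {0<..l} t \<le> ennreal 2 * ennreal ((u (x + t *\<^sub>R b))\<^sup>2) + ennreal (2 * l) * Q x * indicator {0<..l} t"
        using A by eventually_elim (auto simp: indicator_def ennreal_mult)
    qed
    also have "\<dots> = ennreal 2 * P + ennreal (2 * l) * Q x * ennreal l"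
    proof -
      have "(\<integral>\<^sup>+t. ennreal 2 * ennreal ((u (x + t *\<^sub>R b))\<^sup>2) + ennreal (2 * l) * Q x * indicator {0<..l} t \<partial>lborel)
         = (\<integral>\<^sup>+t. ennreal 2 * ennreal ((u (x + t *\<^sub>R b))\<^sup>2) \<partial>lborel) + (\<integral>\<^sup>+t. ennreal (2 * l) * Q x * indicator {0<..l} t \<partial>lborel)"
        by (rule nn_integral_add) measurable
      also have "(\<integral>\<^sup>+t. ennreal 2 * ennreal ((u (x + t *\<^sub>R b))\<^sup>2) \<partial>lborel) = ennreal 2 * P"
        unfolding P_def by (rule nn_integral_cmult) measurable
      also have "(\<integral>\<^sup>+t. ennreal (2 * l) * Q x * indicator {0<..l} t \<partial>lborel) = ennreal (2 * l) * Q x * ennreal l"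
        using l by (simp add: nn_integral_cmult_indicator)
      finally show ?thesis .
    qed
    also have "\<dots> = ennreal l * (ennreal (2 / l) * P + ennreal (2 * l) * Q x)"
    proof -
      have "ennreal l * ennreal (2 / l) = ennreal 2" using l by (simp add: ennreal_mult[symmetric] del: ennreal_numeral)
      moreover have "ennreal l * (ennreal (2 / l) * P + ennreal (2 * l) * Q x)
          = (ennreal l * ennreal (2 / l)) * P + ennreal (2 * l) * Q x * ennreal l"
        by (simp only: distrib_left mult_ac)
      ultimately show ?thesis by (simp only:)
    qed
    also have "ennreal (2 / l) * P + ennreal (2 * l) * Q x = (\<integral>\<^sup>+r. line_weight l u G (x + r *\<^sub>R b) \<partial>lborel)"
    proof -
      have "(\<integral>\<^sup>+r. line_weight l u G (x + r *\<^sub>R b) \<partial>lborel)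
          = (\<integral>\<^sup>+r. ennreal (2 / l) * ennreal ((u (x + r *\<^sub>R b))\<^sup>2) + ennreal (2 * l) * ennreal ((norm (G (x + r *\<^sub>R b)))\<^sup>2) \<partial>lborel)"
        unfolding line_weight_def using l by (intro nn_integral_cong ennreal_mult_add_mult) auto
      also have "\<dots> = (\<integral>\<^sup>+r. ennreal (2 / l) * ennreal ((u (x + r *\<^sub>R b))\<^sup>2) \<partial>lborel)
          + (\<integral>\<^sup>+r. ennreal (2 * l) * ennreal ((norm (G (x + r *\<^sub>R b)))\<^sup>2) \<partial>lborel)"
        by (rule nn_integral_add) measurable
      also have "(\<integral>\<^sup>+r. ennreal (2 / l) * ennreal ((u (x + r *\<^sub>R b))\<^sup>2) \<partial>lborel) = ennreal (2 / l) * P"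
        unfolding P_def by (rule nn_integral_cmult) measurable
      also have "(\<integral>\<^sup>+r. ennreal (2 * l) * ennreal ((norm (G (x + r *\<^sub>R b)))\<^sup>2) \<partial>lborel) = ennreal (2 * l) * Q x"
        unfolding Q_def by (rule nn_integral_cmult) measurable
      finally show ?thesis ..
    qed
    finally have "ennreal l * ennreal ((u x)\<^sup>2) \<le> ennreal l * (\<integral>\<^sup>+r. line_weight l u G (x + r *\<^sub>R b) \<partial>lborel)" .
    moreover have "ennreal l \<noteq> 0" "ennreal l \<noteq> top" using l by auto
    ultimately show "ennreal ((u x)\<^sup>2) \<le> (\<integral>\<^sup>+r. line_weight l u G (x + r *\<^sub>R b) \<partial>lborel)"
      using ennreal_mult_le_mult_iff by blast
  qed
qed

text \<open>The dummy only fixes the type variable, which the interpretation must not generalize.\<close>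

context
  fixes dummy :: "'a::euclidean_space"
begin

interpretation product_sigma_finite "\<lambda>_::'a. lborel::real measure" ..

lemma nn_integral_Basis_1:
  fixes f :: "'a \<Rightarrow> ennreal"
  assumes B: "Basis = {b::'a}" and [measurable]: "f \<in> borel_measurable borel"
  shows "(\<integral>\<^sup>+x. f x \<partial>lborel) = (\<integral>\<^sup>+s. f (s *\<^sub>R b) \<partial>lborel)"
proof -
  have "(\<integral>\<^sup>+x. f x \<partial>lborel) = (\<integral>\<^sup>+w. f (w b *\<^sub>R b) \<partial>(\<Pi>\<^sub>M b\<in>{b}. lborel))"
    by (subst lborel_eq) (simp add: nn_integral_distr B)
  also have "\<dots> = (\<integral>\<^sup>+s. f (s *\<^sub>R b) \<partial>lborel)"
    by (rule product_nn_integral_singleton) measurable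
  finally show ?thesis .
qed

lemma nn_integral_Basis_2:
  fixes f :: "'a \<Rightarrow> ennreal"
  assumes B: "Basis = {b, c::'a}" "b \<noteq> c" and [measurable]: "f \<in> borel_measurable borel"
  shows "(\<integral>\<^sup>+x. f x \<partial>lborel) = (\<integral>\<^sup>+t. (\<integral>\<^sup>+s. f (s *\<^sub>R b + t *\<^sub>R c) \<partial>lborel) \<partial>lborel)"
proof -
  have [measurable]: "(\<lambda>w::'a \<Rightarrow> real. w i) \<in> borel_measurable (\<Pi>\<^sub>M b\<in>I. lborel)" if "i \<in> I" for i I
    using measurable_component_singleton[OF that, of "\<lambda>_. lborel"] by simp
  have "(\<integral>\<^sup>+x. f x \<partial>lborel) = (\<integral>\<^sup>+w. f (w b *\<^sub>R b + w c *\<^sub>R c) \<partial>(\<Pi>\<^sub>M b\<in>insert b {c}. lborel))"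
    by (subst lborel_eq) (use B(2) in \<open>simp add: nn_integral_distr B(1)\<close>)
  also have "\<dots> = (\<integral>\<^sup>+w. (\<integral>\<^sup>+s. f ((w(b := s)) b *\<^sub>R b + (w(b := s)) c *\<^sub>R c) \<partial>lborel) \<partial>(\<Pi>\<^sub>M b\<in>{c}. lborel))"
    by (rule product_nn_integral_insert) (use B(2) in auto)
  also have "\<dots> = (\<integral>\<^sup>+w. (\<integral>\<^sup>+s. f (s *\<^sub>R b + w c *\<^sub>R c) \<partial>lborel) \<partial>(\<Pi>\<^sub>M b\<in>{c}. lborel))"
    using B(2) by simp
  also have "\<dots> = (\<integral>\<^sup>+t. (\<integral>\<^sup>+s. f (s *\<^sub>R b + t *\<^sub>R c) \<partial>lborel) \<partial>lborel)"
    by (rule product_nn_integral_singleton) measurable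
  finally show ?thesis .
qed

lemma nn_integral_Basis_3:
  fixes f :: "'a \<Rightarrow> ennreal"
  assumes B: "Basis = {b, c, d::'a}" "b \<noteq> c" "b \<noteq> d" "c \<noteq> d" and [measurable]: "f \<in> borel_measurable borel"
  shows "(\<integral>\<^sup>+x. f x \<partial>lborel) = (\<integral>\<^sup>+t. (\<integral>\<^sup>+r. (\<integral>\<^sup>+s. f (s *\<^sub>R b + r *\<^sub>R c + t *\<^sub>R d) \<partial>lborel) \<partial>lborel) \<partial>lborel)"
proof -
  have [measurable]: "(\<lambda>w::'a \<Rightarrow> real. w i) \<in> borel_measurable (\<Pi>\<^sub>M b\<in>I. lborel)" if "i \<in> I" for i I
    using measurable_component_singleton[OF that, of "\<lambda>_. lborel"] by simp
  have "(\<integral>\<^sup>+x. f x \<partial>lborel) = (\<integral>\<^sup>+w. f (w b *\<^sub>R b + w c *\<^sub>R c + w d *\<^sub>R d) \<partial>(\<Pi>\<^sub>M b\<in>insert b {c, d}. lborel))"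
    by (subst lborel_eq) (use B(2-) in \<open>simp add: nn_integral_distr B(1) add.assoc\<close>)
  also have "\<dots> = (\<integral>\<^sup>+w. (\<integral>\<^sup>+s. f ((w(b := s)) b *\<^sub>R b + (w(b := s)) c *\<^sub>R c + (w(b := s)) d *\<^sub>R d) \<partial>lborel) \<partial>(\<Pi>\<^sub>M b\<in>{c, d}. lborel))"
    by (rule product_nn_integral_insert) (use B(2-) in auto)
  also have "\<dots> = (\<integral>\<^sup>+w. (\<integral>\<^sup>+s. f (s *\<^sub>R b + w c *\<^sub>R c + w d *\<^sub>R d) \<partial>lborel) \<partial>(\<Pi>\<^sub>M b\<in>insert c {d}. lborel))"
    using B(2-) by simp
  also have "\<dots> = (\<integral>\<^sup>+w. (\<integral>\<^sup>+r. (\<integral>\<^sup>+s. f (s *\<^sub>R b + (w(c := r)) c *\<^sub>R c + (w(c := r)) d *\<^sub>R d) \<partial>lborel) \<partial>lborel) \<partial>(\<Pi>\<^sub>M b\<in>{d}. lborel))"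
    by (rule product_nn_integral_insert) (use B(2-) in auto)
  also have "\<dots> = (\<integral>\<^sup>+w. (\<integral>\<^sup>+r. (\<integral>\<^sup>+s. f (s *\<^sub>R b + r *\<^sub>R c + w d *\<^sub>R d) \<partial>lborel) \<partial>lborel) \<partial>(\<Pi>\<^sub>M b\<in>{d}. lborel))"
    using B(2-) by simp
  also have "\<dots> = (\<integral>\<^sup>+t. (\<integral>\<^sup>+r. (\<integral>\<^sup>+s. f (s *\<^sub>R b + r *\<^sub>R c + t *\<^sub>R d) \<partial>lborel) \<partial>lborel) \<partial>lborel)"
    by (rule product_nn_integral_singleton) measurable
  finally show ?thesis .
qed

end

section \<open>The Loomis--Whitney inequality and the bounds for u that it yields\<close>

text \<open>A line integral in direction b no longer depends on the coordinate along b. The bound is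
  thus a product of functions of separate variables, and the double integral factorizes.\<close>

lemma Loomis_Whitney_2:
  fixes k :: "'a::euclidean_space \<Rightarrow> ennreal"
  assumes d: "DIM('a) = 2" and [measurable]: "k \<in> borel_measurable borel" "h \<in> borel_measurable borel"
    and le: "\<And>x b c. b \<in> Basis \<Longrightarrow> c \<in> Basis \<Longrightarrow> b \<noteq> c \<Longrightarrow> h x \<le> (\<integral>\<^sup>+r. k (x + r *\<^sub>R b) \<partial>lborel) * (\<integral>\<^sup>+r. k (x + r *\<^sub>R c) \<partial>lborel)"
  shows "(\<integral>\<^sup>+x. h x \<partial>lborel) \<le> (\<integral>\<^sup>+x. k x \<partial>lborel)\<^sup>2"
proof -
  obtain b c :: 'a where B: "Basis = {b, c}" "b \<noteq> c" using d by (auto simp: card_2_iff)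
  hence B': "Basis = {c, b}" "c \<noteq> b" by auto
  have shift: "(\<integral>\<^sup>+r. k (s *\<^sub>R b + t *\<^sub>R c + r *\<^sub>R b) \<partial>lborel) = (\<integral>\<^sup>+r. k (r *\<^sub>R b + t *\<^sub>R c) \<partial>lborel)"
    "(\<integral>\<^sup>+r. k (s *\<^sub>R b + t *\<^sub>R c + r *\<^sub>R c) \<partial>lborel) = (\<integral>\<^sup>+r. k (r *\<^sub>R c + s *\<^sub>R b) \<partial>lborel)" for s t
    using nn_integral_translate[of "\<lambda>r::real. k (r *\<^sub>R b + t *\<^sub>R c)" s] nn_integral_translate[of "\<lambda>r::real. k (r *\<^sub>R c + s *\<^sub>R b)" t]
    by (simp_all add: scaleR_add_left add_ac)
  have "(\<integral>\<^sup>+x. h x \<partial>lborel) = (\<integral>\<^sup>+t. (\<integral>\<^sup>+s. h (s *\<^sub>R b + t *\<^sub>R c) \<partial>lborel) \<partial>lborel)"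
    by (rule nn_integral_Basis_2[OF B]) measurable
  also have "\<dots> \<le> (\<integral>\<^sup>+t. (\<integral>\<^sup>+s. (\<integral>\<^sup>+r. k (r *\<^sub>R b + t *\<^sub>R c) \<partial>lborel) * (\<integral>\<^sup>+r. k (r *\<^sub>R c + s *\<^sub>R b) \<partial>lborel) \<partial>lborel) \<partial>lborel)"
  proof (intro nn_integral_mono)
    fix t s :: real
    show "h (s *\<^sub>R b + t *\<^sub>R c) \<le> (\<integral>\<^sup>+r. k (r *\<^sub>R b + t *\<^sub>R c) \<partial>lborel) * (\<integral>\<^sup>+r. k (r *\<^sub>R c + s *\<^sub>R b) \<partial>lborel)"
      using le[of b c "s *\<^sub>R b + t *\<^sub>R c", OF _ _ B(2)] unfolding shift by (simp add: B(1))
  qed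
  also have "\<dots> = (\<integral>\<^sup>+x. k x \<partial>lborel) * (\<integral>\<^sup>+x. k x \<partial>lborel)"
    by (simp add: nn_integral_cmult nn_integral_multc nn_integral_Basis_2[OF B, of k] nn_integral_Basis_2[OF B', of k, symmetric])
  finally show ?thesis by (simp add: power2_eq_square)
qed

text \<open>Each of the three line integrals \<alpha>, \<beta>, \<gamma> lacks the coordinate
  integrated out. The coordinates s, r, t are integrated in turn; at each stage exactly two factors
  depend on the current variable, and Cauchy--Schwarz separates them.\<close>

lemma Loomis_Whitney_3:
  fixes k :: "'a::euclidean_space \<Rightarrow> ennreal"
  assumes dim: "DIM('a) = 3" and [measurable]: "k \<in> borel_measurable borel" "h \<in> borel_measurable borel"
    and le: "\<And>x b c d. b \<in> Basis \<Longrightarrow> c \<in> Basis \<Longrightarrow> d \<in> Basis \<Longrightarrow>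
      (h x)\<^sup>2 \<le> (\<integral>\<^sup>+r. k (x + r *\<^sub>R b) \<partial>lborel) * (\<integral>\<^sup>+r. k (x + r *\<^sub>R c) \<partial>lborel) * (\<integral>\<^sup>+r. k (x + r *\<^sub>R d) \<partial>lborel)"
  shows "(\<integral>\<^sup>+x. h x \<partial>lborel)\<^sup>2 \<le> (\<integral>\<^sup>+x. k x \<partial>lborel) ^ 3"
proof -
  obtain b c d :: 'a where B: "Basis = {b, c, d}" "b \<noteq> c" "b \<noteq> d" "c \<noteq> d"
    using dim by (auto simp: card_3_iff)
  define K where "K = (\<integral>\<^sup>+x. k x \<partial>lborel)"
  define \<alpha> where "\<alpha> r t = (\<integral>\<^sup>+s. k (s *\<^sub>R b + r *\<^sub>R c + t *\<^sub>R d) \<partial>lborel)" for r t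
  define \<beta> where "\<beta> s t = (\<integral>\<^sup>+r. k (s *\<^sub>R b + r *\<^sub>R c + t *\<^sub>R d) \<partial>lborel)" for s t
  define \<gamma> where "\<gamma> s r = (\<integral>\<^sup>+t. k (s *\<^sub>R b + r *\<^sub>R c + t *\<^sub>R d) \<partial>lborel)" for s r
  have [measurable]: "case_prod \<alpha> \<in> borel_measurable (borel \<Otimes>\<^sub>M borel)" "case_prod \<beta> \<in> borel_measurable (borel \<Otimes>\<^sub>M borel)"
    "case_prod \<gamma> \<in> borel_measurable (borel \<Otimes>\<^sub>M borel)"
    unfolding \<alpha>_def \<beta>_def \<gamma>_def by measurable
  have K1: "K = (\<integral>\<^sup>+t. (\<integral>\<^sup>+r. \<alpha> r t \<partial>lborel) \<partial>lborel)"
    unfolding K_def \<alpha>_def by (rule nn_integral_Basis_3[OF B]) measurable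
  have "K = (\<integral>\<^sup>+t. (\<integral>\<^sup>+s. (\<integral>\<^sup>+r. k (r *\<^sub>R c + s *\<^sub>R b + t *\<^sub>R d) \<partial>lborel) \<partial>lborel) \<partial>lborel)"
    unfolding K_def by (rule nn_integral_Basis_3) (use B in auto)
  hence K2: "K = (\<integral>\<^sup>+t. (\<integral>\<^sup>+s. \<beta> s t \<partial>lborel) \<partial>lborel)" unfolding \<beta>_def by (simp add: add_ac)
  have "K = (\<integral>\<^sup>+r. (\<integral>\<^sup>+s. (\<integral>\<^sup>+t. k (t *\<^sub>R d + s *\<^sub>R b + r *\<^sub>R c) \<partial>lborel) \<partial>lborel) \<partial>lborel)"
    unfolding K_def by (rule nn_integral_Basis_3) (use B in auto)
  hence K3: "K = (\<integral>\<^sup>+r. (\<integral>\<^sup>+s. \<gamma> s r \<partial>lborel) \<partial>lborel)" unfolding \<gamma>_def by (simp add: add_ac)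
  define X where "X t = (\<integral>\<^sup>+s. \<beta> s t \<partial>lborel)" for t
  define Y where "Y r = (\<integral>\<^sup>+s. \<gamma> s r \<partial>lborel)" for r
  have [measurable]: "X \<in> borel_measurable borel" "Y \<in> borel_measurable borel"
    unfolding X_def Y_def by measurable
  let ?p = "\<lambda>s r t. s *\<^sub>R b + r *\<^sub>R c + t *\<^sub>R d"
  have shift: "(\<integral>\<^sup>+q. k (?p s r t + q *\<^sub>R b) \<partial>lborel) = \<alpha> r t"
    "(\<integral>\<^sup>+q. k (?p s r t + q *\<^sub>R c) \<partial>lborel) = \<beta> s t"
    "(\<integral>\<^sup>+q. k (?p s r t + q *\<^sub>R d) \<partial>lborel) = \<gamma> s r" for s r t
    unfolding \<alpha>_def \<beta>_def \<gamma>_def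
    using nn_integral_translate[of "\<lambda>q::real. k (?p q r t)" s] nn_integral_translate[of "\<lambda>q::real. k (?p s q t)" r]
      nn_integral_translate[of "\<lambda>q::real. k (?p s r q)" t]
    by (simp_all add: scaleR_add_left add_ac)
  have h2: "(h (?p s r t))\<^sup>2 \<le> (\<alpha> r t * \<beta> s t) * \<gamma> s r" for s r t
    using le[of b c d "?p s r t"] by (simp add: B(1) shift)
  have s1: "(\<integral>\<^sup>+s. h (?p s r t) \<partial>lborel)\<^sup>2 \<le> \<alpha> r t * (X t * Y r)" for r t
  proof -
    have "(\<integral>\<^sup>+s. h (?p s r t) \<partial>lborel)\<^sup>2 \<le> (\<integral>\<^sup>+s. \<alpha> r t * \<beta> s t \<partial>lborel) * (\<integral>\<^sup>+s. \<gamma> s r \<partial>lborel)"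
      by (rule nn_integral_Cauchy_Schwarz) (use h2 in auto)
    thus ?thesis by (simp add: nn_integral_cmult X_def Y_def mult.assoc)
  qed
  have s2: "(\<integral>\<^sup>+r. (\<integral>\<^sup>+s. h (?p s r t) \<partial>lborel) \<partial>lborel)\<^sup>2 \<le> (\<integral>\<^sup>+r. \<alpha> r t \<partial>lborel) * (X t * K)" for t
  proof -
    have "(\<integral>\<^sup>+r. (\<integral>\<^sup>+s. h (?p s r t) \<partial>lborel) \<partial>lborel)\<^sup>2 \<le> (\<integral>\<^sup>+r. \<alpha> r t \<partial>lborel) * (\<integral>\<^sup>+r. X t * Y r \<partial>lborel)"
      by (rule nn_integral_Cauchy_Schwarz) (use s1 in auto)
    thus ?thesis using K3 by (simp add: nn_integral_cmult Y_def)
  qed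
  have "(\<integral>\<^sup>+t. (\<integral>\<^sup>+r. (\<integral>\<^sup>+s. h (?p s r t) \<partial>lborel) \<partial>lborel) \<partial>lborel)\<^sup>2 \<le> (\<integral>\<^sup>+t. (\<integral>\<^sup>+r. \<alpha> r t \<partial>lborel) \<partial>lborel) * (\<integral>\<^sup>+t. X t * K \<partial>lborel)"
    by (rule nn_integral_Cauchy_Schwarz) (use s2 in auto)
  also have "(\<integral>\<^sup>+t. X t * K \<partial>lborel) = K * K" using K2 by (simp add: nn_integral_multc X_def)
  also have "(\<integral>\<^sup>+t. (\<integral>\<^sup>+r. \<alpha> r t \<partial>lborel) \<partial>lborel) = K" using K1 ..
  also have "(\<integral>\<^sup>+t. (\<integral>\<^sup>+r. (\<integral>\<^sup>+s. h (?p s r t) \<partial>lborel) \<partial>lborel) \<partial>lborel) = (\<integral>\<^sup>+x. h x \<partial>lborel)"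
    by (rule nn_integral_Basis_3[OF B, symmetric]) measurable
  finally show ?thesis by (simp add: K_def power3_eq_cube mult.assoc)
qed

text \<open>In dimension one the only coordinate line is the whole space, so the line bound is
  already a uniform bound.\<close>

lemma sobolev_bound_dim1:
  fixes u :: "'a::euclidean_space \<Rightarrow> real"
  assumes s: "sobolev u G" and l: "l > 0" and d: "DIM('a) = 1"
  shows "AE x in lborel. (u x)\<^sup>2 \<le> 2 / l * nsq u + 2 * l * nsq G"
proof -
  obtain b :: 'a where B: "Basis = {b}" using d by (auto simp: card_1_singleton_iff)
  note [measurable] = line_weight_measurable[OF s]
  have "(\<integral>\<^sup>+r. line_weight l u G (x + r *\<^sub>R b) \<partial>lborel) = ennreal (2 / l * nsq u + 2 * l * nsq G)" for x
  proof -
    have "x = (x \<bullet> b) *\<^sub>R b" using euclidean_representation[of x] by (simp add: B)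
    hence "(\<lambda>r. line_weight l u G (x + r *\<^sub>R b)) = (\<lambda>r. line_weight l u G ((r + x \<bullet> b) *\<^sub>R b))"
      by (metis add.commute scaleR_add_left)
    thus ?thesis
      using nn_integral_translate[of "\<lambda>r::real. line_weight l u G (r *\<^sub>R b)" "x \<bullet> b"]
        nn_integral_Basis_1[OF B line_weight_measurable[OF s, of l]] nn_integral_line_weight[OF s l] by simp
  qed
  moreover have "b \<in> Basis" by (simp add: B)
  ultimately have "AE x in lborel. ennreal ((u x)\<^sup>2) \<le> ennreal (2 / l * nsq u + 2 * l * nsq G)"
    using sobolev_square_le_line[OF s _ l, of b] by simp
  moreover have "0 \<le> 2 / l * nsq u + 2 * l * nsq G" using l by simp
  ultimately show ?thesis by (simp only: ennreal_le_iff)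
qed

text \<open>The line bounds hold almost everywhere, whereas the Loomis--Whitney lemmas ask for them
  at every point. Cutting off with the indicator of S reconciles the two.\<close>

lemma sobolev_good_set:
  fixes u :: "'a::euclidean_space \<Rightarrow> real"
  assumes s: "sobolev u G" and l: "l > 0"
  obtains S where "S \<in> sets borel" "AE x in lborel. x \<in> S"
    "\<And>x b. x \<in> S \<Longrightarrow> b \<in> Basis \<Longrightarrow> ennreal ((u x)\<^sup>2) \<le> (\<integral>\<^sup>+r. line_weight l u G (x + r *\<^sub>R b) \<partial>lborel)"
proof -
  note [measurable] = line_weight_measurable[OF s] L2_measurable[OF sobolev_L2(1)[OF s]]
  define S where "S = {x \<in> space borel. \<forall>b\<in>Basis. ennreal ((u x)\<^sup>2) \<le> (\<integral>\<^sup>+r. line_weight l u G (x + r *\<^sub>R b) \<partial>lborel)}"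
  have "AE x in lborel. \<forall>b\<in>Basis. ennreal ((u x)\<^sup>2) \<le> (\<integral>\<^sup>+r. line_weight l u G (x + r *\<^sub>R b) \<partial>lborel)"
    by (rule AE_finite_allI) (use sobolev_square_le_line[OF s _ l] in auto)
  moreover have "S \<in> sets borel" unfolding S_def by measurable
  ultimately show ?thesis by (intro that[of S]) (auto simp: S_def)
qed

lemma sobolev_L4_dim2:
  fixes u :: "'a::euclidean_space \<Rightarrow> real"
  assumes s: "sobolev u G" and l: "l > 0" and d: "DIM('a) = 2"
  shows "(\<integral>\<^sup>+x. ennreal ((u x)^4) \<partial>lborel) \<le> ennreal ((2 / l * nsq u + 2 * l * nsq G)\<^sup>2)"
proof -
  note [measurable] = line_weight_measurable[OF s] L2_measurable[OF sobolev_L2(1)[OF s]]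
  obtain S where S [measurable]: "S \<in> sets borel" and AE: "AE x in lborel. x \<in> S" and le: "\<And>x b. x \<in> S \<Longrightarrow> b \<in> Basis \<Longrightarrow> ennreal ((u x)\<^sup>2) \<le> (\<integral>\<^sup>+r. line_weight l u G (x + r *\<^sub>R b) \<partial>lborel)"
    using sobolev_good_set[OF s l] by blast
  have "(\<integral>\<^sup>+x. ennreal ((u x)^4) \<partial>lborel) = (\<integral>\<^sup>+x. ennreal ((u x)\<^sup>2) * ennreal ((u x)\<^sup>2) * indicator S x \<partial>lborel)"
    using AE by (intro nn_integral_cong_AE) (auto simp: ennreal_mult[symmetric] simp flip: power_add)
  also have "\<dots> \<le> (\<integral>\<^sup>+x. line_weight l u G x \<partial>lborel)\<^sup>2"
    by (rule Loomis_Whitney_2[OF d]) (auto simp: indicator_def intro!: mult_mono le)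
  finally show ?thesis using l ennreal_power[of "2 / l * nsq u + 2 * l * nsq G" 2]
    unfolding nn_integral_line_weight[OF s l] by simp
qed

text \<open>The power 3 comes from the method: |u|^6 is a product of three factors u^2, each bounded
  by a line integral in one of the directions. It also matches potentials in L^(3/2) in Young's
  inequality.\<close>

lemma sobolev_L3_dim3:
  fixes u :: "'a::euclidean_space \<Rightarrow> real"
  assumes s: "sobolev u G" and l: "l > 0" and d: "DIM('a) = 3"
  shows "(\<integral>\<^sup>+x. ennreal (\<bar>u x\<bar>^3) \<partial>lborel)\<^sup>2 \<le> ennreal ((2 / l * nsq u + 2 * l * nsq G)^3)"
proof -
  note [measurable] = line_weight_measurable[OF s] L2_measurable[OF sobolev_L2(1)[OF s]]
  obtain S where S [measurable]: "S \<in> sets borel" and AE: "AE x in lborel. x \<in> S" and le: "\<And>x b. x \<in> S \<Longrightarrow> b \<in> Basis \<Longrightarrow> ennreal ((u x)\<^sup>2) \<le> (\<integral>\<^sup>+r. line_weight l u G (x + r *\<^sub>R b) \<partial>lborel)"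
    using sobolev_good_set[OF s l] by blast
  have "(\<integral>\<^sup>+x. ennreal (\<bar>u x\<bar>^3) \<partial>lborel) = (\<integral>\<^sup>+x. ennreal (\<bar>u x\<bar>^3) * indicator S x \<partial>lborel)"
    using AE by (intro nn_integral_cong_AE) auto
  also have "\<dots>\<^sup>2 \<le> (\<integral>\<^sup>+x. line_weight l u G x \<partial>lborel)^3"
  proof (rule Loomis_Whitney_3[OF d])
    fix x b c d :: 'a assume b: "b \<in> Basis" "c \<in> Basis" "d \<in> Basis"
    show "(ennreal (\<bar>u x\<bar>^3) * indicator S x)\<^sup>2 \<le> (\<integral>\<^sup>+r. line_weight l u G (x + r *\<^sub>R b) \<partial>lborel) *
      (\<integral>\<^sup>+r. line_weight l u G (x + r *\<^sub>R c) \<partial>lborel) * (\<integral>\<^sup>+r. line_weight l u G (x + r *\<^sub>R d) \<partial>lborel)"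
    proof (cases "x \<in> S")
      case True
      have "(ennreal (\<bar>u x\<bar>^3))\<^sup>2 = ennreal ((u x)\<^sup>2) * ennreal ((u x)\<^sup>2) * ennreal ((u x)\<^sup>2)"
      proof -
        have "(\<bar>u x\<bar>^3)\<^sup>2 = (\<bar>u x\<bar>\<^sup>2)^3" by (simp only: power_mult[symmetric] mult.commute)
        also have "\<dots> = (u x)\<^sup>2 * (u x)\<^sup>2 * (u x)\<^sup>2" by (simp add: power3_eq_cube)
        finally have e: "(\<bar>u x\<bar>^3)\<^sup>2 = (u x)\<^sup>2 * (u x)\<^sup>2 * (u x)\<^sup>2" .
        have "(ennreal (\<bar>u x\<bar>^3))\<^sup>2 = ennreal ((\<bar>u x\<bar>^3)\<^sup>2)" by (rule ennreal_power) simp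
        thus ?thesis unfolding e by (simp only: ennreal_mult zero_le_power2 mult_nonneg_nonneg)
      qed
      also have "\<dots> \<le> (\<integral>\<^sup>+r. line_weight l u G (x + r *\<^sub>R b) \<partial>lborel) *
        (\<integral>\<^sup>+r. line_weight l u G (x + r *\<^sub>R c) \<partial>lborel) * (\<integral>\<^sup>+r. line_weight l u G (x + r *\<^sub>R d) \<partial>lborel)"
        by (intro mult_mono le True b) auto
      finally show ?thesis using True by simp
    qed simp
  qed measurable
  finally show ?thesis using l ennreal_power[of "2 / l * nsq u + 2 * l * nsq G" 3]
    unfolding nn_integral_line_weight[OF s l] by simp
qed

section \<open>Bounds for the interaction energy\<close>

lemma nn_integral_reflect:
  fixes f :: "'a::euclidean_space \<Rightarrow> ennreal"
  assumes [measurable]: "f \<in> borel_measurable borel"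
  shows "(\<integral>\<^sup>+y. f (x - y) \<partial>lborel) = (\<integral>\<^sup>+y. f y \<partial>lborel)"
proof -
  have "(\<integral>\<^sup>+y. f y \<partial>lborel) = (\<integral>\<^sup>+y. f y \<partial>density (distr lborel borel (\<lambda>y. x + (-1) *\<^sub>R y)) (\<lambda>_. ennreal (\<bar>-1\<bar>^DIM('a))))"
    using lborel_affine[of "-1" x] by simp
  also have "\<dots> = (\<integral>\<^sup>+y. f (x - y) \<partial>lborel)"
    by (subst nn_integral_density) (auto simp: nn_integral_distr)
  finally show ?thesis ..
qed

text \<open>An iterated nonnegative integral is always meaningful; its finiteness later gives
  integrability of the signed integrand.\<close>

definition abs_interaction :: "('a::euclidean_space \<Rightarrow> real) \<Rightarrow> ('a \<Rightarrow> real) \<Rightarrow> ennreal" where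
  "abs_interaction W u = (\<integral>\<^sup>+x. (\<integral>\<^sup>+y. ennreal ((u x)\<^sup>2 * \<bar>W (x - y)\<bar> * (u y)\<^sup>2) \<partial>lborel) \<partial>lborel)"

lemma convolution_left:
  fixes f g :: "'a::euclidean_space \<Rightarrow> ennreal"
  assumes [measurable]: "f \<in> borel_measurable borel" "g \<in> borel_measurable borel"
  shows "(\<integral>\<^sup>+x. (\<integral>\<^sup>+y. f x * g (x - y) \<partial>lborel) \<partial>lborel) = (\<integral>\<^sup>+x. f x \<partial>lborel) * (\<integral>\<^sup>+y. g y \<partial>lborel)"
  by (simp add: nn_integral_cmult nn_integral_multc nn_integral_reflect)

lemma convolution_right:
  fixes f g :: "'a::euclidean_space \<Rightarrow> ennreal"
  assumes [measurable]: "f \<in> borel_measurable borel" "g \<in> borel_measurable borel"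
  shows "(\<integral>\<^sup>+x. (\<integral>\<^sup>+y. f y * g (x - y) \<partial>lborel) \<partial>lborel) = (\<integral>\<^sup>+x. f x \<partial>lborel) * (\<integral>\<^sup>+y. g y \<partial>lborel)"
proof -
  have "(\<integral>\<^sup>+x. (\<integral>\<^sup>+y. f y * g (x - y) \<partial>lborel) \<partial>lborel) = (\<integral>\<^sup>+y. (\<integral>\<^sup>+x. f y * g (x - y) \<partial>lborel) \<partial>lborel)"
    by (rule lborel_pair.Fubini') measurable
  also have "\<dots> = (\<integral>\<^sup>+y. f y * (\<integral>\<^sup>+x. g x \<partial>lborel) \<partial>lborel)"
    using nn_integral_translate[of g "- _"] by (simp add: nn_integral_cmult)
  finally show ?thesis by (simp add: nn_integral_multc)
qed

lemma abs_interaction_bound_dim1: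
  fixes u :: "'a::euclidean_space \<Rightarrow> real"
  assumes s: "sobolev u G" and d: "DIM('a) = 1" and [measurable]: "W \<in> borel_measurable borel"
    and N: "(\<integral>\<^sup>+x. ennreal \<bar>W x\<bar> \<partial>lborel) \<le> ennreal \<eta>" and \<eta>: "\<eta> \<ge> 0"
  shows "abs_interaction W u \<le> ennreal (2 * \<eta> * nsq u * (nsq u + nsq G))"
proof -
  note [measurable] = L2_measurable[OF sobolev_L2(1)[OF s]]
  \<comment> \<open>The uniform bound on the square of u for the length l = 1.\<close>
  define K where "K = 2 * (nsq u + nsq G)"
  have K0: "K \<ge> 0" by (simp add: K_def)
  have AE: "AE y in lborel. (u y)\<^sup>2 \<le> K"
    using sobolev_bound_dim1[OF s _ d, of 1] by (simp add: K_def)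
  have "abs_interaction W u \<le> (\<integral>\<^sup>+x. (\<integral>\<^sup>+y. ennreal (K * (u x)\<^sup>2) * ennreal \<bar>W (x - y)\<bar> \<partial>lborel) \<partial>lborel)"
    unfolding abs_interaction_def
  proof (rule nn_integral_mono, rule nn_integral_mono_AE)
    fix x
    show "AE y in lborel. ennreal ((u x)\<^sup>2 * \<bar>W (x - y)\<bar> * (u y)\<^sup>2) \<le> ennreal (K * (u x)\<^sup>2) * ennreal \<bar>W (x - y)\<bar>"
      using AE
    proof eventually_elim
      fix y assume "(u y)\<^sup>2 \<le> K"
      hence "(u x)\<^sup>2 * \<bar>W (x - y)\<bar> * (u y)\<^sup>2 \<le> (u x)\<^sup>2 * \<bar>W (x - y)\<bar> * K" by (intro mult_left_mono) auto
      thus "ennreal ((u x)\<^sup>2 * \<bar>W (x - y)\<bar> * (u y)\<^sup>2) \<le> ennreal (K * (u x)\<^sup>2) * ennreal \<bar>W (x - y)\<bar>"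
        using K0 by (subst ennreal_mult[symmetric]) (auto intro!: ennreal_leI simp: mult_ac)
    qed
  qed
  also have "\<dots> = (\<integral>\<^sup>+x. ennreal (K * (u x)\<^sup>2) \<partial>lborel) * (\<integral>\<^sup>+y. ennreal \<bar>W y\<bar> \<partial>lborel)"
    by (rule convolution_left) measurable
  also have "(\<integral>\<^sup>+x. ennreal (K * (u x)\<^sup>2) \<partial>lborel) = ennreal (K * nsq u)"
    using nn_integral_nsq[OF sobolev_L2(1)[OF s]] K0 by (simp add: ennreal_mult nn_integral_cmult)
  also have "\<dots> * (\<integral>\<^sup>+y. ennreal \<bar>W y\<bar> \<partial>lborel) \<le> ennreal (K * nsq u) * ennreal \<eta>"
    by (intro mult_left_mono N) auto
  also have "\<dots> = ennreal (2 * \<eta> * nsq u * (nsq u + nsq G))"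
    using K0 \<eta> by (subst ennreal_mult[symmetric]) (auto simp: K_def algebra_simps)
  finally show ?thesis .
qed

text \<open>Young's inequality with exponents 2, 1, 2 for the functions u^2, W, u^2: by 2 a b <= a^2
  + b^2 only integrals of u^4 against |W(x - y)| remain, and these factorize.\<close>

lemma abs_interaction_bound_dim2:
  fixes u :: "'a::euclidean_space \<Rightarrow> real"
  assumes s: "sobolev u G" and d: "DIM('a) = 2" and [measurable]: "W \<in> borel_measurable borel"
    and N: "(\<integral>\<^sup>+x. ennreal (\<bar>W x\<bar> powr (real DIM('a) / 2)) \<partial>lborel) \<le> ennreal (\<eta> ^ DIM('a))" and \<eta>: "\<eta> > 0" and l: "l > 0"
  shows "abs_interaction W u \<le> ennreal (\<eta>\<^sup>2 * (2 / l * nsq u + 2 * l * nsq G)\<^sup>2)"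
proof -
  note [measurable] = L2_measurable[OF sobolev_L2(1)[OF s]]
  define K where "K = (2 / l * nsq u + 2 * l * nsq G)\<^sup>2"
  define F where "F = (\<integral>\<^sup>+x. ennreal ((u x)^4) \<partial>lborel)"
  define M where "M = (\<integral>\<^sup>+x. ennreal \<bar>W x\<bar> \<partial>lborel)"
  have FK: "F \<le> ennreal K" unfolding F_def K_def by (rule sobolev_L4_dim2[OF s l d])
  have M: "M \<le> ennreal (\<eta>\<^sup>2)" using N d by (simp add: M_def)
  have "ennreal 2 * abs_interaction W u = (\<integral>\<^sup>+x. (\<integral>\<^sup>+y. ennreal 2 * ennreal ((u x)\<^sup>2 * \<bar>W (x - y)\<bar> * (u y)\<^sup>2) \<partial>lborel) \<partial>lborel)"
    unfolding abs_interaction_def by (simp add: nn_integral_cmult del: ennreal_numeral)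
  also have "\<dots> \<le> (\<integral>\<^sup>+x. (\<integral>\<^sup>+y. ennreal ((u x)^4) * ennreal \<bar>W (x - y)\<bar> + ennreal ((u y)^4) * ennreal \<bar>W (x - y)\<bar> \<partial>lborel) \<partial>lborel)"
  proof (intro nn_integral_mono)
    fix x y
    have "0 \<le> ((u x)\<^sup>2 - (u y)\<^sup>2)\<^sup>2 * \<bar>W (x - y)\<bar>" by simp
    hence "2 * ((u x)\<^sup>2 * \<bar>W (x - y)\<bar> * (u y)\<^sup>2) \<le> (u x)^4 * \<bar>W (x - y)\<bar> + (u y)^4 * \<bar>W (x - y)\<bar>"
      by (simp add: power2_diff algebra_simps flip: power_mult power_add)
    thus "ennreal 2 * ennreal ((u x)\<^sup>2 * \<bar>W (x - y)\<bar> * (u y)\<^sup>2) \<le> ennreal ((u x)^4) * ennreal \<bar>W (x - y)\<bar> + ennreal ((u y)^4) * ennreal \<bar>W (x - y)\<bar>"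
      by (simp add: ennreal_mult[symmetric] ennreal_plus[symmetric] del: ennreal_plus ennreal_numeral)
  qed
  also have "\<dots> = F * M + F * M"
    unfolding F_def M_def
    using convolution_left[of "\<lambda>x. ennreal ((u x)^4)" "\<lambda>x. ennreal \<bar>W x\<bar>"]
      convolution_right[of "\<lambda>x. ennreal ((u x)^4)" "\<lambda>x. ennreal \<bar>W x\<bar>"]
    by (simp add: nn_integral_add)
  also have "\<dots> = ennreal 2 * (F * M)" by (simp add: mult_2)
  finally have "abs_interaction W u \<le> F * M" by (subst (asm) ennreal_mult_le_mult_iff) auto
  also have "\<dots> \<le> ennreal K * ennreal (\<eta>\<^sup>2)" by (intro mult_mono FK M) auto
  also have "\<dots> = ennreal (\<eta>\<^sup>2 * K)" by (simp add: K_def ennreal_mult[symmetric] mult.commute)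
  finally show ?thesis unfolding K_def .
qed

lemma arith_geo_mean_3:
  fixes a b c :: real
  assumes "a \<ge> 0" "b \<ge> 0" "c \<ge> 0"
  shows "3 * (a * b * c) \<le> a^3 + b^3 + c^3"
proof -
  have "a^3 + b^3 + c^3 - 3 * (a * b * c) = (a + b + c) * ((a - b)\<^sup>2 + (b - c)\<^sup>2 + (c - a)\<^sup>2) / 2"
    by (simp add: power2_eq_square power3_eq_cube algebra_simps)
  also have "\<dots> \<ge> 0" using assms by simp
  finally show ?thesis by simp
qed

text \<open>Young's inequality with all exponents 3/2 for the functions u^2, W, u^2. The inequality
  of arithmetic and geometric means splits the integrand into three terms, each the product of two
  of |u(x)|^3, |u(y)|^3 and |W(x - y)|^(3/2), and each factorizes upon integration.\<close>

lemma abs_interaction_bound_dim3: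
  fixes u :: "'a::euclidean_space \<Rightarrow> real"
  assumes s: "sobolev u G" and d: "DIM('a) = 3" and [measurable]: "W \<in> borel_measurable borel"
    and N: "(\<integral>\<^sup>+x. ennreal (\<bar>W x\<bar> powr (real DIM('a) / 2)) \<partial>lborel) \<le> ennreal (\<eta> ^ DIM('a))" and \<eta>: "\<eta> > 0" and l: "l > 0"
    and K0: "2 / l * nsq u + 2 * l * nsq G > 0"
  shows "abs_interaction W u \<le> ennreal (\<eta>\<^sup>2 * (2 / l * nsq u + 2 * l * nsq G)\<^sup>2)"
proof -
  note [measurable] = L2_measurable[OF sobolev_L2(1)[OF s]]
  define K where "K = 2 / l * nsq u + 2 * l * nsq G"
  define k where "k = sqrt K"
  have k: "k > 0" "k\<^sup>2 = K" using K0 by (simp_all add: k_def K_def)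
  define F where "F = (\<integral>\<^sup>+x. ennreal (\<bar>u x\<bar>^3) \<partial>lborel)"
  define M where "M = (\<integral>\<^sup>+x. ennreal (\<bar>W x\<bar> powr (3/2)) \<partial>lborel)"
  have M: "M \<le> ennreal (\<eta>^3)" using N d by (simp add: M_def)
  have "F\<^sup>2 \<le> ennreal ((k^3)\<^sup>2)"
    using sobolev_L3_dim3[OF s l d] unfolding F_def K_def[symmetric] k(2)[symmetric] by (simp flip: power_mult)
  hence F2: "F\<^sup>2 \<le> (ennreal (k^3))\<^sup>2" using k by (simp add: ennreal_power)
  have F: "F \<le> ennreal (k^3)"
  proof (cases F rule: ennreal_cases)
    case (real r)
    have "ennreal (r\<^sup>2) \<le> ennreal ((k^3)\<^sup>2)"
      using F2 k unfolding real(2) ennreal_power[OF real(1)] by (simp add: ennreal_power)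
    hence "r\<^sup>2 \<le> (k^3)\<^sup>2" by (rule ennreal_le_iff[THEN iffD1, rotated]) simp
    hence "r \<le> k^3" by (rule power2_le_imp_le) (use k in simp)
    thus ?thesis unfolding real(2) by (rule ennreal_leI)
  next
    case top
    have "(ennreal (k^3))\<^sup>2 = ennreal ((k^3)\<^sup>2)" by (rule ennreal_power) (use k in simp)
    thus ?thesis using F2 top by (simp add: power2_eq_square[of top] top_unique)
  qed
  \<comment> \<open>This weight makes the three terms of the final estimate equal, each being
    \<open>\<eta>\<^sup>2 * K\<^sup>2\<close>.\<close>
  define \<tau> where "\<tau> = k / \<eta>"
  have \<tau>: "\<tau> > 0" using k \<eta> by (simp add: \<tau>_def)
  let ?w = "\<lambda>x. \<bar>W x\<bar> powr (3/2)"
  have pt: "3 * ((u x)\<^sup>2 * \<bar>W z\<bar> * (u y)\<^sup>2) \<le> (1/\<tau>\<^sup>2 * \<bar>u x\<bar>^3) * \<bar>u y\<bar>^3 + ((\<tau> * \<bar>u x\<bar>^3) * ?w z + (\<tau> * \<bar>u y\<bar>^3) * ?w z)" for x y z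
  proof -
    \<comment> \<open>A cube root because the weights appear after cubing: the three factors below
      carry t^-2, t and t, whose product is 1.\<close>
    define t where "t = root 3 \<tau>"
    have t: "t > 0" "t^3 = \<tau>" using \<tau> by (simp_all add: t_def)
    define v where "v = sqrt \<bar>W z\<bar>"
    have v: "v \<ge> 0" "v * v = \<bar>W z\<bar>" by (simp_all add: v_def)
    have v3: "v^3 = ?w z"
    proof (cases "W z = 0")
      case False
      hence "v^3 = v powr real 3" by (subst powr_realpow) (auto simp: v_def)
      also have "\<dots> = ?w z" unfolding v_def by (simp add: powr_half_sqrt[symmetric] powr_powr)
      finally show ?thesis .
    qed (simp add: v_def)
    have "3 * ((\<bar>u x\<bar> * \<bar>u y\<bar> / t^2) * (\<bar>u x\<bar> * v * t) * (\<bar>u y\<bar> * v * t))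
        \<le> (\<bar>u x\<bar> * \<bar>u y\<bar> / t^2)^3 + (\<bar>u x\<bar> * v * t)^3 + (\<bar>u y\<bar> * v * t)^3"
      by (rule arith_geo_mean_3) (use t v in auto)
    moreover have "(\<bar>u x\<bar> * \<bar>u y\<bar> / t^2) * (\<bar>u x\<bar> * v * t) * (\<bar>u y\<bar> * v * t) = (u x)\<^sup>2 * \<bar>W z\<bar> * (u y)\<^sup>2"
    proof -
      have "(\<bar>u x\<bar> * \<bar>u y\<bar> / t^2) * (\<bar>u x\<bar> * v * t) * (\<bar>u y\<bar> * v * t) = \<bar>u x\<bar>\<^sup>2 * (v * v) * \<bar>u y\<bar>\<^sup>2 * (t^2 / t^2)"
        by (simp add: power2_eq_square algebra_simps)
      thus ?thesis using t(1) by (simp add: v)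
    qed
    moreover have "(\<bar>u x\<bar> * \<bar>u y\<bar> / t^2)^3 = (1/\<tau>\<^sup>2 * \<bar>u x\<bar>^3) * \<bar>u y\<bar>^3"
      by (simp add: power_mult_distrib power_divide t(2)[symmetric] flip: power_mult)
    moreover have "(\<bar>u x\<bar> * v * t)^3 = (\<tau> * \<bar>u x\<bar>^3) * ?w z" "(\<bar>u y\<bar> * v * t)^3 = (\<tau> * \<bar>u y\<bar>^3) * ?w z"
      by (simp_all add: power_mult_distrib t(2) v3)
    ultimately show ?thesis by simp
  qed
  have m1: "(\<integral>\<^sup>+x. ennreal (c * \<bar>u x\<bar>^3) \<partial>lborel) = ennreal c * F" if "c \<ge> 0" for c
    unfolding F_def using that by (simp add: ennreal_mult nn_integral_cmult)
  have "ennreal 3 * abs_interaction W u = (\<integral>\<^sup>+x. (\<integral>\<^sup>+y. ennreal 3 * ennreal ((u x)\<^sup>2 * \<bar>W (x - y)\<bar> * (u y)\<^sup>2) \<partial>lborel) \<partial>lborel)"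
    unfolding abs_interaction_def by (simp add: nn_integral_cmult del: ennreal_numeral)
  also have "\<dots> \<le> (\<integral>\<^sup>+x. (\<integral>\<^sup>+y. ennreal (1/\<tau>\<^sup>2 * \<bar>u x\<bar>^3) * ennreal (\<bar>u y\<bar>^3)
       + (ennreal (\<tau> * \<bar>u x\<bar>^3) * ennreal (?w (x - y)) + ennreal (\<tau> * \<bar>u y\<bar>^3) * ennreal (?w (x - y))) \<partial>lborel) \<partial>lborel)"
  proof (intro nn_integral_mono)
    fix x y
    show "ennreal 3 * ennreal ((u x)\<^sup>2 * \<bar>W (x - y)\<bar> * (u y)\<^sup>2) \<le> ennreal (1/\<tau>\<^sup>2 * \<bar>u x\<bar>^3) * ennreal (\<bar>u y\<bar>^3)
       + (ennreal (\<tau> * \<bar>u x\<bar>^3) * ennreal (?w (x - y)) + ennreal (\<tau> * \<bar>u y\<bar>^3) * ennreal (?w (x - y)))"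
      using pt[of x "x - y" y] \<tau>
      by (simp add: ennreal_mult[symmetric] ennreal_plus[symmetric] del: ennreal_plus ennreal_numeral)
  qed
  also have "\<dots> = ennreal (1/\<tau>\<^sup>2) * F * F + (ennreal \<tau> * F * M + ennreal \<tau> * F * M)"
  proof -
    have "(\<integral>\<^sup>+x. (\<integral>\<^sup>+y. ennreal (1/\<tau>\<^sup>2 * \<bar>u x\<bar>^3) * ennreal (\<bar>u y\<bar>^3) \<partial>lborel) \<partial>lborel) = ennreal (1/\<tau>\<^sup>2) * F * F"
      using m1[of "1/\<tau>\<^sup>2"] by (simp add: nn_integral_cmult nn_integral_multc F_def[symmetric])
    moreover have "(\<integral>\<^sup>+x. (\<integral>\<^sup>+y. ennreal (\<tau> * \<bar>u x\<bar>^3) * ennreal (?w (x - y)) \<partial>lborel) \<partial>lborel) = ennreal \<tau> * F * M"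
      using m1[of \<tau>] \<tau> convolution_left[of "\<lambda>x. ennreal (\<tau> * \<bar>u x\<bar>^3)" "\<lambda>x. ennreal (?w x)"] by (simp add: M_def)
    moreover have "(\<integral>\<^sup>+x. (\<integral>\<^sup>+y. ennreal (\<tau> * \<bar>u y\<bar>^3) * ennreal (?w (x - y)) \<partial>lborel) \<partial>lborel) = ennreal \<tau> * F * M"
      using m1[of \<tau>] \<tau> convolution_right[of "\<lambda>x. ennreal (\<tau> * \<bar>u x\<bar>^3)" "\<lambda>x. ennreal (?w x)"] by (simp add: M_def)
    ultimately show ?thesis by (simp add: nn_integral_add)
  qed
  also have "\<dots> \<le> ennreal (1/\<tau>\<^sup>2) * ennreal (k^3) * ennreal (k^3) + (ennreal \<tau> * ennreal (k^3) * ennreal (\<eta>^3) + ennreal \<tau> * ennreal (k^3) * ennreal (\<eta>^3))"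
    by (intro add_mono mult_mono F M) auto
  also have "\<dots> = ennreal (1/\<tau>\<^sup>2 * k^3 * k^3 + (\<tau> * k^3 * \<eta>^3 + \<tau> * k^3 * \<eta>^3))"
    using \<tau> k \<eta> by (simp add: ennreal_mult[symmetric] ennreal_plus[symmetric] del: ennreal_plus)
  also have "1/\<tau>\<^sup>2 * k^3 * k^3 + (\<tau> * k^3 * \<eta>^3 + \<tau> * k^3 * \<eta>^3) = 3 * (\<eta>\<^sup>2 * K\<^sup>2)"
    unfolding \<tau>_def k(2)[symmetric] using k(1) \<eta> by (simp add: field_simps power2_eq_square power3_eq_cube)
  also have "ennreal (3 * (\<eta>\<^sup>2 * K\<^sup>2)) = ennreal 3 * ennreal (\<eta>\<^sup>2 * K\<^sup>2)" by (rule ennreal_mult) auto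
  finally have "abs_interaction W u \<le> ennreal (\<eta>\<^sup>2 * K\<^sup>2)" by (subst (asm) ennreal_mult_le_mult_iff) auto
  thus ?thesis unfolding K_def .
qed

text \<open>By the hypothesis N, \<open>\<eta>\<^sup>2\<close> bounds the norm of W in L^(d/2). For
  fixed l the estimate contains mass and gradient as a sum; the best l turns this sum into 4 times
  the product of the two norms, whose square gives the constant 16.\<close>

lemma abs_interaction_bound_dim23:
  fixes u :: "'a::euclidean_space \<Rightarrow> real"
  assumes s: "sobolev u G" and d: "DIM('a) \<in> {2, 3}" and W: "W \<in> borel_measurable borel"
    and N: "(\<integral>\<^sup>+x. ennreal (\<bar>W x\<bar> powr (real DIM('a) / 2)) \<partial>lborel) \<le> ennreal (\<eta> ^ DIM('a))" and \<eta>: "\<eta> > 0"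
  shows "abs_interaction W u \<le> ennreal (16 * \<eta>\<^sup>2 * nsq u * nsq G)"
proof -
  \<comment> \<open>The positive \<delta> keeps the optimal length a / b defined and positive when a
    norm vanishes; it tends to 0 at the end.\<close>
  have b: "abs_interaction W u \<le> ennreal (16 * \<eta>\<^sup>2 * (nsq u + \<delta>) * (nsq G + \<delta>))" if \<delta>: "\<delta> > 0" for \<delta>
  proof (cases "nsq u = 0 \<and> nsq G = 0")
    case True
    note [measurable] = L2_measurable[OF sobolev_L2(1)[OF s]] W
    have "AE x in lborel. u x = 0" using True nsq_eq_0_iff[OF sobolev_L2(1)[OF s]] by simp
    hence "(\<integral>\<^sup>+x. (\<integral>\<^sup>+y. ennreal ((u x)\<^sup>2 * \<bar>W (x - y)\<bar> * (u y)\<^sup>2) \<partial>lborel) \<partial>lborel) = (\<integral>\<^sup>+x. 0 \<partial>(lborel::'a measure))"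
      by (intro nn_integral_cong_AE) auto
    thus ?thesis unfolding abs_interaction_def by simp
  next
    case False
    define a where "a = sqrt (nsq u + \<delta>)"
    define b where "b = sqrt (nsq G + \<delta>)"
    have ab: "a > 0" "b > 0" "a\<^sup>2 = nsq u + \<delta>" "b\<^sup>2 = nsq G + \<delta>"
      using \<delta> by (auto simp: a_def b_def add_nonneg_pos)
    \<comment> \<open>The minimizer of 2 a^2 / l + 2 l b^2.\<close>
    define l where "l = a / b"
    have l: "l > 0" using ab by (simp add: l_def)
    have K: "2 / l * nsq u + 2 * l * nsq G > 0"
    proof (cases "nsq u = 0")
      case True
      hence "nsq G > 0" using False nsq_nonneg[of G] by linarith
      thus ?thesis using True l by simp
    next
      case False
      hence "nsq u > 0" using nsq_nonneg[of u] by linarith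
      hence "2 / l * nsq u > 0" "2 * l * nsq G \<ge> 0" using l by simp_all
      thus ?thesis by linarith
    qed
    have "abs_interaction W u \<le> ennreal (\<eta>\<^sup>2 * (2 / l * nsq u + 2 * l * nsq G)\<^sup>2)"
      using d abs_interaction_bound_dim2[OF s _ W N \<eta> l] abs_interaction_bound_dim3[OF s _ W N \<eta> l K] by auto
    also have "\<dots> \<le> ennreal (\<eta>\<^sup>2 * (2 / l * a\<^sup>2 + 2 * l * b\<^sup>2)\<^sup>2)"
      unfolding ab(3,4) using l \<delta> K
      by (intro ennreal_leI mult_left_mono power_mono add_mono) auto
    also have "2 / l * a\<^sup>2 + 2 * l * b\<^sup>2 = 4 * a * b"
      unfolding l_def using ab(1,2) by (simp add: field_simps power2_eq_square)
    also have "\<eta>\<^sup>2 * (4 * a * b)\<^sup>2 = 16 * \<eta>\<^sup>2 * (nsq u + \<delta>) * (nsq G + \<delta>)"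
      by (simp add: power_mult_distrib ab(3,4))
    finally show ?thesis .
  qed
  have "(\<lambda>n. ennreal (16 * \<eta>\<^sup>2 * (nsq u + 1 / real (Suc n)) * (nsq G + 1 / real (Suc n)))) \<longlonglongrightarrow> ennreal (16 * \<eta>\<^sup>2 * (nsq u + 0) * (nsq G + 0))"
    by (intro tendsto_ennrealI tendsto_intros LIMSEQ_Suc lim_1_over_n)
  from LIMSEQ_le_const[OF this, of "abs_interaction W u"] b show ?thesis by auto
qed

section \<open>Truncated potentials and the admissible class\<close>

text \<open>Cut off both in height and in space: the truncated interaction is then controlled by the
  L2 norm alone and has finite range, while the remainder of the potential tends to 0 in
  norm.\<close>

definition truncation :: "nat \<Rightarrow> ('a::euclidean_space \<Rightarrow> real) \<Rightarrow> 'a \<Rightarrow> real" where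
  "truncation n W x = (if \<bar>W x\<bar> \<le> real n \<and> norm x \<le> real n then W x else 0)"

lemma truncation_measurable [measurable]:
  assumes [measurable]: "W \<in> borel_measurable borel"
  shows "truncation n W \<in> borel_measurable borel"
  unfolding truncation_def[abs_def] by measurable

lemma truncation_remainder_tendsto:
  assumes [measurable]: "W \<in> borel_measurable borel" and i: "integrable lborel (\<lambda>x. \<bar>W x\<bar> powr p)" and p: "p > 0"
    and e: "e > 0"
  shows "\<exists>n. (\<integral>\<^sup>+x. ennreal (\<bar>W x - truncation n W x\<bar> powr p) \<partial>lborel) \<le> ennreal e"
proof -
  have le: "\<bar>W x - truncation n W x\<bar> powr p \<le> \<bar>W x\<bar> powr p" for n x by (auto simp: truncation_def)
  have int: "integrable lborel (\<lambda>x. \<bar>W x - truncation n W x\<bar> powr p)" for n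
    by (rule Bochner_Integration.integrable_bound[OF i]) (use le in auto)
  have "(\<lambda>n. \<integral>x. \<bar>W x - truncation n W x\<bar> powr p \<partial>lborel) \<longlonglongrightarrow> (\<integral>x. 0 \<partial>(lborel::'a measure))"
  proof (rule integral_dominated_convergence)
    show "integrable lborel (\<lambda>x. \<bar>W x\<bar> powr p)" by (rule i)
    show "AE x in lborel. (\<lambda>n. \<bar>W x - truncation n W x\<bar> powr p) \<longlonglongrightarrow> 0"
    proof (rule AE_I2)
      fix x
      obtain N where N: "real N \<ge> max \<bar>W x\<bar> (norm x)" using real_arch_simple by blast
      have "\<forall>\<^sub>F n in sequentially. \<bar>W x - truncation n W x\<bar> powr p = 0"
        using eventually_ge_at_top[of N]
      proof eventually_elim
        fix n assume "N \<le> n"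
        hence "real N \<le> real n" by simp
        thus "\<bar>W x - truncation n W x\<bar> powr p = 0" using N by (simp add: truncation_def)
      qed
      thus "(\<lambda>n. \<bar>W x - truncation n W x\<bar> powr p) \<longlonglongrightarrow> 0" by (rule tendsto_eventually)
    qed
    show "AE x in lborel. norm (\<bar>W x - truncation n W x\<bar> powr p) \<le> \<bar>W x\<bar> powr p" for n
      using le by simp
  qed measurable
  hence "\<forall>\<^sub>F n in sequentially. (\<integral>x. \<bar>W x - truncation n W x\<bar> powr p \<partial>lborel) < e"
    using e by (intro order_tendstoD(2)) simp_all
  then obtain n where "(\<integral>x. \<bar>W x - truncation n W x\<bar> powr p \<partial>lborel) < e"
    by (auto simp: eventually_sequentially)
  thus ?thesis using int[of n]
    by (intro exI[of _ n]) (subst nn_integral_eq_integral, auto intro: ennreal_leI)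
qed

text \<open>The exponent d / 2 would be 1/2 in dimension one; there the uniform bound on u pairs
  with an integrable potential instead.\<close>

definition admissible :: "('a::euclidean_space \<Rightarrow> real) \<Rightarrow> bool" where
  "admissible W \<longleftrightarrow> W \<in> borel_measurable borel \<and>
     integrable lborel (\<lambda>x. \<bar>W x\<bar> powr (if DIM('a) = 1 then 1 else real DIM('a) / 2))"

text \<open>The interaction bounds see the remainder of the potential only through its norm. The
  index n is chosen before the pair, so the error is uniform on bounded families of pairs.\<close>

lemma abs_interaction_truncation_small:
  fixes W :: "'a::euclidean_space \<Rightarrow> real"
  assumes d: "DIM('a) \<in> {1, 2, 3}" and W: "admissible W" and e: "e > 0"
  shows "\<exists>n. \<forall>u G. sobolev u G \<longrightarrow> abs_interaction (\<lambda>x. W x - truncation n W x) u \<le> ennreal (e * nsq u * (nsq u + nsq G))"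
proof (cases "DIM('a) = 1")
  case True
  have [measurable]: "W \<in> borel_measurable borel" using W by (simp add: admissible_def)
  obtain n where n: "(\<integral>\<^sup>+x. ennreal (\<bar>W x - truncation n W x\<bar> powr 1) \<partial>lborel) \<le> ennreal (e / 2)"
    using truncation_remainder_tendsto[of W 1 "e/2"] W e True by (auto simp: admissible_def)
  show ?thesis
  proof (intro exI[of _ n] allI impI)
    fix u :: "'a \<Rightarrow> real" and G assume s: "sobolev u G"
    show "abs_interaction (\<lambda>x. W x - truncation n W x) u \<le> ennreal (e * nsq u * (nsq u + nsq G))"
      using abs_interaction_bound_dim1[OF s True, of "\<lambda>x. W x - truncation n W x" "e/2"] n e by simp
  qed
next
  case False
  hence d': "DIM('a) \<in> {2, 3}" using d by auto
  have [measurable]: "W \<in> borel_measurable borel" using W by (simp add: admissible_def)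
  \<comment> \<open>Chosen so that the constant \<open>16 * \<eta>\<^sup>2\<close> of the
    interaction bound equals e.\<close>
  define \<eta> where "\<eta> = sqrt (e / 16)"
  have \<eta>: "\<eta> > 0" "16 * \<eta>\<^sup>2 = e" using e by (auto simp: \<eta>_def)
  obtain n where n: "(\<integral>\<^sup>+x. ennreal (\<bar>W x - truncation n W x\<bar> powr (real DIM('a) / 2)) \<partial>lborel) \<le> ennreal (\<eta> ^ DIM('a))"
    using truncation_remainder_tendsto[of W "real DIM('a) / 2" "\<eta> ^ DIM('a)"] W \<eta> False by (auto simp: admissible_def)
  show ?thesis
  proof (intro exI[of _ n] allI impI)
    fix u :: "'a \<Rightarrow> real" and G assume s: "sobolev u G"
    have "abs_interaction (\<lambda>x. W x - truncation n W x) u \<le> ennreal (16 * \<eta>\<^sup>2 * nsq u * nsq G)"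
      by (rule abs_interaction_bound_dim23[OF s d' _ n \<eta>(1)]) measurable
    also have "\<dots> \<le> ennreal (e * nsq u * (nsq u + nsq G))"
      unfolding \<eta>(2) using e by (intro ennreal_leI mult_left_mono) auto
    finally show "abs_interaction (\<lambda>x. W x - truncation n W x) u \<le> ennreal (e * nsq u * (nsq u + nsq G))" .
  qed
qed

text \<open>Unlike in dimension one, no term in the mass alone appears. At fixed mass the
  interaction is thus controlled by the gradient term, which yields both the positivity of the
  critical coupling and the vanishing energy of spread-out functions.\<close>

lemma abs_interaction_bound:
  fixes W :: "'a::euclidean_space \<Rightarrow> real"
  assumes d: "DIM('a) \<in> {2, 3}" and W: "admissible W"
  shows "\<exists>C>0. \<forall>u G. sobolev u G \<longrightarrow> abs_interaction W u \<le> ennreal (C * nsq u * nsq G)"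
proof -
  have [measurable]: "W \<in> borel_measurable borel" using W by (simp add: admissible_def)
  have i: "integrable lborel (\<lambda>x. \<bar>W x\<bar> powr (real DIM('a) / 2))" using W d by (auto simp: admissible_def)
  define N where "N = (\<integral>x. \<bar>W x\<bar> powr (real DIM('a) / 2) \<partial>lborel)"
  have N0: "N \<ge> 0" unfolding N_def by simp
  \<comment> \<open>At least 1, so that N is at most \<eta> and hence at most its d-th
    power.\<close>
  define \<eta> where "\<eta> = N + 1"
  have \<eta>: "\<eta> \<ge> 1" using N0 by (simp add: \<eta>_def)
  have "\<eta> ^ 1 \<le> \<eta> ^ DIM('a)" by (rule power_increasing) (use \<eta> in auto)
  hence "N \<le> \<eta> ^ DIM('a)" by (simp add: \<eta>_def)
  hence n: "(\<integral>\<^sup>+x. ennreal (\<bar>W x\<bar> powr (real DIM('a) / 2)) \<partial>lborel) \<le> ennreal (\<eta> ^ DIM('a))"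
    using i by (subst nn_integral_eq_integral) (auto simp: N_def intro: ennreal_leI)
  show ?thesis
    using abs_interaction_bound_dim23[OF _ d _ n] \<eta> by (intro exI[of _ "16 * \<eta>\<^sup>2"]) auto
qed

section \<open>Local compactness\<close>

text \<open>
  On bounded subsets of \<open>L\<^sup>2\<close>, convergence in this weighted norm is local \<open>L\<^sup>2\<close> convergence.
\<close>

definition weighted_sq :: "('a::euclidean_space \<Rightarrow> real) \<Rightarrow> real" where
  "weighted_sq v = (\<integral>x. (v x)\<^sup>2 / (1 + norm x) \<partial>lborel)"

lemma one_plus_norm_pos [simp]: "0 < 1 + norm x" "1 + norm x \<noteq> 0" "0 \<le> 1 + norm x"
  using norm_ge_zero[of x] by linarith+

lemma weighted_sq_integrable: assumes "L2 v" shows "integrable lborel (\<lambda>x. (v x)\<^sup>2 / (1 + norm x))"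
proof -
  note [measurable] = L2_measurable[OF assms]
  have "integrable lborel (\<lambda>x. (v x)\<^sup>2)" using L2_integrable[OF assms] by simp
  thus ?thesis
  proof (rule Bochner_Integration.integrable_bound)
    have "(v x)\<^sup>2 / (1 + norm x) \<le> (v x)\<^sup>2 / 1" for x by (rule divide_left_mono) auto
    thus "AE x in lborel. norm ((v x)\<^sup>2 / (1 + norm x)) \<le> norm ((v x)\<^sup>2)" by simp
  qed measurable
qed

lemma weighted_sq_nonneg: "0 \<le> weighted_sq v" unfolding weighted_sq_def by simp

lemma L2_tail_tendsto:
  fixes f :: "'a::euclidean_space \<Rightarrow> real"
  assumes "L2 f"
  shows "(\<lambda>n. \<integral>x. (f x)\<^sup>2 * indicator (- cball 0 (real n)) x \<partial>lborel) \<longlonglongrightarrow> 0"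
proof -
  note [measurable] = L2_measurable[OF assms]
  have "(\<lambda>n. \<integral>x. (f x)\<^sup>2 * indicator (- cball 0 (real n)) x \<partial>lborel) \<longlonglongrightarrow> (\<integral>x. 0 \<partial>(lborel::'a measure))"
  proof (rule integral_dominated_convergence)
    show "integrable lborel (\<lambda>x. (f x)\<^sup>2)" using L2_integrable[OF assms] by simp
    show "AE x in lborel. (\<lambda>n. (f x)\<^sup>2 * indicator (- cball 0 (real n)) x) \<longlonglongrightarrow> 0"
    proof (rule AE_I2)
      fix x :: 'a
      obtain N where N: "real N \<ge> norm x" using real_arch_simple by blast
      have "\<forall>\<^sub>F n in sequentially. (f x)\<^sup>2 * indicator (- cball 0 (real n)) x = 0"
        using eventually_ge_at_top[of N]
      proof eventually_elim
        fix n assume "N \<le> n"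
        hence "real N \<le> real n" by simp
        thus "(f x)\<^sup>2 * indicator (- cball 0 (real n)) x = 0" using N by (simp add: indicator_def)
      qed
      thus "(\<lambda>n. (f x)\<^sup>2 * indicator (- cball 0 (real n)) x) \<longlonglongrightarrow> 0" by (rule tendsto_eventually)
    qed
    show "AE x in lborel. norm ((f x)\<^sup>2 * indicator (- cball 0 (real n)) x) \<le> (f x)\<^sup>2" for n
      by (auto simp: indicator_def)
  qed measurable
  thus ?thesis by simp
qed

text \<open>Weak convergence to 0 even under absolute values, as the mixed products in the
  interaction require. On a ball the weighted norm controls \<open>v n\<close>; outside a large ball
  f is small.\<close>

lemma integral_abs_mult_tendsto_0:
  fixes f :: "'a::euclidean_space \<Rightarrow> real"
  assumes f: "L2 f" and v: "\<And>n. L2 (v n)" "\<And>n. nsq (v n) \<le> C" and w: "(\<lambda>n. weighted_sq (v n)) \<longlonglongrightarrow> 0"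
  shows "(\<lambda>n. \<integral>x. \<bar>f x * v n x\<bar> \<partial>lborel) \<longlonglongrightarrow> 0"
proof (rule LIMSEQ_I)
  fix e :: real assume e: "e > 0"
  note [measurable] = L2_measurable[OF f] L2_measurable[OF v(1)]
  have C: "C \<ge> 0" using v(2)[of 0] nsq_nonneg[of "v 0"] by linarith
  \<comment> \<open>Keeps the part of the bound that does not tend to 0 below e / 2.\<close>
  define \<delta> where "\<delta> = e / (nsq f + C + 1)"
  have s: "nsq f + C + 1 > 0" using C nsq_nonneg[of f] by linarith
  have \<delta>: "\<delta> > 0" using e s by (simp add: \<delta>_def)
  have \<delta>1: "\<delta> / 2 * (nsq f + C) \<le> e / 2"
  proof -
    have "\<delta> * (nsq f + C) \<le> \<delta> * (nsq f + C + 1)" using \<delta> by simp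
    also have "\<dots> = e" using s by (simp add: \<delta>_def)
    finally show ?thesis by simp
  qed
  define T where "T R = (\<integral>x. (f x)\<^sup>2 * indicator (- cball 0 (real R)) x \<partial>lborel)" for R
  have "\<forall>\<^sub>F R in sequentially. T R < \<delta> * e / 4"
    using L2_tail_tendsto[OF f] \<delta> e unfolding T_def by (intro order_tendstoD(2)) auto
  then obtain R where R: "T R < \<delta> * e / 4" by (auto simp: eventually_sequentially)
  have "\<forall>\<^sub>F n in sequentially. weighted_sq (v n) < \<delta> * e / 4 / (1 + real R)"
    using w \<delta> e by (intro order_tendstoD(2)) auto
  then obtain N where N: "\<And>n. n \<ge> N \<Longrightarrow> weighted_sq (v n) < \<delta> * e / 4 / (1 + real R)" by (auto simp: eventually_sequentially)
  have am: "\<bar>p * q\<bar> \<le> \<delta> / 2 * p\<^sup>2 + 1 / (2 * \<delta>) * q\<^sup>2" for p q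
  proof -
    have "0 \<le> (\<delta> * \<bar>p\<bar> - \<bar>q\<bar>)\<^sup>2 / (2 * \<delta>)" using \<delta> by simp
    also have "\<dots> = \<delta> / 2 * p\<^sup>2 + 1 / (2 * \<delta>) * q\<^sup>2 - \<bar>p * q\<bar>"
      using \<delta> unfolding power2_diff power_mult_distrib power2_abs abs_mult by (simp add: field_simps power2_eq_square)
    finally show ?thesis by simp
  qed
  show "\<exists>N. \<forall>n\<ge>N. norm ((\<integral>x. \<bar>f x * v n x\<bar> \<partial>lborel) - 0) < e"
  proof (intro exI[of _ N] allI impI)
    fix n assume n: "n \<ge> N"
    \<comment> \<open>The coefficient \<delta> / 2 goes with the factor that is merely bounded, 1 /
      (2 \<delta>) with the small one: this is \<open>v n\<close> inside the ball of radius R and f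
      outside it.\<close>
    let ?b = "\<lambda>x. \<delta> / 2 * ((f x)\<^sup>2 + (v n x)\<^sup>2) + 1 / (2 * \<delta>) * ((1 + real R) * ((v n x)\<^sup>2 / (1 + norm x)) + (f x)\<^sup>2 * indicator (- cball 0 (real R)) x)"
    have le: "\<bar>f x * v n x\<bar> \<le> ?b x" for x
    proof (cases "norm x \<le> real R")
      case True
      have "\<bar>f x * v n x\<bar> \<le> \<delta> / 2 * (f x)\<^sup>2 + 1 / (2 * \<delta>) * (v n x)\<^sup>2" by (rule am)
      also have "\<dots> \<le> \<delta> / 2 * ((f x)\<^sup>2 + (v n x)\<^sup>2) + 1 / (2 * \<delta>) * ((1 + real R) * ((v n x)\<^sup>2 / (1 + norm x)))"
      proof (intro add_mono mult_left_mono)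
        have "1 * (v n x)\<^sup>2 \<le> ((1 + real R) / (1 + norm x)) * (v n x)\<^sup>2"
          using True by (intro mult_right_mono) (auto simp: field_simps)
        thus "(v n x)\<^sup>2 \<le> (1 + real R) * ((v n x)\<^sup>2 / (1 + norm x))" by simp
      qed (use \<delta> in auto)
      finally show ?thesis using True by (simp add: indicator_def)
    next
      case False
      have "\<bar>v n x * f x\<bar> \<le> \<delta> / 2 * (v n x)\<^sup>2 + 1 / (2 * \<delta>) * (f x)\<^sup>2" by (rule am)
      also have "\<dots> \<le> \<delta> / 2 * ((f x)\<^sup>2 + (v n x)\<^sup>2) + 1 / (2 * \<delta>) * ((1 + real R) * ((v n x)\<^sup>2 / (1 + norm x)) + (f x)\<^sup>2)"
        by (intro add_mono mult_left_mono) (use \<delta> in auto)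
      finally show ?thesis using False by (simp add: indicator_def mult.commute)
    qed
    have fi: "integrable lborel (\<lambda>x. (f x)\<^sup>2)" "integrable lborel (\<lambda>x. (v n x)\<^sup>2)"
      using L2_integrable[OF f] L2_integrable[OF v(1)] by auto
    have ft: "integrable lborel (\<lambda>x. (f x)\<^sup>2 * indicator (- cball 0 (real R)) x)"
      by (rule integrable_real_mult_indicator[OF _ fi(1)]) simp
    note ints = fi ft weighted_sq_integrable[OF v(1)[of n]]
    have ib: "integrable lborel ?b"
      using ints by (intro Bochner_Integration.integrable_add integrable_mult_right) auto
    have "(\<integral>x. \<bar>f x * v n x\<bar> \<partial>lborel) \<le> (\<integral>x. ?b x \<partial>lborel)"
      using ib le by (intro integral_mono) (auto intro!: integrable_abs L2_mult_integrable f v)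
    also have "\<dots> = \<delta> / 2 * (nsq f + nsq (v n)) + 1 / (2 * \<delta>) * ((1 + real R) * weighted_sq (v n) + T R)"
      using ints unfolding nsq_def weighted_sq_def T_def by (simp only: Bochner_Integration.integral_add Bochner_Integration.integrable_add integrable_mult_right integral_mult_right_zero real_norm_def power2_abs)
    also have "\<dots> < \<delta> / 2 * (nsq f + C) + 1 / (2 * \<delta>) * (\<delta> * e / 4 + \<delta> * e / 4)"
    proof (rule add_le_less_mono)
      show "\<delta> / 2 * (nsq f + nsq (v n)) \<le> \<delta> / 2 * (nsq f + C)"
        using v(2)[of n] \<delta> by (intro mult_left_mono) auto
      have "(1 + real R) * weighted_sq (v n) < \<delta> * e / 4" using N[OF n] by (simp add: field_simps)
      thus "1 / (2 * \<delta>) * ((1 + real R) * weighted_sq (v n) + T R) < 1 / (2 * \<delta>) * (\<delta> * e / 4 + \<delta> * e / 4)"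
        using R \<delta> by (intro mult_strict_left_mono add_strict_mono) auto
    qed
    also have "\<dots> \<le> e / 2 + e / 4" using \<delta>1 \<delta> by (intro add_mono) (auto simp: field_simps)
    also have "\<dots> < e" using e by simp
    finally show "norm ((\<integral>x. \<bar>f x * v n x\<bar> \<partial>lborel) - 0) < e" by simp
  qed
qed

lemma integral_mult_tendsto_0:
  fixes f :: "'a::euclidean_space \<Rightarrow> real"
  assumes "L2 f" "\<And>n. L2 (v n)" "\<And>n. nsq (v n) \<le> C" "(\<lambda>n. weighted_sq (v n)) \<longlonglongrightarrow> 0"
  shows "(\<lambda>n. \<integral>x. f x * v n x \<partial>lborel) \<longlonglongrightarrow> 0"
proof (rule Lim_null_comparison[OF _ integral_abs_mult_tendsto_0[OF assms]])
  show "\<forall>\<^sub>F n in sequentially. norm (\<integral>x. f x * v n x \<partial>lborel) \<le> (\<integral>x. \<bar>f x * v n x\<bar> \<partial>lborel)"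
    using integral_norm_bound[of lborel "\<lambda>x. f x * v _ x"] by simp
qed

lemma weighted_sq_mid_le:
  assumes "L2 a" "L2 b"
  shows "weighted_sq (\<lambda>x. (a x + b x) / 2) \<le> (weighted_sq a + weighted_sq b) / 2"
proof -
  have "weighted_sq (\<lambda>x. (a x + b x) / 2) \<le> (\<integral>x. (1/2) * ((a x)\<^sup>2 / (1 + norm x)) + (1/2) * ((b x)\<^sup>2 / (1 + norm x)) \<partial>lborel)"
    unfolding weighted_sq_def
  proof (rule integral_mono)
    show "integrable lborel (\<lambda>x. ((a x + b x) / 2)\<^sup>2 / (1 + norm x))"
      using weighted_sq_integrable[OF L2_mult[OF L2_add[OF assms], of "1/2"]] by simp
    show "integrable lborel (\<lambda>x. (1/2) * ((a x)\<^sup>2 / (1 + norm x)) + (1/2) * ((b x)\<^sup>2 / (1 + norm x)))"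
      using assms by (intro Bochner_Integration.integrable_add integrable_mult_right weighted_sq_integrable)
    fix x
    have "0 \<le> ((a x - b x) / 2)\<^sup>2" by simp
    hence "((a x + b x) / 2)\<^sup>2 \<le> ((a x)\<^sup>2 + (b x)\<^sup>2) / 2"
      by (simp add: power2_eq_square field_simps)
    hence "((a x + b x) / 2)\<^sup>2 / (1 + norm x) \<le> ((a x)\<^sup>2 + (b x)\<^sup>2) / 2 / (1 + norm x)"
      by (rule divide_right_mono) simp
    also have "\<dots> = (1/2) * ((a x)\<^sup>2 / (1 + norm x)) + (1/2) * ((b x)\<^sup>2 / (1 + norm x))"
      by (simp add: add_divide_distrib)
    finally show "((a x + b x) / 2)\<^sup>2 / (1 + norm x) \<le> (1/2) * ((a x)\<^sup>2 / (1 + norm x)) + (1/2) * ((b x)\<^sup>2 / (1 + norm x))" .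
  qed
  also have "\<dots> = (1/2) * weighted_sq a + (1/2) * weighted_sq b"
    unfolding weighted_sq_def using weighted_sq_integrable[OF assms(1)] weighted_sq_integrable[OF assms(2)]
    by (simp only: Bochner_Integration.integral_add integrable_mult_right integral_mult_right_zero)
  finally show ?thesis by simp
qed

section \<open>Operations on Sobolev pairs and weak limits\<close>

lemma sobolev_lincomb:
  assumes "sobolev u G" "sobolev v H"
  shows "sobolev (\<lambda>x. c * u x + d * v x) (\<lambda>x. c *\<^sub>R G x + d *\<^sub>R H x)"
  unfolding sobolev_def
proof (intro conjI ballI allI impI)
  note L = sobolev_L2[OF assms(1)] sobolev_L2[OF assms(2)]
  show "L2 (\<lambda>x. c * u x + d * v x)" "L2 (\<lambda>x. c *\<^sub>R G x + d *\<^sub>R H x)"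
    using L by (auto intro: L2_add L2_mult L2_scaleR)
  fix b :: 'a and \<phi> :: "'a \<Rightarrow> real" assume b: "b \<in> Basis" and \<phi>: "test_function \<phi>"
  have P: "L2 (partial_deriv b \<phi>)" "L2 \<phi>" using b \<phi> by (auto intro: cc_L2 test_function_cc test_function_cc_partial)
  have "(\<integral>x. (c * u x + d * v x) * partial_deriv b \<phi> x \<partial>lborel)
      = c * (\<integral>x. u x * partial_deriv b \<phi> x \<partial>lborel) + d * (\<integral>x. v x * partial_deriv b \<phi> x \<partial>lborel)"
    using L2_mult_integrable[OF L(1) P(1)] L2_mult_integrable[OF L(3) P(1)]
    by (simp add: distrib_right mult.assoc)
  also have "\<dots> = - (c * (\<integral>x. (G x \<bullet> b) * \<phi> x \<partial>lborel) + d * (\<integral>x. (H x \<bullet> b) * \<phi> x \<partial>lborel))"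
    unfolding sobolev_ibp[OF assms(1) b \<phi>] sobolev_ibp[OF assms(2) b \<phi>] by simp
  also have "\<dots> = - (\<integral>x. ((c *\<^sub>R G x + d *\<^sub>R H x) \<bullet> b) * \<phi> x \<partial>lborel)"
    using L2_mult_integrable[OF L2_inner[OF L(2)] P(2), of b] L2_mult_integrable[OF L2_inner[OF L(4)] P(2), of b]
    by (simp add: inner_add_left distrib_right mult.assoc)
  finally show "(\<integral>x. (c * u x + d * v x) * partial_deriv b \<phi> x \<partial>lborel) = - (\<integral>x. ((c *\<^sub>R G x + d *\<^sub>R H x) \<bullet> b) * \<phi> x \<partial>lborel)" .
qed

lemma sobolev_diff: "sobolev u G \<Longrightarrow> sobolev v H \<Longrightarrow> sobolev (\<lambda>x. u x - v x) (\<lambda>x. G x - H x)"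
  using sobolev_lincomb[of u G v H 1 "-1"] by simp

lemma sobolev_cmult: "sobolev u G \<Longrightarrow> sobolev (\<lambda>x. c * u x) (\<lambda>x. c *\<^sub>R G x)"
  using sobolev_lincomb[of u G u G c 0] by simp

lemma sobolev_translate:
  assumes "sobolev u G" shows "sobolev (\<lambda>x. u (x + z)) (\<lambda>x. G (x + z))"
  unfolding sobolev_def
proof (intro conjI ballI allI impI)
  note L = sobolev_L2[OF assms]
  note [measurable] = L[THEN L2_measurable]
  show "L2 (\<lambda>x. u (x + z))" "L2 (\<lambda>x. G (x + z))" using L by (auto intro: L2_translate)
  fix b :: 'a and \<phi> :: "'a \<Rightarrow> real" assume b: "b \<in> Basis" and \<phi>: "test_function \<phi>"
  note [measurable] = cc_measurable[OF test_function_cc[OF \<phi>]] cc_measurable[OF test_function_cc_partial[OF \<phi> b]]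
  have \<psi>: "test_function (\<lambda>x. \<phi> (1 *\<^sub>R x + (- z)))" by (rule test_function_affine[OF \<phi>]) simp
  have p: "partial_deriv b (\<lambda>x. \<phi> (1 *\<^sub>R x + (- z))) = (\<lambda>x. partial_deriv b \<phi> (x - z))"
    using partial_deriv_affine[where f=\<phi> and c=1 and z="-z" and b=b, OF test_function_differentiable[OF \<phi>]] by auto
  have "(\<integral>x. u (x + z) * partial_deriv b \<phi> x \<partial>lborel) = (\<integral>x. u x * partial_deriv b \<phi> (x - z) \<partial>lborel)"
    using integral_translate[of "\<lambda>x. u x * partial_deriv b \<phi> (x - z)" z] by simp
  also have "\<dots> = - (\<integral>x. (G x \<bullet> b) * \<phi> (x - z) \<partial>lborel)"
    using sobolev_ibp[OF assms b \<psi>] unfolding p by simp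
  also have "\<dots> = - (\<integral>x. (G (x + z) \<bullet> b) * \<phi> x \<partial>lborel)"
    using integral_translate[of "\<lambda>x. (G x \<bullet> b) * \<phi> (x - z)" z] by simp
  finally show "(\<integral>x. u (x + z) * partial_deriv b \<phi> x \<partial>lborel) = - (\<integral>x. (G (x + z) \<bullet> b) * \<phi> x \<partial>lborel)" .
qed

lemma ip_tendsto:
  assumes "L2 F" "\<And>n. L2 (H n)" "L2 G" "(\<lambda>n. nsq (\<lambda>x. H n x - G x)) \<longlonglongrightarrow> 0"
  shows "(\<lambda>n. ip F (H n)) \<longlonglongrightarrow> ip F G"
proof -
  have e: "ip F (H n) - ip F G = ip F (\<lambda>x. H n x - G x)" for n
    using L2_integrable_inner(1)[OF assms(1,2)] L2_integrable_inner(1)[OF assms(1,3)]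
    by (simp add: ip_def inner_diff_right)
  have "(\<lambda>n. (ip F (H n) - ip F G)\<^sup>2) \<longlonglongrightarrow> 0"
  proof (rule Lim_null_comparison)
    show "\<forall>\<^sub>F n in sequentially. norm ((ip F (H n) - ip F G)\<^sup>2) \<le> nsq F * nsq (\<lambda>x. H n x - G x)"
      unfolding e using ip_bound[OF assms(1) L2_diff[OF assms(2,3)]] by simp
    show "(\<lambda>n. nsq F * nsq (\<lambda>x. H n x - G x)) \<longlonglongrightarrow> 0"
      using tendsto_mult[OF tendsto_const assms(4)] by simp
  qed
  hence "(\<lambda>n. ip F (H n) - ip F G) \<longlonglongrightarrow> 0" by simp
  thus ?thesis using LIM_zero_iff by blast
qed

text \<open>
  The limit gradient minimizes the norm over convex sets of gradients of functions closer and closer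
  to \<open>u\<close>; the parallelogram law makes near-minimizers a Cauchy sequence. The half-space constraint
  \<open>e \<le> ip F G\<close> survives since it is convex.
\<close>

lemma sobolev_weak_closure:
  assumes s: "\<And>n. sobolev (v n) (H n)" and C1: "\<And>n. nsq (v n) \<le> C1" and C: "\<And>n. nsq (H n) \<le> C"
    and u: "L2 u" and w: "(\<lambda>n. weighted_sq (\<lambda>x. v n x - u x)) \<longlonglongrightarrow> 0"
    and F: "L2 F" and e: "\<And>n. e \<le> ip F (H n)"
  shows "\<exists>G. sobolev u G \<and> e \<le> ip F G"
proof -
  define K where "K n = {(a, A). sobolev a A \<and> nsq a \<le> C1 \<and> weighted_sq (\<lambda>x. a x - u x) \<le> 1 / real (Suc n) \<and> e \<le> ip F A}" for n
  have K_mono: "K m \<subseteq> K n" if "n \<le> m" for m n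
  proof -
    have "1 / real (Suc m) \<le> 1 / real (Suc n)" using that by (simp add: field_simps)
    thus ?thesis unfolding K_def by (auto intro: order_trans)
  qed
  have K_ne: "\<exists>k. (v k, H k) \<in> K n" for n
  proof -
    have "\<forall>\<^sub>F k in sequentially. weighted_sq (\<lambda>x. v k x - u x) < 1 / real (Suc n)"
      using w by (intro order_tendstoD(2)) auto
    then obtain k where "weighted_sq (\<lambda>x. v k x - u x) < 1 / real (Suc n)" by (auto simp: eventually_sequentially)
    thus ?thesis using s C1 e by (intro exI[of _ k]) (auto simp: K_def)
  qed
  have K_mid: "((\<lambda>x. (1/2) * a x + (1/2) * b x), (\<lambda>x. (1/2) *\<^sub>R A x + (1/2) *\<^sub>R B x)) \<in> K n"
    if ab: "(a, A) \<in> K n" "(b, B) \<in> K n" for a A b B n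
  proof -
    have sa: "sobolev a A" and sb: "sobolev b B" using ab by (auto simp: K_def)
    note La = sobolev_L2[OF sa] and Lb = sobolev_L2[OF sb]
    have "nsq (\<lambda>x. (1/2) * a x + (1/2) * b x) \<le> 2 * nsq (\<lambda>x. (1/2) * a x) + 2 * nsq (\<lambda>x. (1/2) * b x)"
      by (intro nsq_add_le L2_mult La Lb)
    also have "\<dots> = (nsq a + nsq b) / 2" unfolding nsq_mult by (simp add: power2_eq_square)
    also have "\<dots> \<le> C1" using ab by (auto simp: K_def)
    finally have 1: "nsq (\<lambda>x. (1/2) * a x + (1/2) * b x) \<le> C1" .
    have "weighted_sq (\<lambda>x. ((1/2) * a x + (1/2) * b x) - u x) = weighted_sq (\<lambda>x. ((a x - u x) + (b x - u x)) / 2)"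
      by (intro arg_cong[where f=weighted_sq]) (auto simp: field_simps)
    also have "\<dots> \<le> (weighted_sq (\<lambda>x. a x - u x) + weighted_sq (\<lambda>x. b x - u x)) / 2"
      by (intro weighted_sq_mid_le L2_diff La Lb u)
    also have "\<dots> \<le> 1 / real (Suc n)" using ab by (auto simp: K_def)
    finally have 2: "weighted_sq (\<lambda>x. ((1/2) * a x + (1/2) * b x) - u x) \<le> 1 / real (Suc n)" .
    have "ip F (\<lambda>x. (1/2) *\<^sub>R A x + (1/2) *\<^sub>R B x) = (1/2) * ip F A + (1/2) * ip F B"
      using ip_add_right[OF F L2_scaleR[OF La(2), of "1/2"] L2_scaleR[OF Lb(2), of "1/2"]]
      unfolding ip_scaleR_right .
    hence 3: "e \<le> ip F (\<lambda>x. (1/2) *\<^sub>R A x + (1/2) *\<^sub>R B x)" using ab by (auto simp: K_def)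
    from 1 2 3 sobolev_lincomb[OF sa sb, of "1/2" "1/2"] show ?thesis unfolding K_def by blast
  qed
  define Q where "Q n = (\<lambda>(a, A). nsq A) ` K n" for n
  have Q_bdd: "bdd_below (Q n)" for n unfolding Q_def by (rule bdd_belowI[of _ 0]) auto
  have Q_ne: "Q n \<noteq> {}" for n using K_ne[of n] by (auto simp: Q_def)
  define d where "d n = Inf (Q n)" for n
  have d_le: "d n \<le> nsq A" if "(a, A) \<in> K n" for a A n
    unfolding d_def by (rule cInf_lower[OF _ Q_bdd]) (use that in \<open>force simp: Q_def\<close>)
  have d_mono: "d n \<le> d m" if "n \<le> m" for n m
    unfolding d_def by (rule cInf_superset_mono[OF Q_ne Q_bdd]) (use K_mono[OF that] in \<open>auto simp: Q_def\<close>)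
  have d_C: "d n \<le> C" for n
    using K_ne[of n] d_le C order_trans by blast
  have "\<exists>p. p \<in> K n \<and> nsq (snd p) < d n + 1 / real (Suc n)" for n
  proof -
    have "\<exists>q\<in>Q n. q < d n + 1 / real (Suc n)"
      using cInf_less_iff[OF Q_ne Q_bdd[of n], of "d n + 1 / real (Suc n)"] unfolding d_def by simp
    thus ?thesis by (force simp: Q_def)
  qed
  then obtain p where p: "\<And>n. p n \<in> K n" "\<And>n. nsq (snd (p n)) < d n + 1 / real (Suc n)" by metis
  define a where "a n = fst (p n)" for n
  define A where "A n = snd (p n)" for n
  have aK: "(a n, A n) \<in> K n" for n using p(1)[of n] by (simp add: a_def A_def)
  have An: "nsq (A n) < d n + 1 / real (Suc n)" for n using p(2)[of n] by (simp add: A_def)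
  have sa: "sobolev (a n) (A n)" and aC: "nsq (a n) \<le> C1" and aw: "weighted_sq (\<lambda>x. a n x - u x) \<le> 1 / real (Suc n)"
    and ae: "e \<le> ip F (A n)" for n
    using aK[of n] by (auto simp: K_def)
  note La = sobolev_L2(1)[OF sa] and LA = sobolev_L2(2)[OF sa]
  \<comment> \<open>For n <= m both near-minimizers lie in \<open>K n\<close>, hence so does their
    midpoint, whose gradient therefore has squared norm at least \<open>d n\<close>.\<close>
  have par: "nsq (\<lambda>x. A n x - A m x) \<le> 2 * (d m - d n) + 4 / real (Suc n)" if nm: "n \<le> m" for n m
  proof -
    have "(a m, A m) \<in> K n" using aK[of m] K_mono[OF nm] by auto
    from d_le[OF K_mid[OF aK this]]
    have "d n \<le> nsq (\<lambda>x. (1/2) *\<^sub>R (A n x + A m x))" by (simp add: scaleR_add_right)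
    hence "4 * d n \<le> nsq (\<lambda>x. A n x + A m x)" unfolding nsq_scaleR by (simp add: power2_eq_square)
    moreover have "nsq (\<lambda>x. A n x - A m x) + nsq (\<lambda>x. A n x + A m x) = 2 * nsq (A n) + 2 * nsq (A m)"
      using nsq_add[OF LA[of n] LA[of m]] nsq_diff[OF LA[of n] LA[of m]] by simp
    moreover have "1 / real (Suc m) \<le> 1 / real (Suc n)" using nm by (simp add: field_simps)
    moreover have "S \<le> 2 * (q - p) + 4 * s"
      if "4 * p \<le> X" "S + X = 2 * a + 2 * b" "t \<le> s" "a < p + s" "b < q + t" for S X a b p q s t :: real
      using that by argo
    ultimately have "nsq (\<lambda>x. A n x - A m x) \<le> 2 * (d m - d n) + 4 * (1 / real (Suc n))"
      using An[of n] An[of m] by blast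
    thus ?thesis by simp
  qed
  \<comment> \<open>The minimal values increase because the sets \<open>K n\<close> shrink, and they
    stay below C. Their convergence makes the right-hand side of the parallelogram estimate
    small.\<close>
  have "incseq d" using d_mono by (auto simp: incseq_def)
  then obtain D where D: "d \<longlonglongrightarrow> D" "\<And>n. d n \<le> D" using incseq_convergent[of d C] d_C by blast
  have cauchy: "\<exists>N. \<forall>m\<ge>N. \<forall>n\<ge>N. nsq (\<lambda>x. A m x - A n x) \<le> \<epsilon>" if \<epsilon>: "\<epsilon> > 0" for \<epsilon>
  proof -
    have "(\<lambda>n. 2 * (D - d n) + 4 / real (Suc n)) \<longlonglongrightarrow> 2 * (D - D) + 4 * 0"
      by (intro tendsto_intros D LIMSEQ_Suc lim_const_over_n[where a="4::real", simplified])
        (use lim_const_over_n[of "4::real"] in simp)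
    hence "\<forall>\<^sub>F n in sequentially. 2 * (D - d n) + 4 / real (Suc n) < \<epsilon>"
      using \<epsilon> by (intro order_tendstoD(2)) auto
    then obtain N where N: "\<And>n. n \<ge> N \<Longrightarrow> 2 * (D - d n) + 4 / real (Suc n) < \<epsilon>" by (auto simp: eventually_sequentially)
    have le: "nsq (\<lambda>x. A n x - A m x) \<le> \<epsilon>" if "N \<le> n" "n \<le> m" for n m
      using par[OF that(2)] N[OF that(1)] D(2)[of m] by argo
    have sym: "nsq (\<lambda>x. A m x - A n x) = nsq (\<lambda>x. A n x - A m x)" for m n
      unfolding nsq_def by (simp add: norm_minus_commute)
    show ?thesis by (intro exI[of _ N] allI impI) (metis le sym nat_le_linear)
  qed
  obtain G where GL: "L2 G" and AG: "(\<lambda>n. nsq (\<lambda>x. A n x - G x)) \<longlonglongrightarrow> 0"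
    by (rule L2_complete[of A, OF LA cauchy])
  have "e \<le> ip F G"
    by (rule LIMSEQ_le_const[OF ip_tendsto[OF F LA GL AG]]) (use ae in auto)
  moreover have "sobolev u G"
    unfolding sobolev_def
  proof (intro conjI ballI allI impI u GL)
    fix b :: 'a and \<phi> :: "'a \<Rightarrow> real" assume b: "b \<in> Basis" and \<phi>: "test_function \<phi>"
    have P: "L2 (partial_deriv b \<phi>)" "L2 \<phi>" using b \<phi> by (auto intro: cc_L2 test_function_cc test_function_cc_partial)
    have "(\<lambda>n. \<integral>x. partial_deriv b \<phi> x * (a n x - u x) \<partial>lborel) \<longlonglongrightarrow> 0"
    proof (rule integral_mult_tendsto_0[OF P(1)])
      show "L2 (\<lambda>x. a n x - u x)" for n by (intro L2_diff La u)
      show "nsq (\<lambda>x. a n x - u x) \<le> 2 * C1 + 2 * nsq u" for n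
        using nsq_diff_le[OF La[of n] u] aC[of n] by linarith
      show "(\<lambda>n. weighted_sq (\<lambda>x. a n x - u x)) \<longlonglongrightarrow> 0"
        using aw by (intro Lim_null_comparison[OF _ LIMSEQ_Suc[OF lim_1_over_n]] always_eventually)
          (simp add: abs_of_nonneg weighted_sq_nonneg)
    qed
    moreover have "(\<integral>x. partial_deriv b \<phi> x * (a n x - u x) \<partial>lborel)
        = - ip (\<lambda>x. \<phi> x *\<^sub>R b) (A n) - (\<integral>x. u x * partial_deriv b \<phi> x \<partial>lborel)" for n
      using sobolev_ibp[OF sa b \<phi>, of n] L2_mult_integrable[OF La[of n] P(1)] L2_mult_integrable[OF u P(1)]
      by (simp add: ip_def right_diff_distrib mult.commute inner_commute)
    moreover have "(\<lambda>n. - ip (\<lambda>x. \<phi> x *\<^sub>R b) (A n) - (\<integral>x. u x * partial_deriv b \<phi> x \<partial>lborel))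
        \<longlonglongrightarrow> - ip (\<lambda>x. \<phi> x *\<^sub>R b) G - (\<integral>x. u x * partial_deriv b \<phi> x \<partial>lborel)"
    proof (intro tendsto_diff tendsto_minus tendsto_const ip_tendsto LA GL AG)
      show "L2 (\<lambda>x. \<phi> x *\<^sub>R b)"
        using L2_measurable[OF P(2)] L2_integrable[OF P(2)] b by (simp add: L2_def)
    qed
    ultimately have "0 = - ip (\<lambda>x. \<phi> x *\<^sub>R b) G - (\<integral>x. u x * partial_deriv b \<phi> x \<partial>lborel)"
      using LIMSEQ_unique by (simp only:) blast
    thus "(\<integral>x. u x * partial_deriv b \<phi> x \<partial>lborel) = - (\<integral>x. (G x \<bullet> b) * \<phi> x \<partial>lborel)"
      by (simp add: ip_def mult.commute inner_commute)
  qed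
  ultimately show ?thesis by blast
qed

lemma sobolev_zero:
  assumes s: "sobolev u G" and 0: "AE x in lborel. u x = 0"
  shows "AE x in lborel. G x = 0"
proof -
  note [measurable] = L2_measurable[OF sobolev_L2(1)[OF s]] L2_measurable[OF sobolev_L2(2)[OF s]]
  have "AE x in lborel. \<forall>b\<in>Basis. G x \<bullet> b = 0"
  proof (rule AE_finite_allI)
    fix b :: 'a assume b: "b \<in> Basis"
    show "AE x in lborel. G x \<bullet> b = 0"
    proof (rule AE_eq_0_if_orthogonal_to_test_functions)
      show "(\<lambda>x. G x \<bullet> b) \<in> borel_measurable borel" by measurable
      show "integrable lborel (\<lambda>x. indicator (cball 0 R) x * (G x \<bullet> b))" for R
        by (rule L2_loc_integrable[OF L2_inner[OF sobolev_L2(2)[OF s]]])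
      fix \<phi> :: "'a \<Rightarrow> real" assume \<phi>: "test_function \<phi>"
      have "(\<integral>x. u x * partial_deriv b \<phi> x \<partial>lborel) = (\<integral>x. 0 \<partial>(lborel::'a measure))"
        using 0 cc_measurable[OF test_function_cc_partial[OF \<phi> b]] by (intro integral_cong_AE) auto
      thus "(\<integral>x. (G x \<bullet> b) * \<phi> x \<partial>lborel) = 0" using sobolev_ibp[OF s b \<phi>] by simp
    qed
  qed simp
  thus ?thesis by eventually_elim (simp add: euclidean_all_zero_iff)
qed

text \<open>Otherwise the inner products stay at least e > 0 in absolute value along a subsequence.
  Weak closure with limit function 0 then produces a gradient of 0 in the same half-space, although
  a gradient of 0 vanishes almost everywhere. This is the purpose of the half-space constraint in
  \<open>sobolev_weak_closure\<close>.\<close>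

lemma sobolev_weak_convergence:
  assumes s: "\<And>n. sobolev (v n) (H n)" and C1: "\<And>n. nsq (v n) \<le> C1" and C: "\<And>n. nsq (H n) \<le> C"
    and w: "(\<lambda>n. weighted_sq (v n)) \<longlonglongrightarrow> 0" and F: "L2 F"
  shows "(\<lambda>n. ip F (H n)) \<longlonglongrightarrow> 0"
proof (rule ccontr)
  assume "\<not> ?thesis"
  then obtain e where e: "e > 0" and inf: "\<And>N. \<exists>n\<ge>N. \<bar>ip F (H n)\<bar> \<ge> e"
    by (auto simp: LIMSEQ_iff not_less)
  have no: "finite {n. e \<le> ip F' (H n)}" if F': "L2 F'" for F'
  proof (rule ccontr)
    assume "infinite {n. e \<le> ip F' (H n)}"
    then obtain r :: "nat \<Rightarrow> nat" where r: "strict_mono r" "\<And>n. r n \<in> {n. e \<le> ip F' (H n)}"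
      using infinite_enumerate by blast
    have "\<exists>G. sobolev (\<lambda>_. 0) G \<and> e \<le> ip F' G"
    proof (rule sobolev_weak_closure[of "\<lambda>n. v (r n)" "\<lambda>n. H (r n)"])
      show "(\<lambda>n. weighted_sq (\<lambda>x. v (r n) x - 0)) \<longlonglongrightarrow> 0"
        using LIMSEQ_subseq_LIMSEQ[OF w r(1)] by (simp add: o_def)
    qed (use s C1 C F' r in auto)
    then obtain G where G: "sobolev (\<lambda>_. 0) G" "e \<le> ip F' G" by blast
    have "AE x in lborel. G x = 0" by (rule sobolev_zero[OF G(1)]) simp
    hence "ip F' G = (\<integral>x. 0 \<partial>(lborel::'a measure))" unfolding ip_def
      using L2_measurable[OF F'] L2_measurable[OF sobolev_L2(2)[OF G(1)]] by (intro integral_cong_AE) auto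
    thus False using G(2) e by simp
  qed
  \<comment> \<open>Values below -e are covered by the negative of F.\<close>
  have "ip (\<lambda>x. - F x) (H n) = - ip F (H n)" for n by (simp add: ip_def)
  moreover have "L2 (\<lambda>x. - F x)" using L2_scaleR[OF F, of "-1"] by simp
  ultimately have "finite ({n. e \<le> ip F (H n)} \<union> {n. e \<le> - ip F (H n)})"
    using no[OF F] no[of "\<lambda>x. - F x"] by simp
  hence "finite {n. \<bar>ip F (H n)\<bar> \<ge> e}" by (rule finite_subset[rotated]) auto
  then obtain N where "\<And>n. \<bar>ip F (H n)\<bar> \<ge> e \<Longrightarrow> n < N" using finite_nat_bounded by blast
  with inf[of N] show False by (metis not_less)
qed

section \<open>Averages over balls and local compactness\<close>

text \<open>The average of v over the ball of radius r around x, in the role of a mollification: it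
  is Lipschitz with a constant governed by the gradient, and for small r it is close to v in
  L2.\<close>

definition ball_average :: "real \<Rightarrow> ('a::euclidean_space \<Rightarrow> real) \<Rightarrow> 'a \<Rightarrow> real" where
  "ball_average r v x = (\<integral>z. indicator (cball 0 r) z * v (z + x) \<partial>lborel) / measure lborel (cball (0::'a) r)"

lemma ball_average_measurable:
  fixes v :: "'a::euclidean_space \<Rightarrow> real"
  assumes [measurable]: "v \<in> borel_measurable borel"
  shows "ball_average r v \<in> borel_measurable borel"
proof -
  have [measurable]: "cball (0::'a) r \<in> sets borel" by simp
  show ?thesis unfolding ball_average_def[abs_def] by measurable
qed

lemma measure_cball_pos: "r > 0 \<Longrightarrow> measure lborel (cball (c::'a::euclidean_space) r) > 0"
  by (simp add: content_cball_pos)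

lemma nsq_indicator_cball: "nsq (indicator (cball c r) :: 'a::euclidean_space \<Rightarrow> real) = measure lborel (cball c r)"
proof -
  have "(\<lambda>x. (norm (indicator (cball c r) x :: real))\<^sup>2) = (indicator (cball c r) :: 'a \<Rightarrow> real)"
    by (auto simp: indicator_def)
  thus ?thesis unfolding nsq_def by simp
qed

text \<open>Cauchy--Schwarz against the indicator of the ball. The function f is arbitrary so that
  averages, their increments and their distance from the averaged function are all covered.\<close>

lemma ball_average_bound:
  fixes f :: "'a::euclidean_space \<Rightarrow> real"
  assumes r: "r > 0" and f: "L2 f" and eq: "I = (\<integral>z. indicator (cball 0 r) z * f z \<partial>lborel) / measure lborel (cball (0::'a) r)"
  shows "I\<^sup>2 \<le> nsq f / measure lborel (cball (0::'a) r)"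
proof -
  let ?B = "measure lborel (cball (0::'a) r)"
  have B: "?B > 0" using measure_cball_pos[OF r] .
  have "I = ip (indicator (cball 0 r)) f / ?B" by (simp add: eq ip_def)
  hence "I\<^sup>2 = (ip (indicator (cball 0 r)) f)\<^sup>2 / ?B\<^sup>2" by (simp add: power_divide)
  also have "\<dots> \<le> (?B * nsq f) / ?B\<^sup>2"
    using ip_bound[OF L2_indicator_cball[of 0 r] f] by (intro divide_right_mono) (auto simp: nsq_indicator_cball)
  also have "\<dots> = nsq f / ?B" using B by (simp add: power2_eq_square)
  finally show ?thesis .
qed

lemma ball_average_square_le:
  fixes v :: "'a::euclidean_space \<Rightarrow> real"
  assumes "r > 0" "L2 v"
  shows "(ball_average r v x)\<^sup>2 \<le> nsq v / measure lborel (cball (0::'a) r)"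
  using ball_average_bound[OF assms(1) L2_translate[OF assms(2), of x] ball_average_def] nsq_translate[OF assms(2)] by simp

lemma ball_average_diff_le:
  fixes v :: "'a::euclidean_space \<Rightarrow> real"
  assumes r: "r > 0" and s: "sobolev v H"
  shows "(ball_average r v x - ball_average r v y)\<^sup>2 \<le> (norm (x - y))\<^sup>2 * nsq H / measure lborel (cball (0::'a) r)"
proof -
  let ?B = "measure lborel (cball (0::'a) r)"
  have v: "L2 v" using s by (rule sobolev_L2)
  have i: "integrable lborel (\<lambda>z. indicator (cball 0 r) z * v (z + x))" for x
    by (rule L2_loc_integrable[OF L2_translate[OF v]])
  have "ball_average r v x - ball_average r v y = (\<integral>z. indicator (cball 0 r) z * (v (z + x) - v (z + y)) \<partial>lborel) / ?B"
    unfolding ball_average_def using i[of x] i[of y] by (simp add: right_diff_distrib diff_divide_distrib)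
  from ball_average_bound[OF r L2_diff[OF L2_translate[OF v] L2_translate[OF v]] this]
  have "(ball_average r v x - ball_average r v y)\<^sup>2 \<le> nsq (\<lambda>z. v (z + x) - v (z + y)) / ?B" .
  also have "nsq (\<lambda>z. v (z + x) - v (z + y)) = nsq (\<lambda>z. v (z + (x - y)) - v z)"
    using nsq_translate[OF L2_diff[OF L2_translate[OF v, of "x - y"] v], of y] by (simp add: algebra_simps)
  also have "\<dots> / ?B \<le> (norm (x - y))\<^sup>2 * nsq H / ?B"
    by (intro divide_right_mono nsq_translate_diff_le[OF s]) simp
  finally show ?thesis .
qed

text \<open>The difference is an average over |z| <= r of translation increments, each of squared
  norm at most \<open>r\<^sup>2 * nsq H\<close>.\<close>

lemma ball_average_approx:
  fixes v :: "'a::euclidean_space \<Rightarrow> real"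
  assumes r: "r > 0" and s: "sobolev v H"
  shows "L2 (\<lambda>x. v x - ball_average r v x)" "nsq (\<lambda>x. v x - ball_average r v x) \<le> r\<^sup>2 * nsq H"
proof -
  let ?B = "measure lborel (cball (0::'a) r)"
  have B: "?B > 0" using measure_cball_pos[OF r] .
  have v: "L2 v" using s by (rule sobolev_L2)
  note [measurable] = L2_measurable[OF v] ball_average_measurable[OF L2_measurable[OF v], of r]
  have [measurable]: "cball (0::'a) r \<in> sets borel" by simp
  have pt: "ennreal ((norm (v x - ball_average r v x))\<^sup>2) \<le> (\<integral>\<^sup>+z. ennreal (1 / ?B) * (indicator (cball 0 r) z * ennreal ((v (z + x) - v x)\<^sup>2)) \<partial>lborel)" for x
  proof -
    let ?i = "indicator (cball 0 r) :: 'a \<Rightarrow> real"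
    have iv: "integrable lborel (\<lambda>z. ?i z * v (z + x))"
      by (rule L2_loc_integrable[OF L2_translate[OF v]])
    have ii: "integrable lborel ?i"
      using emeasure_lborel_cball_finite[of "0::'a" r] by (intro integrable_real_indicator) auto
    \<comment> \<open>The constant \<open>v x\<close> is not square integrable on the whole space
      unless it vanishes, so the increment is first cut off by the indicator.\<close>
    have gL: "L2 (\<lambda>z. ?i z * (v (z + x) - v x))"
    proof -
      have "integrable lborel (\<lambda>z. ?i z * (v (z + x))\<^sup>2)"
        using integrable_real_mult_indicator[of "cball 0 r" lborel "\<lambda>z. (v (z + x))\<^sup>2"] L2_integrable[OF L2_translate[OF v, of x]]
        by (simp add: mult.commute)
      hence "integrable lborel (\<lambda>z. ?i z * (v (z + x))\<^sup>2 - 2 * v x * (?i z * v (z + x)) + (v x)\<^sup>2 * ?i z)"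
        using iv ii by (intro Bochner_Integration.integrable_add Bochner_Integration.integrable_diff integrable_mult_right)
      moreover have "(norm (?i z * (v (z + x) - v x)))\<^sup>2 = ?i z * (v (z + x))\<^sup>2 - 2 * v x * (?i z * v (z + x)) + (v x)\<^sup>2 * ?i z" for z
        by (auto simp: indicator_def power2_eq_square algebra_simps)
      moreover have "(\<lambda>z. ?i z * (v (z + x) - v x)) \<in> borel_measurable borel" by measurable
      ultimately show ?thesis unfolding L2_def by (simp only: simp_thms)
    qed
    \<comment> \<open>The indicator appears twice, being idempotent: one copy is the averaging
      kernel, the other belongs to the square integrable factor.\<close>
    have "v x - ball_average r v x = (\<integral>z. ?i z * (- (?i z * (v (z + x) - v x))) \<partial>lborel) / ?B"
    proof -
      have "(\<integral>z. ?i z * (- (?i z * (v (z + x) - v x))) \<partial>lborel) = (\<integral>z. v x * ?i z - ?i z * v (z + x) \<partial>lborel)"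
        by (intro Bochner_Integration.integral_cong refl) (auto simp: indicator_def)
      also have "\<dots> = v x * ?B - (\<integral>z. ?i z * v (z + x) \<partial>lborel)"
        using iv ii by simp
      finally show ?thesis using B by (simp add: ball_average_def field_simps)
    qed
    from ball_average_bound[OF r _ this] L2_mult[OF gL, of "-1"]
    have "(v x - ball_average r v x)\<^sup>2 \<le> nsq (\<lambda>z. - (?i z * (v (z + x) - v x))) / ?B" by simp
    also have "nsq (\<lambda>z. - (?i z * (v (z + x) - v x))) = nsq (\<lambda>z. ?i z * (v (z + x) - v x))"
      unfolding nsq_def by simp
    finally have "ennreal ((v x - ball_average r v x)\<^sup>2) \<le> ennreal (1 / ?B) * ennreal (nsq (\<lambda>z. ?i z * (v (z + x) - v x)))"
      using B by (subst ennreal_mult[symmetric]) (auto intro: ennreal_leI)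
    also have "ennreal (nsq (\<lambda>z. ?i z * (v (z + x) - v x))) = (\<integral>\<^sup>+z. ennreal ((norm (?i z * (v (z + x) - v x)))\<^sup>2) \<partial>lborel)"
      by (rule nn_integral_nsq[OF gL, symmetric])
    also have "\<dots> = (\<integral>\<^sup>+z. indicator (cball 0 r) z * ennreal ((v (z + x) - v x)\<^sup>2) \<partial>lborel)"
      by (intro nn_integral_cong) (auto simp: indicator_def)
    finally show ?thesis by (simp add: nn_integral_cmult)
  qed
  have "(\<integral>\<^sup>+x. ennreal ((norm (v x - ball_average r v x))\<^sup>2) \<partial>lborel)
    \<le> (\<integral>\<^sup>+x. (\<integral>\<^sup>+z. ennreal (1 / ?B) * (indicator (cball 0 r) z * ennreal ((v (z + x) - v x)\<^sup>2)) \<partial>lborel) \<partial>lborel)"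
    by (intro nn_integral_mono pt)
  also have "\<dots> = (\<integral>\<^sup>+z. (\<integral>\<^sup>+x. ennreal (1 / ?B) * (indicator (cball 0 r) z * ennreal ((v (z + x) - v x)\<^sup>2)) \<partial>lborel) \<partial>lborel)"
    by (rule lborel_pair.Fubini') measurable
  also have "\<dots> \<le> (\<integral>\<^sup>+z. ennreal (1 / ?B) * (indicator (cball 0 r) (z::'a) * ennreal (r\<^sup>2 * nsq H)) \<partial>lborel)"
  proof (rule nn_integral_mono)
    fix z :: 'a
    have "(\<integral>\<^sup>+x. ennreal ((v (z + x) - v x)\<^sup>2) \<partial>lborel) = ennreal (nsq (\<lambda>x. v (x + z) - v x))"
      using nn_integral_nsq[OF L2_diff[OF L2_translate[OF v, of z] v]] by (simp add: add.commute)
    also have "\<dots> \<le> ennreal (r\<^sup>2 * nsq H)" if "z \<in> cball 0 r"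
      using that by (intro ennreal_leI order_trans[OF nsq_translate_diff_le[OF s]] mult_right_mono power_mono) auto
    finally show "(\<integral>\<^sup>+x. ennreal (1 / ?B) * (indicator (cball 0 r) z * ennreal ((v (z + x) - v x)\<^sup>2)) \<partial>lborel)
        \<le> ennreal (1 / ?B) * (indicator (cball 0 r) z * ennreal (r\<^sup>2 * nsq H))"
      by (cases "z \<in> cball 0 r") (auto simp: nn_integral_cmult intro!: mult_left_mono)
  qed
  also have "\<dots> = ennreal (1 / ?B) * (emeasure lborel (cball (0::'a) r) * ennreal (r\<^sup>2 * nsq H))"
    by (simp add: nn_integral_cmult nn_integral_multc)
  also have "emeasure lborel (cball (0::'a) r) = ennreal ?B"
    using emeasure_lborel_cball_finite[of "0::'a" r] by (intro emeasure_eq_ennreal_measure) auto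
  also have "ennreal (1 / ?B) * (ennreal ?B * ennreal (r\<^sup>2 * nsq H)) = ennreal (r\<^sup>2 * nsq H)"
    using B by (simp add: ennreal_mult[symmetric])
  finally have le: "(\<integral>\<^sup>+x. ennreal ((norm (v x - ball_average r v x))\<^sup>2) \<partial>lborel) \<le> ennreal (r\<^sup>2 * nsq H)" .
  have m: "(\<lambda>x. v x - ball_average r v x) \<in> borel_measurable borel" by measurable
  from nn_integral_imp_L2[OF m le]
  show "L2 (\<lambda>x. v x - ball_average r v x)" "nsq (\<lambda>x. v x - ball_average r v x) \<le> r\<^sup>2 * nsq H" by auto
qed

text \<open>The Rellich theorem at precision e. Averages over balls of radius \<delta> are bounded
  and equicontinuous, so Arzela--Ascoli makes a subsequence uniformly close on a large ball. The
  errors from averaging, from the uniform distance and from the tail take e / 3 each.\<close>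

lemma sobolev_weighted_sq_subsequence:
  fixes v :: "nat \<Rightarrow> 'a::euclidean_space \<Rightarrow> real"
  assumes s: "\<And>n. sobolev (v n) (H n)" and C1: "\<And>n. nsq (v n) \<le> C" and C: "\<And>n. nsq (H n) \<le> C" and e: "e > 0"
  shows "\<exists>r :: nat \<Rightarrow> nat. strict_mono r \<and> (\<exists>N. \<forall>m\<ge>N. \<forall>n\<ge>N. weighted_sq (\<lambda>x. v (r m) x - v (r n) x) \<le> e)"
proof -
  have C0: "C \<ge> 0" using C[of 0] nsq_nonneg[of "H 0"] by linarith
  note v = sobolev_L2(1)[OF s]
  \<comment> \<open>Sized for two averaging errors, each with the factor 3 from the square of a sum
    of three terms.\<close>
  define \<delta> where "\<delta> = sqrt (e / (18 * (C + 1)))"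
  have \<delta>: "\<delta> > 0" "\<delta>\<^sup>2 = e / (18 * (C + 1))" using e C0 by (auto simp: \<delta>_def)
  have \<delta>C: "6 * (\<delta>\<^sup>2 * C) \<le> e / 3"
  proof -
    have "\<delta>\<^sup>2 * C \<le> \<delta>\<^sup>2 * (C + 1)" by (intro mult_left_mono) auto
    also have "\<dots> = e / 18" unfolding \<delta>(2) using C0 by (simp add: field_simps)
    finally show ?thesis by simp
  qed
  \<comment> \<open>Outside the ball of radius R the weight is at most 1 / (1 + R), and a difference
    of two members of the sequence has squared norm at most 4 C.\<close>
  define R where "R = 12 * C / e"
  have R: "R \<ge> 0" "4 * C / (1 + R) \<le> e / 3" using e C0 by (auto simp: R_def field_simps)
  let ?D = "cball (0::'a) R"
  let ?A = "\<lambda>n. ball_average \<delta> (v n)"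
  let ?b = "measure lborel (cball (0::'a) \<delta>)"
  have b: "?b > 0" by (rule measure_cball_pos[OF \<delta>(1)])
  have bd: "norm (?A n x) \<le> sqrt (C / ?b)" for n x
  proof -
    have "(?A n x)\<^sup>2 \<le> nsq (v n) / ?b" by (rule ball_average_square_le[OF \<delta>(1) v])
    also have "\<dots> \<le> C / ?b" using C1 b by (intro divide_right_mono) auto
    finally have "sqrt ((?A n x)\<^sup>2) \<le> sqrt (C / ?b)" by (rule real_sqrt_le_mono)
    thus ?thesis by simp
  qed
  have lip: "norm (?A n x - ?A n y) \<le> norm (x - y) * sqrt (C / ?b)" for n x y
  proof -
    have "(?A n x - ?A n y)\<^sup>2 \<le> (norm (x - y))\<^sup>2 * nsq (H n) / ?b" by (rule ball_average_diff_le[OF \<delta>(1) s])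
    also have "\<dots> \<le> (norm (x - y))\<^sup>2 * C / ?b" using C b by (intro divide_right_mono mult_left_mono) auto
    finally have "sqrt ((?A n x - ?A n y)\<^sup>2) \<le> sqrt ((norm (x - y))\<^sup>2 * C / ?b)" by (rule real_sqrt_le_mono)
    thus ?thesis by (simp add: real_sqrt_mult real_sqrt_divide)
  qed
  have equi: "\<exists>d. 0 < d \<and> (\<forall>n y. y \<in> ?D \<and> norm (x - y) < d \<longrightarrow> norm (?A n x - ?A n y) < \<epsilon>)" if "\<epsilon> > 0" for x \<epsilon>
  proof -
    let ?L = "sqrt (C / ?b) + 1"
    have L: "?L > 0" using C0 b by (simp add: add_nonneg_pos)
    have "norm (?A n x - ?A n y) < \<epsilon>" if d: "norm (x - y) < \<epsilon> / ?L" for n y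
    proof -
      have "norm (?A n x - ?A n y) \<le> norm (x - y) * sqrt (C / ?b)" by (rule lip)
      also have "\<dots> \<le> norm (x - y) * ?L" by (intro mult_left_mono) auto
      also have "\<dots> < \<epsilon>" using d L by (simp add: field_simps)
      finally show ?thesis .
    qed
    thus ?thesis using L \<open>\<epsilon> > 0\<close> by (intro exI[of _ "\<epsilon> / ?L"]) auto
  qed
  obtain g k where k: "strict_mono (k :: nat \<Rightarrow> nat)"
    and unif: "\<And>\<epsilon>. 0 < \<epsilon> \<Longrightarrow> \<exists>N. \<forall>n x. n \<ge> N \<and> x \<in> ?D \<longrightarrow> norm (?A (k n) x - g x) < \<epsilon>"
    using Arzela_Ascoli[OF compact_cball, of 0 R ?A "sqrt (C / ?b)"] bd equi by (metis (no_types, lifting))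
  define m where "m = measure lborel ?D"
  have m0: "m \<ge> 0" by (simp add: m_def)
  \<comment> \<open>A uniform distance \<tau> on a ball of volume m contributes at most e / 3; the
    added 1 covers the case of volume 0.\<close>
  define \<tau> where "\<tau> = sqrt (e / (9 * (m + 1)))"
  have \<tau>: "\<tau> > 0" "\<tau>\<^sup>2 = e / (9 * (m + 1))" using e m0 by (auto simp: \<tau>_def)
  have \<tau>m: "3 * (\<tau>\<^sup>2 * m) \<le> e / 3"
  proof -
    have "\<tau>\<^sup>2 * m \<le> \<tau>\<^sup>2 * (m + 1)" by (intro mult_left_mono) auto
    also have "\<dots> = e / 9" unfolding \<tau>(2) using m0 by (simp add: field_simps)
    finally show ?thesis by simp
  qed
  obtain N where N: "\<And>n x. n \<ge> N \<Longrightarrow> x \<in> ?D \<Longrightarrow> norm (?A (k n) x - g x) < \<tau> / 2"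
    using unif[of "\<tau> / 2"] \<tau> by auto
  have "weighted_sq (\<lambda>x. v (k i) x - v (k j) x) \<le> e" if ij: "i \<ge> N" "j \<ge> N" for i j
  proof -
    let ?p = "v (k i)" and ?q = "v (k j)" and ?P = "?A (k i)" and ?Q = "?A (k j)"
    have dL: "L2 (\<lambda>x. ?p x - ?q x)" by (intro L2_diff v)
    have aL: "L2 (\<lambda>x. ?p x - ?P x)" "L2 (\<lambda>x. ?q x - ?Q x)" by (intro ball_average_approx[OF \<delta>(1) s])+
    let ?rhs = "\<lambda>x. 3 * (?p x - ?P x)\<^sup>2 + 3 * (?q x - ?Q x)\<^sup>2 + 3 * \<tau>\<^sup>2 * indicator ?D x + 1 / (1 + R) * (?p x - ?q x)\<^sup>2"
    have pt: "(?p x - ?q x)\<^sup>2 / (1 + norm x) \<le> ?rhs x" for x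
    proof (cases "x \<in> ?D")
      case True
      have "\<bar>?P x - ?Q x\<bar> \<le> \<tau>" using N[OF ij(1) True] N[OF ij(2) True] by (auto simp: abs_if split: if_splits)
      hence "(?P x - ?Q x)\<^sup>2 \<le> \<tau>\<^sup>2" using \<tau>(1) by (simp add: abs_le_square_iff[symmetric])
      moreover have "(?p x - ?q x)\<^sup>2 \<le> 3 * (?p x - ?P x)\<^sup>2 + 3 * (?q x - ?Q x)\<^sup>2 + 3 * (?P x - ?Q x)\<^sup>2"
      proof -
        have "(a - b + c)\<^sup>2 \<le> 3 * a\<^sup>2 + 3 * b\<^sup>2 + 3 * c\<^sup>2" for a b c :: real
          using zero_le_power2[of "a + b"] zero_le_power2[of "a - c"] zero_le_power2[of "b + c"]
          by (simp add: power2_eq_square algebra_simps)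
        from this[of "?p x - ?P x" "?q x - ?Q x" "?P x - ?Q x"] show ?thesis by simp
      qed
      moreover have "(?p x - ?q x)\<^sup>2 / (1 + norm x) \<le> (?p x - ?q x)\<^sup>2 / 1" by (rule divide_left_mono) auto
      moreover have "0 \<le> 1 / (1 + R) * (?p x - ?q x)\<^sup>2" using R by simp
      ultimately show ?thesis using True by simp
    next
      case False
      hence "(?p x - ?q x)\<^sup>2 / (1 + norm x) \<le> (?p x - ?q x)\<^sup>2 / (1 + R)" using R by (intro divide_left_mono) auto
      also have "\<dots> \<le> ?rhs x" using False by simp
      finally show ?thesis .
    qed
    have i1: "integrable lborel (\<lambda>x. (?p x - ?P x)\<^sup>2)" "integrable lborel (\<lambda>x. (?q x - ?Q x)\<^sup>2)"
      "integrable lborel (\<lambda>x. (?p x - ?q x)\<^sup>2)"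
      using L2_integrable[OF aL(1)] L2_integrable[OF aL(2)] L2_integrable[OF dL] by simp_all
    have i2: "integrable lborel (indicator ?D :: 'a \<Rightarrow> real)"
      using emeasure_lborel_cball_finite[of "0::'a" R] by (intro integrable_real_indicator) auto
    have "weighted_sq (\<lambda>x. ?p x - ?q x) \<le> (\<integral>x. ?rhs x \<partial>lborel)"
      unfolding weighted_sq_def
      by (rule integral_mono[OF weighted_sq_integrable[OF dL] _ pt])
        (intro Bochner_Integration.integrable_add integrable_mult_right i1 i2)
    also have "\<dots> = 3 * nsq (\<lambda>x. ?p x - ?P x) + 3 * nsq (\<lambda>x. ?q x - ?Q x) + 3 * \<tau>\<^sup>2 * m + 1 / (1 + R) * nsq (\<lambda>x. ?p x - ?q x)"
      using i1 i2 unfolding nsq_def m_def by simp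
    also have "\<dots> \<le> 3 * (\<delta>\<^sup>2 * C) + 3 * (\<delta>\<^sup>2 * C) + 3 * \<tau>\<^sup>2 * m + 1 / (1 + R) * (4 * C)"
    proof (intro add_mono mult_left_mono order_refl)
      have "\<delta>\<^sup>2 * nsq (H n) \<le> \<delta>\<^sup>2 * C" for n using C by (intro mult_left_mono) auto
      thus "nsq (\<lambda>x. ?p x - ?P x) \<le> \<delta>\<^sup>2 * C" "nsq (\<lambda>x. ?q x - ?Q x) \<le> \<delta>\<^sup>2 * C"
        using ball_average_approx(2)[OF \<delta>(1) s] order_trans by blast+
      show "nsq (\<lambda>x. ?p x - ?q x) \<le> 4 * C"
        using nsq_diff_le[OF v v, of "k i" "k j"] C1[of "k i"] C1[of "k j"] by linarith
    qed (use R in auto)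
    also have "\<dots> = 6 * (\<delta>\<^sup>2 * C) + 3 * (\<tau>\<^sup>2 * m) + 4 * C / (1 + R)" by simp
    also have "\<dots> \<le> e / 3 + e / 3 + e / 3" by (intro add_mono \<delta>C \<tau>m R(2))
    also have "\<dots> = e" by simp
    finally show ?thesis .
  qed
  hence "\<exists>N. \<forall>i\<ge>N. \<forall>j\<ge>N. weighted_sq (\<lambda>x. v (k i) x - v (k j) x) \<le> e" by blast
  with k show ?thesis by blast
qed

text \<open>One diagonal sequence serves all precisions 1 / (k + 1). Completeness gives a limit in
  the weighted space only; Fatou's lemma along an almost everywhere convergent subsequence shows
  with the uniform bound C that it is square integrable.\<close>

lemma sobolev_local_compactness:
  fixes v :: "nat \<Rightarrow> 'a::euclidean_space \<Rightarrow> real"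
  assumes s: "\<And>n. sobolev (v n) (H n)" and C1: "\<And>n. nsq (v n) \<le> C" and C: "\<And>n. nsq (H n) \<le> C"
  obtains r u where "strict_mono (r :: nat \<Rightarrow> nat)" "L2 u" "(\<lambda>n. weighted_sq (\<lambda>x. v (r n) x - u x)) \<longlonglongrightarrow> 0"
proof -
  have C0: "C \<ge> 0" using C[of 0] nsq_nonneg[of "H 0"] by linarith
  note v = sobolev_L2(1)[OF s]
  note [measurable] = L2_measurable[OF v]
  define P where "P k r \<longleftrightarrow> (\<exists>N. \<forall>m\<ge>N. \<forall>n\<ge>N. weighted_sq (\<lambda>x. v (r m) x - v (r n) x) \<le> 1 / real (Suc k))" for k and r :: "nat \<Rightarrow> nat"
  interpret subseqs P
  proof
    fix n and q :: "nat \<Rightarrow> nat"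
    show "\<exists>r'. strict_mono r' \<and> P n (q \<circ> r')"
      using sobolev_weighted_sq_subsequence[of "\<lambda>n. v (q n)" "\<lambda>n. H (q n)" C "1 / real (Suc n)"] s C1 C
      by (simp add: P_def)
  qed
  \<comment> \<open>The diagonal sequence is a subsequence of the k-th one from some index on, so
    the property must survive passing to subsequences.\<close>
  have stable: "P k (t \<circ> r)" if r: "strict_mono r" and "P k t" for r t k
  proof -
    obtain N where N: "\<forall>m\<ge>N. \<forall>n\<ge>N. weighted_sq (\<lambda>x. v (t m) x - v (t n) x) \<le> 1 / real (Suc k)"
      using \<open>P k t\<close> by (auto simp: P_def)
    have "weighted_sq (\<lambda>x. v ((t \<circ> r) m) x - v ((t \<circ> r) n) x) \<le> 1 / real (Suc k)" if "m \<ge> N" "n \<ge> N" for m n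
    proof -
      have "N \<le> r m" "N \<le> r n" using that seq_suble[OF r] order_trans by blast+
      thus ?thesis using N by (simp only: o_apply)
    qed
    thus ?thesis unfolding P_def by blast
  qed
  \<comment> \<open>Dividing by the root of \<open>1 + norm x\<close> maps the weighted space
    isometrically into L2, where completeness is known.\<close>
  define f where "f n x = v (diagseq n) x / sqrt (1 + norm x)" for n x
  have f_sq: "(norm (a / sqrt (1 + norm x)))\<^sup>2 = a\<^sup>2 / (1 + norm x)" for a :: real and x :: 'a
    by (simp add: power_divide)
  have fL: "L2 (f n)" for n
  proof -
    have "f n \<in> borel_measurable borel" unfolding f_def[abs_def] by measurable
    thus ?thesis using weighted_sq_integrable[OF v[of "diagseq n"]] unfolding f_def[abs_def] L2_def f_sq by blast
  qed
  have fd: "nsq (\<lambda>x. f m x - f n x) = weighted_sq (\<lambda>x. v (diagseq m) x - v (diagseq n) x)" for m n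
    unfolding f_def nsq_def weighted_sq_def diff_divide_distrib[symmetric] f_sq ..
  have "\<exists>N. \<forall>m\<ge>N. \<forall>n\<ge>N. nsq (\<lambda>x. f m x - f n x) \<le> e" if e: "e > 0" for e
  proof -
    obtain k where k: "1 / real (Suc k) < e" using e reals_Archimedean[of e] by (auto simp: inverse_eq_divide)
    have "P k (diagseq \<circ> ((+) (Suc k)))" by (rule diagseq_holds[OF stable])
    then obtain N where N: "\<And>m n. m \<ge> N \<Longrightarrow> n \<ge> N \<Longrightarrow> weighted_sq (\<lambda>x. v (diagseq (Suc k + m)) x - v (diagseq (Suc k + n)) x) \<le> 1 / real (Suc k)"
      by (auto simp: P_def)
    have "nsq (\<lambda>x. f m x - f n x) \<le> e" if "m \<ge> Suc k + N" "n \<ge> Suc k + N" for m n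
    proof -
      have "N \<le> m - Suc k" "N \<le> n - Suc k" "Suc k + (m - Suc k) = m" "Suc k + (n - Suc k) = n" using that by simp_all
      hence "weighted_sq (\<lambda>x. v (diagseq m) x - v (diagseq n) x) \<le> 1 / real (Suc k)"
        using N[of "m - Suc k" "n - Suc k"] by (simp only:)
      thus ?thesis unfolding fd using k by linarith
    qed
    thus ?thesis by blast
  qed
  then obtain g q where g: "L2 g" "(\<lambda>n. nsq (\<lambda>x. f n x - g x)) \<longlonglongrightarrow> 0"
    and q: "strict_mono (q :: nat \<Rightarrow> nat)" "AE x in lborel. (\<lambda>n. f (q n) x) \<longlonglongrightarrow> g x"
    using L2_complete[of f] fL by blast
  note [measurable] = L2_measurable[OF g(1)]
  define u where "u x = g x * sqrt (1 + norm x)" for x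
  have [measurable]: "u \<in> borel_measurable borel" unfolding u_def by measurable
  have gu: "g x = u x / sqrt (1 + norm x)" for x by (simp add: u_def)
  have "nsq (\<lambda>x. f n x - g x) = weighted_sq (\<lambda>x. v (diagseq n) x - u x)" for n
    unfolding f_def nsq_def weighted_sq_def gu diff_divide_distrib[symmetric] f_sq ..
  with g(2) have w: "(\<lambda>n. weighted_sq (\<lambda>x. v (diagseq n) x - u x)) \<longlonglongrightarrow> 0" by simp
  have "L2 u"
  proof (rule nn_integral_imp_L2(1))
    have "(\<integral>\<^sup>+x. ennreal ((norm (u x))\<^sup>2) \<partial>lborel) = (\<integral>\<^sup>+x. liminf (\<lambda>n. ennreal ((norm (v (diagseq (q n)) x))\<^sup>2)) \<partial>lborel)"
    proof (rule nn_integral_cong_AE)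
      show "AE x in lborel. ennreal ((norm (u x))\<^sup>2) = liminf (\<lambda>n. ennreal ((norm (v (diagseq (q n)) x))\<^sup>2))"
        using q(2)
      proof eventually_elim
        fix x assume "(\<lambda>n. f (q n) x) \<longlonglongrightarrow> g x"
        hence "(\<lambda>n. f (q n) x * sqrt (1 + norm x)) \<longlonglongrightarrow> u x" unfolding u_def by (intro tendsto_intros)
        hence "(\<lambda>n. v (diagseq (q n)) x) \<longlonglongrightarrow> u x" by (simp add: f_def)
        hence "(\<lambda>n. ennreal ((norm (v (diagseq (q n)) x))\<^sup>2)) \<longlonglongrightarrow> ennreal ((norm (u x))\<^sup>2)"
          by (intro tendsto_intros tendsto_ennrealI)
        thus "ennreal ((norm (u x))\<^sup>2) = liminf (\<lambda>n. ennreal ((norm (v (diagseq (q n)) x))\<^sup>2))"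
          by (intro lim_imp_Liminf[symmetric]) auto
      qed
    qed
    also have "\<dots> \<le> liminf (\<lambda>n. \<integral>\<^sup>+x. ennreal ((norm (v (diagseq (q n)) x))\<^sup>2) \<partial>lborel)"
      by (rule nn_integral_liminf) measurable
    also have "\<dots> = liminf (\<lambda>n. ennreal (nsq (v (diagseq (q n)))))"
      by (simp only: nn_integral_nsq[OF v])
    also have "\<dots> \<le> ennreal C"
      by (rule Liminf_le) (auto intro!: always_eventually ennreal_leI C1)
    finally show "(\<integral>\<^sup>+x. ennreal ((norm (u x))\<^sup>2) \<partial>lborel) \<le> ennreal C" .
  qed (use C0 in auto)
  with w show ?thesis using that[of diagseq u] subseq_diagseq by blast
qed

section \<open>The interaction energy\<close>

definition interaction :: "('a::euclidean_space \<Rightarrow> real) \<Rightarrow> ('a \<Rightarrow> real) \<Rightarrow> real" where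
  "interaction W u = (\<integral>(x, y). (u x)\<^sup>2 * W (x - y) * (u y)\<^sup>2 \<partial>(lborel \<Otimes>\<^sub>M lborel))"

lemma interaction_measurable:
  fixes W u :: "'a::euclidean_space \<Rightarrow> real"
  assumes [measurable]: "W \<in> borel_measurable borel" "u \<in> borel_measurable borel"
  shows "(\<lambda>(x, y). (u x)\<^sup>2 * W (x - y) * (u y)\<^sup>2) \<in> borel_measurable (lborel \<Otimes>\<^sub>M lborel)"
  by measurable

lemma interaction_integrable:
  fixes W u :: "'a::euclidean_space \<Rightarrow> real"
  assumes [measurable]: "W \<in> borel_measurable borel" "u \<in> borel_measurable borel"
    and Z: "abs_interaction W u \<le> ennreal c" and c: "c \<ge> 0"
  shows "integrable (lborel \<Otimes>\<^sub>M lborel) (\<lambda>(x, y). (u x)\<^sup>2 * W (x - y) * (u y)\<^sup>2)" "\<bar>interaction W u\<bar> \<le> c"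
proof -
  let ?f = "\<lambda>(x, y). (u x)\<^sup>2 * W (x - y) * (u y)\<^sup>2"
  have "(\<integral>\<^sup>+p. ennreal (norm (?f p)) \<partial>(lborel \<Otimes>\<^sub>M lborel)) = (\<integral>\<^sup>+x. (\<integral>\<^sup>+y. ennreal (norm (?f (x, y))) \<partial>lborel) \<partial>lborel)"
    by (rule lborel.nn_integral_fst[symmetric]) measurable
  also have "\<dots> = abs_interaction W u" unfolding abs_interaction_def by (simp add: abs_mult)
  finally have e: "(\<integral>\<^sup>+p. ennreal (norm (?f p)) \<partial>(lborel \<Otimes>\<^sub>M lborel)) \<le> ennreal c" using Z by simp
  show i: "integrable (lborel \<Otimes>\<^sub>M lborel) ?f"
  proof (rule integrableI_bounded)
    show "?f \<in> borel_measurable (lborel \<Otimes>\<^sub>M lborel)" by (rule interaction_measurable) fact+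
    show "(\<integral>\<^sup>+p. ennreal (norm (?f p)) \<partial>(lborel \<Otimes>\<^sub>M lborel)) < \<infinity>" using e by (auto intro: le_less_trans)
  qed
  have "ennreal (norm (interaction W u)) \<le> ennreal c"
    unfolding interaction_def using integral_norm_bound_ennreal[OF i] e by (rule order_trans)
  thus "\<bar>interaction W u\<bar> \<le> c" using c by simp
qed

lemma truncation_diff_bound: "\<bar>truncation n W (x - y)\<bar> \<le> real n * indicator (cball x (real n)) y"
  by (auto simp: truncation_def indicator_def dist_norm)

text \<open>A potential of height and range n pairs each x only with the mass in the ball of radius
  n around x. Read contrapositively, a large interaction locates a ball that carries mass.\<close>

lemma abs_interaction_truncation_le:
  fixes W u :: "'a::euclidean_space \<Rightarrow> real"
  assumes [measurable]: "W \<in> borel_measurable borel" and u: "L2 u"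
    and loc: "\<And>y. (\<integral>\<^sup>+x. ennreal ((u x)\<^sup>2) * indicator (cball y (real n)) x \<partial>lborel) \<le> ennreal e" and e: "e \<ge> 0"
  shows "abs_interaction (truncation n W) u \<le> ennreal (real n * nsq u * e)"
proof -
  note [measurable] = L2_measurable[OF u]
  have [measurable]: "cball z r \<in> sets (borel :: 'a measure)" for z r by simp
  have "abs_interaction (truncation n W) u \<le> (\<integral>\<^sup>+x. (\<integral>\<^sup>+y. ennreal (real n * (u x)\<^sup>2) * (ennreal ((u y)\<^sup>2) * indicator (cball x (real n)) y) \<partial>lborel) \<partial>lborel)"
    unfolding abs_interaction_def
  proof (intro nn_integral_mono)
    fix x y
    have "(u x)\<^sup>2 * \<bar>truncation n W (x - y)\<bar> * (u y)\<^sup>2 \<le> (u x)\<^sup>2 * (real n * indicator (cball x (real n)) y) * (u y)\<^sup>2"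
      by (intro mult_right_mono mult_left_mono truncation_diff_bound) auto
    also have "\<dots> = (real n * (u x)\<^sup>2) * ((u y)\<^sup>2 * indicator (cball x (real n)) y)" by simp
    finally have "ennreal ((u x)\<^sup>2 * \<bar>truncation n W (x - y)\<bar> * (u y)\<^sup>2) \<le> ennreal ((real n * (u x)\<^sup>2) * ((u y)\<^sup>2 * indicator (cball x (real n)) y))"
      by (rule ennreal_leI)
    also have "\<dots> = ennreal (real n * (u x)\<^sup>2) * (ennreal ((u y)\<^sup>2) * indicator (cball x (real n)) y)"
      by (auto simp: indicator_def ennreal_mult[symmetric])
    finally show "ennreal ((u x)\<^sup>2 * \<bar>truncation n W (x - y)\<bar> * (u y)\<^sup>2) \<le> ennreal (real n * (u x)\<^sup>2) * (ennreal ((u y)\<^sup>2) * indicator (cball x (real n)) y)" .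
  qed
  also have "\<dots> \<le> (\<integral>\<^sup>+x. ennreal (real n * (u x)\<^sup>2) * ennreal e \<partial>lborel)"
  proof (rule nn_integral_mono)
    fix x
    have "(\<integral>\<^sup>+y. ennreal (real n * (u x)\<^sup>2) * (ennreal ((u y)\<^sup>2) * indicator (cball x (real n)) y) \<partial>lborel)
        = ennreal (real n * (u x)\<^sup>2) * (\<integral>\<^sup>+y. ennreal ((u y)\<^sup>2) * indicator (cball x (real n)) y \<partial>lborel)"
      by (rule nn_integral_cmult) measurable
    also have "\<dots> \<le> ennreal (real n * (u x)\<^sup>2) * ennreal e" by (intro mult_left_mono loc) simp
    finally show "(\<integral>\<^sup>+y. ennreal (real n * (u x)\<^sup>2) * (ennreal ((u y)\<^sup>2) * indicator (cball x (real n)) y) \<partial>lborel)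
       \<le> ennreal (real n * (u x)\<^sup>2) * ennreal e" .
  qed
  also have "\<dots> = (\<integral>\<^sup>+x. ennreal (real n * (u x)\<^sup>2) \<partial>lborel) * ennreal e" by (rule nn_integral_multc) simp
  also have "(\<integral>\<^sup>+x. ennreal (real n * (u x)\<^sup>2) \<partial>lborel) = ennreal (real n * nsq u)"
    using nn_integral_nsq[OF u] by (simp add: ennreal_mult nn_integral_cmult)
  also have "ennreal (real n * nsq u) * ennreal e = ennreal (real n * nsq u * e)"
    using e by (simp add: ennreal_mult)
  finally show ?thesis .
qed

lemma abs_interaction_truncation_le_nsq:
  fixes W u :: "'a::euclidean_space \<Rightarrow> real"
  assumes W: "W \<in> borel_measurable borel" and u: "L2 u"
  shows "abs_interaction (truncation n W) u \<le> ennreal (real n * nsq u * nsq u)"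
proof (rule abs_interaction_truncation_le[OF W u])
  fix y
  have "(\<integral>\<^sup>+x. ennreal ((u x)\<^sup>2) * indicator (cball y (real n)) x \<partial>lborel) \<le> (\<integral>\<^sup>+x. ennreal ((norm (u x))\<^sup>2) \<partial>lborel)"
    by (intro nn_integral_mono) (auto simp: indicator_def)
  also have "\<dots> = ennreal (nsq u)" by (rule nn_integral_nsq[OF u])
  finally show "(\<integral>\<^sup>+x. ennreal ((u x)\<^sup>2) * indicator (cball y (real n)) x \<partial>lborel) \<le> ennreal (nsq u)" .
qed simp

lemma interaction_truncation_split:
  fixes W u :: "'a::euclidean_space \<Rightarrow> real"
  assumes W: "W \<in> borel_measurable borel" and u: "L2 u"
    and Z: "abs_interaction (\<lambda>x. W x - truncation n W x) u \<le> ennreal c" "c \<ge> 0"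
  shows "interaction W u = interaction (truncation n W) u + interaction (\<lambda>x. W x - truncation n W x) u"
    and "integrable (lborel \<Otimes>\<^sub>M lborel) (\<lambda>(x, y). (u x)\<^sup>2 * W (x - y) * (u y)\<^sup>2)"
proof -
  note [measurable] = W L2_measurable[OF u]
  have i1: "integrable (lborel \<Otimes>\<^sub>M lborel) (\<lambda>(x, y). (u x)\<^sup>2 * truncation n W (x - y) * (u y)\<^sup>2)"
    by (rule interaction_integrable(1)[OF _ _ abs_interaction_truncation_le_nsq[OF W u]]) auto
  have i2: "integrable (lborel \<Otimes>\<^sub>M lborel) (\<lambda>(x, y). (u x)\<^sup>2 * (W (x - y) - truncation n W (x - y)) * (u y)\<^sup>2)"
    by (rule interaction_integrable(1)[OF _ _ Z]) auto
  have eq: "(\<lambda>(x, y). (u x)\<^sup>2 * W (x - y) * (u y)\<^sup>2) = (\<lambda>p. (case p of (x, y) \<Rightarrow> (u x)\<^sup>2 * truncation n W (x - y) * (u y)\<^sup>2)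
     + (case p of (x, y) \<Rightarrow> (u x)\<^sup>2 * (W (x - y) - truncation n W (x - y)) * (u y)\<^sup>2))"
    by (auto simp: algebra_simps)
  show "integrable (lborel \<Otimes>\<^sub>M lborel) (\<lambda>(x, y). (u x)\<^sup>2 * W (x - y) * (u y)\<^sup>2)"
    unfolding eq using i1 i2 by (rule Bochner_Integration.integrable_add)
  show "interaction W u = interaction (truncation n W) u + interaction (\<lambda>x. W x - truncation n W x) u"
    unfolding interaction_def eq using i1 i2 by (rule Bochner_Integration.integral_add)
qed

lemma interaction_cmult: "interaction W (\<lambda>x. c * u x) = c^4 * interaction W u"
proof -
  have "interaction W (\<lambda>x. c * u x) = (\<integral>p. c^4 * (case p of (x, y) \<Rightarrow> (u x)\<^sup>2 * W (x - y) * (u y)\<^sup>2) \<partial>(lborel \<Otimes>\<^sub>M lborel))"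
    unfolding interaction_def
    by (intro Bochner_Integration.integral_cong refl) (auto simp: power_mult_distrib mult_ac simp flip: power_add)
  thus ?thesis unfolding interaction_def by simp
qed

lemma interaction_translate:
  fixes W u :: "'a::euclidean_space \<Rightarrow> real"
  assumes [measurable]: "W \<in> borel_measurable borel" "u \<in> borel_measurable borel"
  shows "interaction W (\<lambda>x. u (x + z)) = interaction W u"
proof -
  let ?f = "\<lambda>p. case p of (x, y) \<Rightarrow> (u x)\<^sup>2 * W (x - y) * (u y)\<^sup>2"
  have "?f \<in> borel_measurable (lborel \<Otimes>\<^sub>M lborel)" by (rule interaction_measurable) fact+
  hence m: "?f \<in> borel_measurable borel" by (simp add: lborel_prod)
  have "interaction W (\<lambda>x. u (x + z)) = (\<integral>p. ?f (p + (z, z)) \<partial>lborel)"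
    unfolding interaction_def lborel_prod by (intro Bochner_Integration.integral_cong refl) auto
  also have "\<dots> = (\<integral>p. ?f p \<partial>lborel)" by (rule integral_translate[OF m])
  finally show ?thesis unfolding interaction_def lborel_prod .
qed

section \<open>Splitting of the interaction\<close>

lemma integral_product:
  fixes f g :: "'a::euclidean_space \<Rightarrow> real"
  assumes f: "integrable lborel f" and g: "integrable lborel g"
  shows "integrable (lborel \<Otimes>\<^sub>M lborel) (\<lambda>(x, y). f x * g y)"
    and "(\<integral>(x, y). f x * g y \<partial>(lborel \<Otimes>\<^sub>M lborel)) = (\<integral>x. f x \<partial>lborel) * (\<integral>y. g y \<partial>lborel)"
proof -
  have [measurable]: "f \<in> borel_measurable borel" "g \<in> borel_measurable borel" using f g by auto
  show i: "integrable (lborel \<Otimes>\<^sub>M lborel) (\<lambda>(x, y). f x * g y)"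
  proof (rule lborel_pair.Fubini_integrable)
    show "integrable lborel (\<lambda>x. \<integral>y. norm (case (x, y) of (x, y) \<Rightarrow> f x * g y) \<partial>lborel)"
      using f by (simp add: abs_mult)
  qed (use g in auto)
  show "(\<integral>(x, y). f x * g y \<partial>(lborel \<Otimes>\<^sub>M lborel)) = (\<integral>x. f x \<partial>lborel) * (\<integral>y. g y \<partial>lborel)"
    using lborel_pair.integral_fst'[OF i] by simp
qed

text \<open>At fixed x, the weighted norm forces the mass of \<open>v n\<close> in the ball around x
  to tend to 0, and \<open>C * (u x)\<^sup>2\<close> dominates.\<close>

lemma local_interaction_tendsto_0:
  fixes u :: "'a::euclidean_space \<Rightarrow> real"
  assumes u: "L2 u" and v: "\<And>n. L2 (v n)" "\<And>n. nsq (v n) \<le> C" and w: "(\<lambda>n. weighted_sq (v n)) \<longlonglongrightarrow> 0" and M: "M \<ge> 0"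
  shows "integrable (lborel \<Otimes>\<^sub>M lborel) (\<lambda>(x, y). (u x)\<^sup>2 * (v n y)\<^sup>2 * indicator (cball x M) y)"
    and "(\<lambda>n. \<integral>(x, y). (u x)\<^sup>2 * (v n y)\<^sup>2 * indicator (cball x M) y \<partial>(lborel \<Otimes>\<^sub>M lborel)) \<longlonglongrightarrow> 0"
proof -
  note [measurable] = L2_measurable[OF u] L2_measurable[OF v(1)]
  have ui: "integrable lborel (\<lambda>x. (u x)\<^sup>2)" using L2_integrable[OF u] by simp
  have vi: "integrable lborel (\<lambda>x. (v n x)\<^sup>2)" for n using L2_integrable[OF v(1)] by simp
  have ind: "(indicator (cball x M) y :: real) = (if dist x y \<le> M then 1 else 0)" for x y :: 'a by (simp add: indicator_def)
  have int: "integrable (lborel \<Otimes>\<^sub>M lborel) (\<lambda>(x, y). (u x)\<^sup>2 * (v n y)\<^sup>2 * indicator (cball x M) y)" for n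
    unfolding ind
  proof (rule Bochner_Integration.integrable_bound[OF integral_product(1)[OF ui vi[of n]]])
    show "(\<lambda>(x, y). (u x)\<^sup>2 * (v n y)\<^sup>2 * (if dist x y \<le> M then 1 else 0)) \<in> borel_measurable (lborel \<Otimes>\<^sub>M lborel)"
      by measurable
  qed auto
  show "integrable (lborel \<Otimes>\<^sub>M lborel) (\<lambda>(x, y). (u x)\<^sup>2 * (v n y)\<^sup>2 * indicator (cball x M) y)" by (rule int)
  define h where "h n x = (\<integral>y. (v n y)\<^sup>2 * indicator (cball x M) y \<partial>lborel)" for n x
  have hm [measurable]: "h n \<in> borel_measurable borel" for n
    unfolding h_def ind by measurable
  have h0: "0 \<le> h n x" for n x unfolding h_def by simp
  have hC: "h n x \<le> C" for n x
  proof -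
    have "h n x \<le> (\<integral>y. (v n y)\<^sup>2 \<partial>lborel)"
      unfolding h_def by (rule integral_mono[OF integrable_real_mult_indicator[OF _ vi] vi]) (auto simp: indicator_def)
    thus ?thesis using v(2)[of n] by (simp add: nsq_def)
  qed
  have hw: "h n x \<le> (1 + (norm x + M)) * weighted_sq (v n)" for n x
  proof -
    have "h n x \<le> (\<integral>y. (1 + (norm x + M)) * ((v n y)\<^sup>2 / (1 + norm y)) \<partial>lborel)"
      unfolding h_def
    proof (rule integral_mono[OF integrable_real_mult_indicator[OF _ vi] integrable_mult_right[OF weighted_sq_integrable[OF v(1)]]])
      fix y
      show "(v n y)\<^sup>2 * indicator (cball x M) y \<le> (1 + (norm x + M)) * ((v n y)\<^sup>2 / (1 + norm y))"
      proof (cases "y \<in> cball x M")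
        case True
        hence "norm y \<le> norm x + M" using norm_triangle_ineq2[of y x] by (simp add: dist_norm norm_minus_commute)
        hence "1 * (v n y)\<^sup>2 \<le> ((1 + (norm x + M)) / (1 + norm y)) * (v n y)\<^sup>2"
          by (intro mult_right_mono) (auto simp: pos_le_divide_eq)
        thus ?thesis using True by simp
      next
        case False
        thus ?thesis using M by simp
      qed
    qed simp
    thus ?thesis unfolding weighted_sq_def integral_mult_right_zero .
  qed
  have eq: "(\<integral>(x, y). (u x)\<^sup>2 * (v n y)\<^sup>2 * indicator (cball x M) y \<partial>(lborel \<Otimes>\<^sub>M lborel)) = (\<integral>x. (u x)\<^sup>2 * h n x \<partial>lborel)" for n
    using lborel_pair.integral_fst'[OF int[of n]] by (simp add: h_def mult.assoc)
  have "(\<lambda>n. \<integral>x. (u x)\<^sup>2 * h n x \<partial>lborel) \<longlonglongrightarrow> (\<integral>x. (u x)\<^sup>2 * 0 \<partial>lborel)"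
  proof (rule integral_dominated_convergence)
    show "integrable lborel (\<lambda>x. C * (u x)\<^sup>2)" using ui by (rule integrable_mult_right)
    show "AE x in lborel. (\<lambda>n. (u x)\<^sup>2 * h n x) \<longlonglongrightarrow> (u x)\<^sup>2 * 0"
    proof (rule AE_I2)
      fix x
      have "(\<lambda>n. h n x) \<longlonglongrightarrow> 0"
      proof (rule Lim_null_comparison)
        show "\<forall>\<^sub>F n in sequentially. norm (h n x) \<le> (1 + (norm x + M)) * weighted_sq (v n)"
          using hw h0 by simp
        show "(\<lambda>n. (1 + (norm x + M)) * weighted_sq (v n)) \<longlonglongrightarrow> 0"
          using tendsto_mult[OF tendsto_const w] by simp
      qed
      thus "(\<lambda>n. (u x)\<^sup>2 * h n x) \<longlonglongrightarrow> (u x)\<^sup>2 * 0" by (intro tendsto_intros)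
    qed
    show "AE x in lborel. norm ((u x)\<^sup>2 * h n x) \<le> C * (u x)\<^sup>2" for n
    proof (rule AE_I2)
      fix x
      show "norm ((u x)\<^sup>2 * h n x) \<le> C * (u x)\<^sup>2"
        using mult_left_mono[OF hC[of n x], of "(u x)\<^sup>2"] h0[of n x] by (simp add: abs_mult mult.commute)
    qed
  qed measurable
  thus "(\<lambda>n. \<integral>(x, y). (u x)\<^sup>2 * (v n y)\<^sup>2 * indicator (cball x M) y \<partial>(lborel \<Otimes>\<^sub>M lborel)) \<longlonglongrightarrow> 0"
    unfolding eq by simp
qed

text \<open>Here p and q stand for the values of the two functions at x, and the primed letters for
  those at y. Each term on the right is mixed: a square of one function at one point times a square
  of the other at the other point, or a product of both functions at the same point.\<close>

lemma square_sum_split_bound: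
  fixes p q p' q' :: real
  shows "\<bar>(p + q)\<^sup>2 * (p' + q')\<^sup>2 - p\<^sup>2 * p'\<^sup>2 - q\<^sup>2 * q'\<^sup>2\<bar>
    \<le> p\<^sup>2 * q'\<^sup>2 + q\<^sup>2 * p'\<^sup>2 + 2 * \<bar>p * q\<bar> * (p' + q')\<^sup>2 + 2 * ((p\<^sup>2 + q\<^sup>2) * \<bar>p' * q'\<bar>)"
proof -
  let ?a = "p\<^sup>2 * q'\<^sup>2" and ?b = "q\<^sup>2 * p'\<^sup>2" and ?c = "2 * (p * q) * (p' + q')\<^sup>2" and ?d = "2 * ((p\<^sup>2 + q\<^sup>2) * (p' * q'))"
  have e: "(p + q)\<^sup>2 * (p' + q')\<^sup>2 - p\<^sup>2 * p'\<^sup>2 - q\<^sup>2 * q'\<^sup>2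
     = p\<^sup>2 * q'\<^sup>2 + q\<^sup>2 * p'\<^sup>2 + 2 * (p * q) * (p' + q')\<^sup>2 + 2 * ((p\<^sup>2 + q\<^sup>2) * (p' * q'))"
    by (simp add: power2_eq_square algebra_simps)
  have "\<bar>?a + ?b + ?c + ?d\<bar> \<le> \<bar>?a\<bar> + \<bar>?b\<bar> + \<bar>?c\<bar> + \<bar>?d\<bar>" by linarith
  thus ?thesis unfolding e by (simp add: abs_mult)
qed

text \<open>A Brezis--Lieb splitting. Terms with the product of u and v at one point vanish by weak
  convergence (\<open>J\<close>). Terms with the square of u at one point and the square of v at the
  other vanish because the truncated potential has finite range (\<open>T\<close>).\<close>

lemma interaction_truncation_splitting:
  fixes W u :: "'a::euclidean_space \<Rightarrow> real"
  assumes W: "W \<in> borel_measurable borel" and u: "L2 u"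
    and v: "\<And>n. L2 (v n)" "\<And>n. nsq (v n) \<le> C" and w: "(\<lambda>n. weighted_sq (v n)) \<longlonglongrightarrow> 0"
  shows "(\<lambda>n. interaction (truncation k W) (\<lambda>x. u x + v n x) - interaction (truncation k W) u - interaction (truncation k W) (v n)) \<longlonglongrightarrow> 0"
proof -
  note [measurable] = W L2_measurable[OF u] L2_measurable[OF v(1)]
  let ?V = "truncation k W" and ?P = "lborel \<Otimes>\<^sub>M (lborel :: 'a measure)"
  let ?I = "\<lambda>f p. case p of (x, y) \<Rightarrow> (f x)\<^sup>2 * ?V (x - y) * (f y)\<^sup>2"
  have i: "integrable ?P (?I f)" if "L2 f" for f
    by (rule interaction_integrable(1)[OF _ _ abs_interaction_truncation_le_nsq[OF W that]]) (use L2_measurable[OF that] in auto)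
  define J where "J n = (\<integral>x. \<bar>u x * v n x\<bar> \<partial>lborel)" for n
  define T where "T n = (\<integral>(x, y). (u x)\<^sup>2 * (v n y)\<^sup>2 * indicator (cball x (real k)) y \<partial>?P)" for n
  have J0: "J \<longlonglongrightarrow> 0" unfolding J_def by (rule integral_abs_mult_tendsto_0[OF u v w])
  have Ji: "integrable lborel (\<lambda>x. \<bar>u x * v n x\<bar>)" for n by (intro integrable_abs L2_mult_integrable u v)
  have Jn: "J n \<ge> 0" for n unfolding J_def by simp
  have T0: "T \<longlonglongrightarrow> 0" unfolding T_def by (rule local_interaction_tendsto_0(2)[OF u v w]) simp
  define c where "c = 2 * nsq u + 2 * C"
  have bound: "norm (interaction ?V (\<lambda>x. u x + v n x) - interaction ?V u - interaction ?V (v n)) \<le> real k * (2 * T n) + real k * (J n * (2 * c + 2 * (nsq u + C)))" for n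
  proof -
    have sL: "L2 (\<lambda>x. u x + v n x)" by (intro L2_add u v)
    let ?t1 = "\<lambda>p. case p of (x, y) \<Rightarrow> (u x)\<^sup>2 * (v n y)\<^sup>2 * indicator (cball x (real k)) y"
    let ?t2 = "\<lambda>p. case p of (x, y) \<Rightarrow> (u y)\<^sup>2 * (v n x)\<^sup>2 * indicator (cball y (real k)) x"
    let ?t3 = "\<lambda>p. case p of (x, y) \<Rightarrow> \<bar>u x * v n x\<bar> * (u y + v n y)\<^sup>2"
    let ?t4 = "\<lambda>p. case p of (x, y) \<Rightarrow> ((u x)\<^sup>2 + (v n x)\<^sup>2) * \<bar>u y * v n y\<bar>"
    let ?b = "\<lambda>p. real k * (?t1 p + ?t2 p) + real k * (2 * ?t3 p + 2 * ?t4 p)"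
    have si: "integrable lborel (\<lambda>x. (u x + v n x)\<^sup>2)" "integrable lborel (\<lambda>x. (u x)\<^sup>2)" "integrable lborel (\<lambda>x. (v n x)\<^sup>2)"
      using L2_integrable[OF sL] L2_integrable[OF u] L2_integrable[OF v(1)[of n]] by simp_all
    have i1: "integrable ?P ?t1" by (rule local_interaction_tendsto_0(1)[OF u v w]) simp
    have i2: "integrable ?P ?t2"
      using lborel_pair.integrable_product_swap[OF i1] by (simp add: case_prod_unfold)
    have e2: "integral\<^sup>L ?P ?t2 = T n"
      using lborel_pair.integral_product_swap[of ?t1] i1 unfolding T_def by (simp add: case_prod_unfold)
    have i3: "integrable ?P ?t3" and e3: "integral\<^sup>L ?P ?t3 = J n * nsq (\<lambda>x. u x + v n x)"
      using integral_product[OF Ji[of n] si(1)] by (simp_all add: J_def nsq_def)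
    have i4: "integrable ?P ?t4" and e4: "integral\<^sup>L ?P ?t4 = (nsq u + nsq (v n)) * J n"
      using integral_product[OF Bochner_Integration.integrable_add[OF si(2,3)] Ji[of n]] si by (simp_all add: J_def nsq_def)
    have ib: "integrable ?P ?b"
      using i1 i2 i3 i4 by (intro Bochner_Integration.integrable_add integrable_mult_right)
    have eq: "interaction ?V (\<lambda>x. u x + v n x) - interaction ?V u - interaction ?V (v n)
        = (\<integral>p. ?I (\<lambda>x. u x + v n x) p - ?I u p - ?I (v n) p \<partial>?P)"
      unfolding interaction_def
      by (simp only: Bochner_Integration.integral_diff Bochner_Integration.integrable_diff i[OF sL] i[OF u] i[OF v(1)[of n]])
    have "norm (\<integral>p. ?I (\<lambda>x. u x + v n x) p - ?I u p - ?I (v n) p \<partial>?P) \<le> (\<integral>p. norm (?I (\<lambda>x. u x + v n x) p - ?I u p - ?I (v n) p) \<partial>?P)"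
      by (rule integral_norm_bound)
    also have "\<dots> \<le> (\<integral>p. ?b p \<partial>?P)"
    proof (rule integral_mono[OF integrable_norm ib])
      show "integrable ?P (\<lambda>p. ?I (\<lambda>x. u x + v n x) p - ?I u p - ?I (v n) p)"
        using i[OF sL] i[OF u] i[OF v(1)[of n]] by (intro Bochner_Integration.integrable_diff)
      fix p :: "'a \<times> 'a"
      obtain x y where p: "p = (x, y)" by force
      let ?i = "indicator (cball x (real k)) y :: real"
      have sym: "(indicator (cball y (real k)) x :: real) = ?i" by (simp add: indicator_def dist_commute)
      have iV: "\<bar>?V (x - y)\<bar> \<le> real k * ?i"
        by (rule truncation_diff_bound)
      have "norm (?I (\<lambda>x. u x + v n x) p - ?I u p - ?I (v n) p)
          = \<bar>?V (x - y)\<bar> * \<bar>(u x + v n x)\<^sup>2 * (u y + v n y)\<^sup>2 - (u x)\<^sup>2 * (u y)\<^sup>2 - (v n x)\<^sup>2 * (v n y)\<^sup>2\<bar>"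
        unfolding p by (simp add: abs_mult[symmetric] algebra_simps)
      also have "\<dots> \<le> (real k * ?i) * ((u x)\<^sup>2 * (v n y)\<^sup>2 + (v n x)\<^sup>2 * (u y)\<^sup>2 + 2 * \<bar>u x * v n x\<bar> * (u y + v n y)\<^sup>2 + 2 * (((u x)\<^sup>2 + (v n x)\<^sup>2) * \<bar>u y * v n y\<bar>))"
        by (intro mult_mono iV square_sum_split_bound) auto
      also have "\<dots> = real k * (?t1 p + ?t2 p) + real k * (?i * (2 * ?t3 p + 2 * ?t4 p))"
        unfolding p by (simp add: sym algebra_simps)
      \<comment> \<open>The restriction to pairs within the range is kept only in the terms that
        need it.\<close>
      also have "\<dots> \<le> ?b p"
      proof -
        have "0 \<le> 2 * ?t3 p + 2 * ?t4 p" unfolding p by simp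
        hence "?i * (2 * ?t3 p + 2 * ?t4 p) \<le> 2 * ?t3 p + 2 * ?t4 p" by (simp add: indicator_def)
        hence "real k * (?i * (2 * ?t3 p + 2 * ?t4 p)) \<le> real k * (2 * ?t3 p + 2 * ?t4 p)" by (rule mult_left_mono) simp
        thus ?thesis by simp
      qed
      finally show "norm (?I (\<lambda>x. u x + v n x) p - ?I u p - ?I (v n) p) \<le> ?b p" .
    qed
    also have "\<dots> = real k * (T n + T n) + real k * (2 * (J n * nsq (\<lambda>x. u x + v n x)) + 2 * ((nsq u + nsq (v n)) * J n))"
    proof -
      have "(\<integral>p. ?b p \<partial>?P) = real k * (integral\<^sup>L ?P ?t1 + integral\<^sup>L ?P ?t2) + real k * (2 * integral\<^sup>L ?P ?t3 + 2 * integral\<^sup>L ?P ?t4)"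
        using i1 i2 i3 i4 by (simp only: Bochner_Integration.integral_add Bochner_Integration.integrable_add integrable_mult_right integral_mult_right_zero)
      thus ?thesis unfolding e2 e3 e4 unfolding T_def .
    qed
    also have "\<dots> = real k * (2 * T n) + real k * (J n * (2 * nsq (\<lambda>x. u x + v n x) + 2 * (nsq u + nsq (v n))))"
      by (simp add: algebra_simps)
    also have "\<dots> \<le> real k * (2 * T n) + real k * (J n * (2 * c + 2 * (nsq u + C)))"
      using nsq_add_le[OF u v(1)[of n]] v(2)[of n] unfolding c_def
      by (intro add_left_mono mult_left_mono Jn add_mono) auto
    finally show ?thesis unfolding eq .
  qed
  show ?thesis
  proof (rule Lim_null_comparison[OF always_eventually[OF allI[OF bound]]])
    have "(\<lambda>n. real k * (2 * T n) + real k * (J n * (2 * c + 2 * (nsq u + C)))) \<longlonglongrightarrow> real k * (2 * 0) + real k * (0 * (2 * c + 2 * (nsq u + C)))"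
      by (intro tendsto_intros T0 J0)
    thus "(\<lambda>n. real k * (2 * T n) + real k * (J n * (2 * c + 2 * (nsq u + C)))) \<longlonglongrightarrow> 0" by simp
  qed
qed

section \<open>Existence of minimizers\<close>

definition pair_energy :: "('a::euclidean_space \<Rightarrow> real) \<Rightarrow> real \<Rightarrow> ('a \<Rightarrow> real) \<Rightarrow> ('a \<Rightarrow> 'a) \<Rightarrow> real" where
  "pair_energy W g u G = 1 / 2 * nsq G - g / 4 * interaction W u"

lemma admissible_measurable: "admissible W \<Longrightarrow> W \<in> borel_measurable borel"
  by (simp add: admissible_def)

text \<open>
  Every estimate on the interaction is transferred from the bounded, compactly supported truncations,
  the remainder being small relative to the \<open>H\<^sup>1\<close> norm.
\<close>

lemma interaction_approx:
  fixes W :: "'a::euclidean_space \<Rightarrow> real"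
  assumes d: "DIM('a) \<in> {1, 2, 3}" and W: "admissible W" and e: "e > 0"
  obtains n where "\<And>u G. sobolev u G \<Longrightarrow> \<bar>interaction W u - interaction (truncation n W) u\<bar> \<le> e * nsq u * (nsq u + nsq G)"
proof -
  note Wm = admissible_measurable[OF W]
  obtain n where n: "\<And>u G. sobolev u G \<Longrightarrow> abs_interaction (\<lambda>x. W x - truncation n W x) u \<le> ennreal (e * nsq u * (nsq u + nsq G))"
    using abs_interaction_truncation_small[OF d W e] by blast
  have "\<bar>interaction W u - interaction (truncation n W) u\<bar> \<le> e * nsq u * (nsq u + nsq G)" if s: "sobolev u G" for u G
  proof -
    have 0: "0 \<le> e * nsq u * (nsq u + nsq G)" using e by simp
    have m: "(\<lambda>x. W x - truncation n W x) \<in> borel_measurable borel" using Wm by measurable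
    show ?thesis
      using interaction_truncation_split(1)[OF Wm sobolev_L2(1)[OF s] n[OF s] 0]
        interaction_integrable(2)[OF m L2_measurable[OF sobolev_L2(1)[OF s]] n[OF s] 0] by simp
  qed
  thus ?thesis by (rule that)
qed

lemma interaction_truncation_bound:
  fixes W :: "'a::euclidean_space \<Rightarrow> real"
  assumes W: "admissible W" and u: "L2 u"
  shows "\<bar>interaction (truncation n W) u\<bar> \<le> real n * nsq u * nsq u"
  using admissible_measurable[OF W] u
  by (intro interaction_integrable(2) abs_interaction_truncation_le_nsq) (auto intro: L2_measurable)

lemma pair_energy_coercive:
  fixes W :: "'a::euclidean_space \<Rightarrow> real"
  assumes d: "DIM('a) \<in> {1, 2, 3}" and W: "admissible W" and g: "g > 0" and m: "m > 0"
  obtains K where "\<And>u G. sobolev u G \<Longrightarrow> nsq u = m \<Longrightarrow> nsq G \<le> 4 * pair_energy W g u G + K"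
proof -
  \<comment> \<open>Chosen so that the remainder of the potential takes from the kinetic term
    \<open>nsq G / 2\<close> only \<open>nsq G / 4\<close>, up to a constant.\<close>
  define e where "e = 1 / (g * m)"
  have e: "e > 0" using g m by (simp add: e_def)
  obtain n where n: "\<And>u G. sobolev u G \<Longrightarrow> \<bar>interaction W u - interaction (truncation n W) u\<bar> \<le> e * nsq u * (nsq u + nsq G)"
    using interaction_approx[OF d W e] by blast
  have "nsq G \<le> 4 * pair_energy W g u G + (g * real n * m * m + m)" if s: "sobolev u G" and um: "nsq u = m" for u G
  proof -
    have "g * interaction W u \<le> g * (real n * m * m + e * m * (m + nsq G))"
      using n[OF s] interaction_truncation_bound[OF W sobolev_L2(1)[OF s], of n] g unfolding um
      by (intro mult_left_mono) linarith+
    also have "\<dots> = g * real n * m * m + (m + nsq G)"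
      unfolding e_def using g m by (simp add: field_simps)
    finally show ?thesis unfolding pair_energy_def by argo
  qed
  thus ?thesis by (rule that)
qed

lemma interaction_splitting:
  fixes W :: "'a::euclidean_space \<Rightarrow> real"
  assumes d: "DIM('a) \<in> {1, 2, 3}" and W: "admissible W" and u: "sobolev u G"
    and v: "\<And>n. sobolev (v n) (H n)" "\<And>n. nsq (v n) \<le> C" "\<And>n. nsq (H n) \<le> C" and w: "(\<lambda>n. weighted_sq (v n)) \<longlonglongrightarrow> 0"
  shows "(\<lambda>n. interaction W (\<lambda>x. u x + v n x) - interaction W u - interaction W (v n)) \<longlonglongrightarrow> 0"
proof (rule LIMSEQ_I)
  fix e :: real assume e: "e > 0"
  have C0: "C \<ge> 0" using v(2)[of 0] nsq_nonneg[of "v 0"] by linarith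
  \<comment> \<open>A common bound for the squared norms of u, of \<open>v n\<close> and of their
    sum, and for those of the gradients.\<close>
  define K where "K = 2 * nsq u + 2 * nsq G + 2 * C + 1"
  have K: "K > 0" using C0 nsq_nonneg[of u] nsq_nonneg[of G] unfolding K_def by linarith
  \<comment> \<open>Three truncation errors of at most e / 6 leave e / 2 for the truncated
    splitting.\<close>
  define \<epsilon> where "\<epsilon> = e / (12 * K * K)"
  have \<epsilon>: "\<epsilon> > 0" using e K by (simp add: \<epsilon>_def)
  obtain k where k: "\<And>u G. sobolev u G \<Longrightarrow> \<bar>interaction W u - interaction (truncation k W) u\<bar> \<le> \<epsilon> * nsq u * (nsq u + nsq G)"
    using interaction_approx[OF d W \<epsilon>] by blast
  have small: "\<bar>interaction W a - interaction (truncation k W) a\<bar> \<le> e / 6" if s: "sobolev a A" and "nsq a \<le> K" "nsq A \<le> K" for a A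
  proof -
    have "\<epsilon> * nsq a * (nsq a + nsq A) \<le> \<epsilon> * K * (K + K)"
      using that(2,3) \<epsilon> K by (intro mult_mono add_mono) auto
    also have "\<dots> = e / 6" using K by (simp add: \<epsilon>_def field_simps)
    finally show ?thesis using k[OF s] by linarith
  qed
  have s: "sobolev (\<lambda>x. u x + v n x) (\<lambda>x. G x + H n x)" for n
    using sobolev_lincomb[OF u v(1)[of n], of 1 1] by simp
  have nu: "nsq u \<le> K" "nsq G \<le> K" using C0 nsq_nonneg[of u] nsq_nonneg[of G] unfolding K_def by linarith+
  have nv: "nsq (v n) \<le> K" "nsq (H n) \<le> K" for n
    using v(2)[of n] v(3)[of n] C0 nsq_nonneg[of u] nsq_nonneg[of G] unfolding K_def by linarith+
  have ns: "nsq (\<lambda>x. u x + v n x) \<le> K" "nsq (\<lambda>x. G x + H n x) \<le> K" for n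
    using nsq_add_le[OF sobolev_L2(1)[OF u] sobolev_L2(1)[OF v(1)], of n] nsq_add_le[OF sobolev_L2(2)[OF u] sobolev_L2(2)[OF v(1)], of n]
      v(2)[of n] v(3)[of n] nsq_nonneg[of u] nsq_nonneg[of G] unfolding K_def by linarith+
  have "(\<lambda>n. interaction (truncation k W) (\<lambda>x. u x + v n x) - interaction (truncation k W) u - interaction (truncation k W) (v n)) \<longlonglongrightarrow> 0"
    by (rule interaction_truncation_splitting[OF admissible_measurable[OF W] sobolev_L2(1)[OF u] sobolev_L2(1)[OF v(1)] v(2) w])
  then obtain N where N: "\<And>n. n \<ge> N \<Longrightarrow> \<bar>interaction (truncation k W) (\<lambda>x. u x + v n x) - interaction (truncation k W) u - interaction (truncation k W) (v n)\<bar> < e / 2"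
    using LIMSEQ_D[of _ 0 "e/2"] e by fastforce
  show "\<exists>N. \<forall>n\<ge>N. norm (interaction W (\<lambda>x. u x + v n x) - interaction W u - interaction W (v n) - 0) < e"
  proof (intro exI[of _ N] allI impI)
    fix n assume "n \<ge> N"
    from N[OF this] small[OF u nu] small[OF v(1) nv, of n] small[OF s ns, of n]
    show "norm (interaction W (\<lambda>x. u x + v n x) - interaction W u - interaction W (v n) - 0) < e"
      unfolding real_norm_def by linarith
  qed
qed

text \<open>The cross term of the gradients is \<open>ip G (H n)\<close>, which tends to 0 by weak
  convergence.\<close>

lemma pair_energy_splitting:
  fixes W :: "'a::euclidean_space \<Rightarrow> real"
  assumes d: "DIM('a) \<in> {1, 2, 3}" and W: "admissible W" and u: "sobolev u G"
    and v: "\<And>n. sobolev (v n) (H n)" "\<And>n. nsq (v n) \<le> C" "\<And>n. nsq (H n) \<le> C" and w: "(\<lambda>n. weighted_sq (v n)) \<longlonglongrightarrow> 0"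
  shows "(\<lambda>n. pair_energy W g (\<lambda>x. u x + v n x) (\<lambda>x. G x + H n x) - pair_energy W g u G - pair_energy W g (v n) (H n)) \<longlonglongrightarrow> 0"
proof -
  have "pair_energy W g (\<lambda>x. u x + v n x) (\<lambda>x. G x + H n x) - pair_energy W g u G - pair_energy W g (v n) (H n)
      = ip G (H n) - g / 4 * (interaction W (\<lambda>x. u x + v n x) - interaction W u - interaction W (v n))" for n
    unfolding pair_energy_def nsq_add[OF sobolev_L2(2)[OF u] sobolev_L2(2)[OF v(1)]] by (simp add: algebra_simps)
  moreover have "(\<lambda>n. ip G (H n) - g / 4 * (interaction W (\<lambda>x. u x + v n x) - interaction W u - interaction W (v n))) \<longlonglongrightarrow> 0 - g / 4 * 0"
    by (intro tendsto_intros sobolev_weak_convergence[OF v w sobolev_L2(2)[OF u]] interaction_splitting[OF d W u v w])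
  ultimately show ?thesis by simp
qed

text \<open>Multiplying u by the root of \<theta> = m / nsq u raises its mass to m, the gradient
  term by the factor \<theta> and the interaction by its square. After division by \<theta>, the
  competitor differs from u only by the factor \<theta> >= 1 in front of the interaction. A positive
  interaction makes this a gain, strict for \<theta> > 1; otherwise the energy of u is nonnegative
  while the left-hand side is negative.\<close>

lemma pair_energy_scaling:
  fixes W :: "'a::euclidean_space \<Rightarrow> real"
  assumes E0: "\<And>v H. sobolev v H \<Longrightarrow> nsq v = m \<Longrightarrow> E0 \<le> pair_energy W g v H" and neg: "E0 < 0" and g: "g > 0"
    and s: "sobolev u G" and pos: "0 < nsq u" and m: "nsq u \<le> m"
  shows "nsq u / m * E0 \<le> pair_energy W g u G" and "nsq u < m \<Longrightarrow> nsq u / m * E0 < pair_energy W g u G"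
proof -
  define \<theta> where "\<theta> = m / nsq u"
  have \<theta>: "\<theta> \<ge> 1" "nsq u / m = 1 / \<theta>" using pos m by (auto simp: \<theta>_def)
  have c2: "(sqrt \<theta>)\<^sup>2 = \<theta>" using \<theta> by simp
  hence c4: "(sqrt \<theta>)^4 = \<theta>\<^sup>2" by (metis mult_2_right numeral_Bit0 power_add power2_eq_square)
  have "nsq (\<lambda>x. sqrt \<theta> * u x) = m" unfolding nsq_mult c2 using pos by (simp add: \<theta>_def)
  from E0[OF sobolev_cmult[OF s] this]
  have "E0 \<le> 1/2 * (\<theta> * nsq G) - g/4 * (\<theta>\<^sup>2 * interaction W u)"
    unfolding pair_energy_def nsq_scaleR interaction_cmult c2 c4 .
  hence "E0 / \<theta> \<le> (1/2 * (\<theta> * nsq G) - g/4 * (\<theta>\<^sup>2 * interaction W u)) / \<theta>" using \<theta> by (intro divide_right_mono) auto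
  also have "\<dots> = 1/2 * nsq G - g/4 * (\<theta> * interaction W u)" using \<theta>(1) by (simp add: field_simps power2_eq_square)
  finally have le: "nsq u / m * E0 \<le> 1/2 * nsq G - g/4 * (\<theta> * interaction W u)" unfolding \<theta>(2) by simp
  have dneg: "nsq u / m * E0 < 0" using neg pos m by (intro mult_pos_neg divide_pos_pos) auto
  show "nsq u / m * E0 \<le> pair_energy W g u G"
  proof (cases "interaction W u \<ge> 0")
    case True
    hence "g/4 * (1 * interaction W u) \<le> g/4 * (\<theta> * interaction W u)" using \<theta> g by (intro mult_left_mono mult_right_mono) auto
    thus ?thesis using le by (simp add: pair_energy_def)
  next
    case False
    hence "g/4 * interaction W u \<le> 0" using g by (simp add: mult_nonneg_nonpos)
    thus ?thesis using dneg nsq_nonneg[of G] unfolding pair_energy_def by linarith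
  qed
  show "nsq u / m * E0 < pair_energy W g u G" if lt: "nsq u < m"
  proof (cases "interaction W u > 0")
    case True
    have "\<theta> > 1" using lt pos by (simp add: \<theta>_def)
    hence "g/4 * (1 * interaction W u) < g/4 * (\<theta> * interaction W u)" using True g by (intro mult_strict_left_mono mult_strict_right_mono) auto
    thus ?thesis using le by (simp add: pair_energy_def)
  next
    case False
    hence "g/4 * interaction W u \<le> 0" using g by (simp add: mult_nonneg_nonpos)
    thus ?thesis using dneg nsq_nonneg[of G] unfolding pair_energy_def by linarith
  qed
qed

lemma mass_near_point:
  fixes W :: "'a::euclidean_space \<Rightarrow> real"
  assumes W: "admissible W" and u: "L2 u" and lt: "real n * nsq u * e < interaction (truncation n W) u" and e: "e \<ge> 0"
  obtains y where "ennreal e < (\<integral>\<^sup>+x. ennreal ((u x)\<^sup>2) * indicator (cball y (real n)) x \<partial>lborel)"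
proof -
  have "\<not> (\<forall>y. (\<integral>\<^sup>+x. ennreal ((u x)\<^sup>2) * indicator (cball y (real n)) x \<partial>lborel) \<le> ennreal e)"
  proof
    assume *: "\<forall>y. (\<integral>\<^sup>+x. ennreal ((u x)\<^sup>2) * indicator (cball y (real n)) x \<partial>lborel) \<le> ennreal e"
    have "\<bar>interaction (truncation n W) u\<bar> \<le> real n * nsq u * e"
      using admissible_measurable[OF W] u e *
      by (intro interaction_integrable(2) abs_interaction_truncation_le) (auto intro: L2_measurable)
    thus False using lt by linarith
  qed
  thus ?thesis using that by (auto simp: not_le)
qed

lemma weighted_sq_ge_local:
  fixes u :: "'a::euclidean_space \<Rightarrow> real"
  assumes u: "L2 u" and R: "R \<ge> 0"
  shows "(\<integral>\<^sup>+x. ennreal ((u x)\<^sup>2) * indicator (cball 0 R) x \<partial>lborel) \<le> ennreal ((1 + R) * weighted_sq u)"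
proof -
  note [measurable] = L2_measurable[OF u]
  have "(\<integral>\<^sup>+x. ennreal ((u x)\<^sup>2) * indicator (cball 0 R) x \<partial>lborel) \<le> (\<integral>\<^sup>+x. ennreal ((1 + R) * ((u x)\<^sup>2 / (1 + norm x))) \<partial>lborel)"
  proof (rule nn_integral_mono)
    fix x :: 'a
    have "(u x)\<^sup>2 \<le> (1 + R) * ((u x)\<^sup>2 / (1 + norm x))" if "x \<in> cball 0 R"
    proof -
      have "1 * (u x)\<^sup>2 \<le> ((1 + R) / (1 + norm x)) * (u x)\<^sup>2"
        using that by (intro mult_right_mono) (auto simp: pos_le_divide_eq)
      thus ?thesis by simp
    qed
    thus "ennreal ((u x)\<^sup>2) * indicator (cball 0 R) x \<le> ennreal ((1 + R) * ((u x)\<^sup>2 / (1 + norm x)))"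
      by (cases "x \<in> cball 0 R") (auto intro: ennreal_leI)
  qed
  also have "\<dots> = ennreal (\<integral>x. (1 + R) * ((u x)\<^sup>2 / (1 + norm x)) \<partial>lborel)"
    using R by (intro nn_integral_eq_integral integrable_mult_right weighted_sq_integrable u) auto
  also have "(\<integral>x. (1 + R) * ((u x)\<^sup>2 / (1 + norm x)) \<partial>lborel) = (1 + R) * weighted_sq u"
    unfolding weighted_sq_def by (rule integral_mult_right_zero)
  finally show ?thesis .
qed

theorem pair_energy_minimizer_exists:
  fixes W :: "'a::euclidean_space \<Rightarrow> real"
  assumes d: "DIM('a) \<in> {1, 2, 3}" and W: "admissible W" and g: "g > 0" and m: "m > 0"
    and neg: "sobolev u0 G0" "nsq u0 = m" "pair_energy W g u0 G0 < 0"
  obtains u G where "sobolev u G" "nsq u = m" "\<And>v H. sobolev v H \<Longrightarrow> nsq v = m \<Longrightarrow> pair_energy W g u G \<le> pair_energy W g v H"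
proof -
  define S where "S = {pair_energy W g v H | v H. sobolev v H \<and> nsq v = m}"
  obtain K where K: "\<And>u G. sobolev u G \<Longrightarrow> nsq u = m \<Longrightarrow> nsq G \<le> 4 * pair_energy W g u G + K"
    using pair_energy_coercive[OF d W g m] by blast
  have bdd: "bdd_below S"
  proof (rule bdd_belowI)
    fix x assume "x \<in> S"
    then obtain v H where v: "x = pair_energy W g v H" "sobolev v H" "nsq v = m" by (auto simp: S_def)
    show "- K / 4 \<le> x" using K[OF v(2,3)] nsq_nonneg[of H] unfolding v(1) by linarith
  qed
  have ne: "S \<noteq> {}" using neg by (auto simp: S_def)
  define E0 where "E0 = Inf S"
  have E0: "E0 \<le> pair_energy W g v H" if "sobolev v H" "nsq v = m" for v H
    unfolding E0_def by (rule cInf_lower[OF _ bdd]) (use that in \<open>auto simp: S_def\<close>)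
  have E0n: "E0 < 0" using E0[OF neg(1,2)] neg(3) by linarith
  \<comment> \<open>The tolerance is at most - E0 / 2, so every energy of the minimizing sequence is
    at most E0 / 2 < 0.\<close>
  have "\<exists>v H. sobolev v H \<and> nsq v = m \<and> pair_energy W g v H < E0 + (- E0 / 2) * (1 / real (Suc n))" for n
  proof -
    have "0 < (- E0 / 2) * (1 / real (Suc n))" using E0n by (intro mult_pos_pos) auto
    hence "E0 < E0 + (- E0 / 2) * (1 / real (Suc n))" by (rule less_add_same_cancel1[THEN iffD2])
    then obtain x where "x \<in> S" "x < E0 + (- E0 / 2) * (1 / real (Suc n))"
      using cInf_less_iff[OF ne bdd] unfolding E0_def by blast
    thus ?thesis by (auto simp: S_def)
  qed
  then obtain a A where sa: "\<And>n. sobolev (a n) (A n)" and am: "\<And>n. nsq (a n) = m"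
    and aE: "\<And>n. pair_energy W g (a n) (A n) < E0 + (- E0 / 2) * (1 / real (Suc n))" by metis
  have aE2: "pair_energy W g (a n) (A n) \<le> E0 / 2" for n
  proof -
    have "(- E0 / 2) * (1 / real (Suc n)) \<le> (- E0 / 2) * 1" using E0n by (intro mult_left_mono) auto
    thus ?thesis using aE[of n] by linarith
  qed
  define C where "C = max m \<bar>K\<bar>"
  have C: "nsq (a n) \<le> C" "nsq (A n) \<le> C" for n
    using K[OF sa am, of n] aE2[of n] E0n am[of n] unfolding C_def by linarith+
  have C0: "C > 0" using m by (simp add: C_def)
  \<comment> \<open>As the kinetic term is nonnegative, the interaction is at least 2 c along the
    sequence; truncation is allowed to cost c.\<close>
  define c where "c = - E0 / g"
  have c: "c > 0" using E0n g unfolding c_def by (intro divide_pos_pos) auto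
  have aI: "2 * c \<le> interaction W (a n)" for n
  proof -
    have "- g / 4 * interaction W (a n) \<le> E0 / 2" using aE2[of n] nsq_nonneg[of "A n"] unfolding pair_energy_def by linarith
    hence "- E0 * 2 \<le> g * interaction W (a n)" by linarith
    thus ?thesis using g unfolding c_def by (simp add: field_simps)
  qed
  \<comment> \<open>Makes the truncation error at most c at mass m and gradient bound C.\<close>
  define \<epsilon> where "\<epsilon> = c / (m * (m + C))"
  have \<epsilon>: "\<epsilon> > 0" using c m C0 by (simp add: \<epsilon>_def)
  obtain N where N: "\<And>u G. sobolev u G \<Longrightarrow> \<bar>interaction W u - interaction (truncation N W) u\<bar> \<le> \<epsilon> * nsq u * (nsq u + nsq G)"
    using interaction_approx[OF d W \<epsilon>] by blast
  have aV: "c \<le> interaction (truncation N W) (a n)" for n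
  proof -
    have "\<epsilon> * nsq (a n) * (nsq (a n) + nsq (A n)) \<le> \<epsilon> * m * (m + C)"
      unfolding am using C(2)[of n] \<epsilon> m by (intro mult_left_mono add_left_mono) auto
    also have "\<dots> = c"
    proof -
      have "m * (m + C) \<noteq> 0" using m C0 by simp
      thus ?thesis by (simp add: \<epsilon>_def mult.assoc)
    qed
    finally show ?thesis using N[OF sa, of n] aI[of n] by linarith
  qed
  \<comment> \<open>The amount of mass to be found in a ball, small enough for
    \<open>real N * m * \<eta> < c\<close>; the added 1 covers N = 0.\<close>
  define \<eta> where "\<eta> = c / (2 * (real N * m + 1))"
  have Nm: "real N * m \<ge> 0" using m by simp
  have \<eta>: "\<eta> > 0" using c Nm by (simp add: \<eta>_def)
  have "real N * m * \<eta> < c"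
  proof -
    have "real N * m * \<eta> \<le> (real N * m + 1) * \<eta>" using \<eta> by simp
    also have "\<dots> = c / 2" using Nm by (simp add: \<eta>_def field_simps)
    finally show ?thesis using c by linarith
  qed
  hence "\<exists>y. ennreal \<eta> < (\<integral>\<^sup>+x. ennreal ((a n x)\<^sup>2) * indicator (cball y (real N)) x \<partial>lborel)" for n
    using mass_near_point[OF W sobolev_L2(1)[OF sa[of n]], of N \<eta>] aV[of n] \<eta> am[of n] by (metis less_le_trans less_imp_le)
  then obtain y where y: "\<And>n. ennreal \<eta> < (\<integral>\<^sup>+x. ennreal ((a n x)\<^sup>2) * indicator (cball (y n) (real N)) x \<partial>lborel)" by metis
  \<comment> \<open>Recentred at the ball that carries the mass; the energy is translation
    invariant.\<close>
  define b where "b n x = a n (x + y n)" for n x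
  define B where "B n x = A n (x + y n)" for n x
  have sb: "sobolev (b n) (B n)" for n unfolding b_def B_def by (rule sobolev_translate[OF sa])
  have bm: "nsq (b n) = m" for n unfolding b_def using nsq_translate[OF sobolev_L2(1)[OF sa]] am by simp
  have Bn: "nsq (B n) = nsq (A n)" for n unfolding B_def using nsq_translate[OF sobolev_L2(2)[OF sa]] by simp
  have bE: "pair_energy W g (b n) (B n) = pair_energy W g (a n) (A n)" for n
    unfolding pair_energy_def Bn unfolding b_def
    using interaction_translate[OF admissible_measurable[OF W] L2_measurable[OF sobolev_L2(1)[OF sa]]] by simp
  have bC: "nsq (b n) \<le> C" "nsq (B n) \<le> C" for n using C am bm Bn by metis+
  have bloc: "ennreal \<eta> < ennreal ((1 + real N) * weighted_sq (b n))" for n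
  proof -
    note [measurable] = L2_measurable[OF sobolev_L2(1)[OF sa]]
    have [measurable]: "cball z q \<in> sets (borel :: 'a measure)" for z q by simp
    have "(\<integral>\<^sup>+x. ennreal ((a n x)\<^sup>2) * indicator (cball (y n) (real N)) x \<partial>lborel)
        = (\<integral>\<^sup>+x. ennreal ((a n (x + y n))\<^sup>2) * indicator (cball (y n) (real N)) (x + y n) \<partial>lborel)"
      by (rule nn_integral_translate[symmetric]) measurable
    also have "\<dots> = (\<integral>\<^sup>+x. ennreal ((b n x)\<^sup>2) * indicator (cball 0 (real N)) x \<partial>lborel)"
      unfolding b_def by (intro nn_integral_cong) (auto simp: indicator_def dist_norm)
    finally have "ennreal \<eta> < (\<integral>\<^sup>+x. ennreal ((b n x)\<^sup>2) * indicator (cball 0 (real N)) x \<partial>lborel)" using y[of n] by simp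
    also have "\<dots> \<le> ennreal ((1 + real N) * weighted_sq (b n))" by (rule weighted_sq_ge_local[OF sobolev_L2(1)[OF sb]]) simp
    finally show ?thesis .
  qed
  obtain r u where r: "strict_mono (r :: nat \<Rightarrow> nat)" and u: "L2 u" and w: "(\<lambda>n. weighted_sq (\<lambda>x. b (r n) x - u x)) \<longlonglongrightarrow> 0"
    by (rule sobolev_local_compactness[OF sb bC])
  \<comment> \<open>For F = 0 and e = 0 the half-space constraint holds trivially.\<close>
  obtain G where sG: "sobolev u G"
    using sobolev_weak_closure[of "\<lambda>n. b (r n)" "\<lambda>n. B (r n)", OF sb bC u w L2_0, of 0] by (auto simp: ip_def)
  define v where "v n x = b (r n) x - u x" for n x
  define H where "H n x = B (r n) x - G x" for n x
  have sv: "sobolev (v n) (H n)" for n unfolding v_def H_def by (rule sobolev_diff[OF sb sG])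
  have vw: "(\<lambda>n. weighted_sq (v n)) \<longlonglongrightarrow> 0" using w by (simp add: v_def[abs_def])
  define C' where "C' = 2 * C + 2 * nsq u + 2 * nsq G"
  have vC: "nsq (v n) \<le> C'" "nsq (H n) \<le> C'" for n
    using nsq_diff_le[OF sobolev_L2(1)[OF sb[of "r n"]] u] nsq_diff_le[OF sobolev_L2(2)[OF sb[of "r n"]] sobolev_L2(2)[OF sG]]
      bC[of "r n"] nsq_nonneg[of u] nsq_nonneg[of G] unfolding C'_def v_def H_def by linarith+
  have bu: "b (r n) = (\<lambda>x. u x + v n x)" "B (r n) = (\<lambda>x. G x + H n x)" for n by (auto simp: v_def H_def)
  have "(\<lambda>n. \<integral>x. u x * v n x \<partial>lborel) \<longlonglongrightarrow> 0"
    by (rule integral_mult_tendsto_0[OF u sobolev_L2(1)[OF sv] vC(1) vw])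
  hence "(\<lambda>n. ip u (v n)) \<longlonglongrightarrow> 0" by (simp add: ip_def)
  hence "(\<lambda>n. m - nsq u - 2 * ip u (v n)) \<longlonglongrightarrow> m - nsq u - 2 * 0" by (intro tendsto_intros)
  moreover have "m - nsq u - 2 * ip u (v n) = nsq (v n)" for n
    using nsq_add[OF u sobolev_L2(1)[OF sv], of n] bm[of "r n"] unfolding bu by simp
  ultimately have vm: "(\<lambda>n. nsq (v n)) \<longlonglongrightarrow> m - nsq u" by simp
  have um: "nsq u \<le> m" using LIMSEQ_le_const[OF vm, of 0] by auto
  \<comment> \<open>A zero limit would make the weighted norms of the recentred functions tend to 0,
    against the mass \<eta> in the fixed ball around the origin.\<close>
  have upos: "0 < nsq u"
  proof (rule ccontr)
    assume "\<not> 0 < nsq u"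
    hence "nsq u = 0" using nsq_nonneg[of u] by linarith
    hence u0: "AE x in lborel. u x = 0" using nsq_eq_0_iff[OF u] by simp
    have "weighted_sq (b (r n)) = weighted_sq (v n)" for n
      unfolding weighted_sq_def
      using u0 L2_measurable[OF u] L2_measurable[OF sobolev_L2(1)[OF sb]] L2_measurable[OF sobolev_L2(1)[OF sv]]
      by (intro integral_cong_AE) (auto simp: v_def elim: eventually_mono)
    hence "(\<lambda>n. (1 + real N) * weighted_sq (b (r n))) \<longlonglongrightarrow> (1 + real N) * 0" using vw by (intro tendsto_mult tendsto_const) simp
    hence "\<forall>\<^sub>F n in sequentially. (1 + real N) * weighted_sq (b (r n)) < \<eta>" using \<eta> by (intro order_tendstoD(2)) auto
    then obtain n where "(1 + real N) * weighted_sq (b (r n)) < \<eta>" by (auto simp: eventually_sequentially)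
    hence "ennreal ((1 + real N) * weighted_sq (b (r n))) \<le> ennreal \<eta>" by (intro ennreal_leI) simp
    thus False using bloc[of "r n"] by simp
  qed
  have lim1: "(\<lambda>n. pair_energy W g (b (r n)) (B (r n)) - pair_energy W g u G - pair_energy W g (v n) (H n)) \<longlonglongrightarrow> 0"
    unfolding bu by (rule pair_energy_splitting[OF d W sG sv vC vw])
  have "(\<lambda>n. pair_energy W g (a n) (A n)) \<longlonglongrightarrow> E0"
  proof (rule tendsto_sandwich)
    show "\<forall>\<^sub>F n in sequentially. E0 \<le> pair_energy W g (a n) (A n)" using E0[OF sa am] by simp
    show "\<forall>\<^sub>F n in sequentially. pair_energy W g (a n) (A n) \<le> E0 + (- E0 / 2) * (1 / real (Suc n))"
      using aE by (simp add: less_imp_le)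
    have "(\<lambda>n. E0 + (- E0 / 2) * (1 / real (Suc n))) \<longlonglongrightarrow> E0 + (- E0 / 2) * 0"
      by (intro tendsto_intros LIMSEQ_Suc lim_1_over_n)
    thus "(\<lambda>n. E0 + (- E0 / 2) * (1 / real (Suc n))) \<longlonglongrightarrow> E0" by simp
  qed simp
  hence lim2: "(\<lambda>n. pair_energy W g (b (r n)) (B (r n))) \<longlonglongrightarrow> E0"
    unfolding bE using LIMSEQ_subseq_LIMSEQ[OF _ r] by (simp add: o_def)
  have lim3: "(\<lambda>n. pair_energy W g (v n) (H n)) \<longlonglongrightarrow> E0 - pair_energy W g u G"
  proof -
    have "(\<lambda>n. pair_energy W g (b (r n)) (B (r n)) - pair_energy W g u G - (pair_energy W g (b (r n)) (B (r n)) - pair_energy W g u G - pair_energy W g (v n) (H n))) \<longlonglongrightarrow> E0 - pair_energy W g u G - 0"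
      by (intro tendsto_diff lim1 lim2 tendsto_const)
    thus ?thesis by simp
  qed
  \<comment> \<open>Since u carries mass, the remainder eventually has mass below m and falls under
    the scaling lemma.\<close>
  have "\<forall>\<^sub>F n in sequentially. nsq (v n) < m" using vm upos by (intro order_tendstoD(2)) auto
  hence "\<forall>\<^sub>F n in sequentially. nsq (v n) / m * E0 \<le> pair_energy W g (v n) (H n)"
  proof eventually_elim
    fix n assume lt: "nsq (v n) < m"
    show "nsq (v n) / m * E0 \<le> pair_energy W g (v n) (H n)"
    proof (cases "nsq (v n) = 0")
      \<comment> \<open>The scaling lemma excludes mass 0; the interaction then vanishes by
        comparison with a truncation.\<close>
      case True
      obtain k where "\<And>u G. sobolev u G \<Longrightarrow> \<bar>interaction W u - interaction (truncation k W) u\<bar> \<le> 1 * nsq u * (nsq u + nsq G)"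
        using interaction_approx[OF d W, of 1] by auto
      from this[OF sv[of n]] interaction_truncation_bound[OF W sobolev_L2(1)[OF sv], of k n] have "interaction W (v n) = 0"
        unfolding True by simp
      thus ?thesis using True by (simp add: pair_energy_def)
    next
      case False
      hence "0 < nsq (v n)" using nsq_nonneg[of "v n"] by linarith
      from pair_energy_scaling(1)[OF E0 E0n g sv this] lt show ?thesis by simp
    qed
  qed
  hence key: "(m - nsq u) / m * E0 \<le> E0 - pair_energy W g u G"
    by (intro tendsto_le[OF _ lim3 tendsto_mult[OF tendsto_divide[OF vm tendsto_const] tendsto_const]]) (use m in auto)
  have "(m - nsq u) / m * E0 = E0 - nsq u / m * E0" using m by (simp add: field_simps)
  with key have "E0 - nsq u / m * E0 \<le> E0 - pair_energy W g u G" by (simp only:)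
  hence key2: "pair_energy W g u G \<le> nsq u / m * E0" by (meson diff_strict_left_mono not_le)
  have eq: "nsq u = m"
    using pair_energy_scaling(2)[OF E0 E0n g sG upos um] key2 um by fastforce
  have "pair_energy W g u G \<le> E0" using key2 m unfolding eq by simp
  with E0 have "pair_energy W g u G \<le> pair_energy W g v H" if "sobolev v H" "nsq v = m" for v H using that order_trans by blast
  with sG eq show ?thesis by (intro that)
qed

section \<open>Trial functions and the critical coupling\<close>

lemma sobolev_dilate:
  assumes \<phi>: "test_function \<phi>" and l: "l > 0"
  shows "sobolev (\<lambda>x. \<phi> (l *\<^sub>R x)) (\<lambda>x. l *\<^sub>R (\<Sum>b\<in>Basis. partial_deriv b \<phi> (l *\<^sub>R x) *\<^sub>R b))"
proof -
  have "test_function (\<lambda>x. \<phi> (l *\<^sub>R x + 0))" using l by (intro test_function_affine \<phi>) simp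
  hence s: "sobolev (\<lambda>x. \<phi> (l *\<^sub>R x)) (\<lambda>x. \<Sum>b\<in>Basis. partial_deriv b (\<lambda>x. \<phi> (l *\<^sub>R x)) x *\<^sub>R b)"
    using test_function_sobolev[of "\<lambda>x. \<phi> (l *\<^sub>R x + 0)"] by simp
  have p: "partial_deriv b (\<lambda>x. \<phi> (l *\<^sub>R x)) x = l * partial_deriv b \<phi> (l *\<^sub>R x)" for b x
    using partial_deriv_affine[where f=\<phi> and c=l and z=0 and x=x and b=b] test_function_differentiable[OF \<phi>] by simp
  show ?thesis using s unfolding p by (simp add: scaleR_sum_right)
qed

lemma nsq_dilate:
  fixes f :: "'a::euclidean_space \<Rightarrow> 'b::euclidean_space"
  assumes "L2 f" "l > 0"
  shows "nsq (\<lambda>x. f (l *\<^sub>R x)) = nsq f / l ^ DIM('a)"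
  using integral_scale[of "\<lambda>x. (norm (f x))\<^sup>2" l] assms L2_measurable[OF assms(1)] by (simp add: nsq_def)

text \<open>Dilations of one bump, normalized to mass m, serve all purposes. For large l the support
  shrinks into the ball where the potential is positive. For small l the gradient term decays like
  l^2, while the square stays of order l^d on a ball of radius of order 1 / l.\<close>

lemma trial_functions:
  assumes m: "m > 0"
  obtains R a \<eta> B where "R > 0" "a > 0" "\<eta> > 0"
    "\<forall>l>0. \<exists>u G. sobolev u G \<and> nsq u = m \<and> nsq G = l\<^sup>2 * B
       \<and> (\<forall>x::'a::euclidean_space. norm x > R / l \<longrightarrow> u x = 0) \<and> (\<forall>x. norm x \<le> a / l \<longrightarrow> \<eta> * l ^ DIM('a) \<le> (u x)\<^sup>2)"
proof -
  define \<phi> :: "'a \<Rightarrow> real" where "\<phi> = bump 1 (- One) One"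
  have \<phi>: "test_function \<phi>" unfolding \<phi>_def by (rule test_function_bump) simp
  define D where "D x = (\<Sum>b\<in>Basis. partial_deriv b \<phi> x *\<^sub>R b)" for x
  have s: "sobolev \<phi> D" unfolding D_def by (rule test_function_sobolev[OF \<phi>])
  have \<phi>0: "\<phi> 0 > 0" unfolding \<phi>_def bump_def by (auto intro!: prod_pos mult_pos_pos simp: exp_flat_def)
  obtain R where R: "\<And>x. norm x > R \<Longrightarrow> \<phi> x = 0" using test_function_cc[OF \<phi>] by (auto simp: cc_def)
  have "isCont \<phi> 0" using cc_continuous[OF test_function_cc[OF \<phi>]] by (simp add: continuous_on_eq_continuous_at)
  then obtain a where a: "a > 0" "\<And>x. dist x 0 < a \<Longrightarrow> dist (\<phi> x) (\<phi> 0) < \<phi> 0 / 2"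
    using \<phi>0 unfolding continuous_at_eps_delta by (metis half_gt_zero)
  have \<phi>a: "\<phi> 0 / 2 \<le> \<phi> x" if "norm x \<le> a / 2" for x
  proof -
    have "norm x < a" using that a(1) by linarith
    hence "\<bar>\<phi> x - \<phi> 0\<bar> < \<phi> 0 / 2" using a(2)[of x] by (simp add: dist_norm)
    thus ?thesis by linarith
  qed
  define A where "A = nsq \<phi>"
  \<comment> \<open>\<phi> is at least half its value at 0 on a ball of positive measure.\<close>
  have A: "A > 0"
  proof (rule ccontr)
    assume "\<not> A > 0"
    hence "nsq \<phi> = 0" using nsq_nonneg[of \<phi>] unfolding A_def by linarith
    hence ae: "AE x in lborel. \<phi> x = 0" using nsq_eq_0_iff[OF sobolev_L2(1)[OF s]] by simp
    have "emeasure lborel (cball (0::'a) (a/2)) = (\<integral>\<^sup>+x. indicator (cball (0::'a) (a/2)) x \<partial>lborel)" by simp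
    also have "\<dots> = (\<integral>\<^sup>+x. 0 \<partial>(lborel :: 'a measure))"
    proof (rule nn_integral_cong_AE)
      show "AE x::'a in lborel. indicator (cball 0 (a/2)) x = (0::ennreal)"
        using ae
      proof eventually_elim
        fix x assume "\<phi> x = 0"
        hence "\<not> norm x \<le> a / 2" using \<phi>a[of x] \<phi>0 by auto
        thus "indicator (cball 0 (a/2)) x = (0::ennreal)" by simp
      qed
    qed
    finally have "emeasure lborel (cball (0::'a) (a/2)) = 0" by simp
    hence "measure lborel (cball (0::'a) (a/2)) = 0" by (simp add: measure_def)
    thus False using measure_cball_pos[of "a/2" "0::'a"] a(1) by simp
  qed
  define B where "B = m * nsq D / A"
  define \<eta> where "\<eta> = m / A * (\<phi> 0 / 2)\<^sup>2"
  have \<eta>: "\<eta> > 0" using m A \<phi>0 by (simp add: \<eta>_def)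
  \<comment> \<open>The maximum with 1 provides a positive radius, as the sign of R is not
    known.\<close>
  show ?thesis
  proof (rule that[of "max R 1" "a/2" \<eta> B])
    show "0 < max R 1" by simp
    show "0 < a / 2" using a by simp
    show "0 < \<eta>" by (rule \<eta>)
  next
    show "\<forall>l>0. \<exists>u G. sobolev u G \<and> nsq u = m \<and> nsq G = l\<^sup>2 * B
       \<and> (\<forall>x::'a. norm x > max R 1 / l \<longrightarrow> u x = 0) \<and> (\<forall>x. norm x \<le> a / 2 / l \<longrightarrow> \<eta> * l ^ DIM('a) \<le> (u x)\<^sup>2)"
    proof (intro allI impI)
      fix l :: real assume l: "l > 0"
      define c where "c = sqrt (m * l ^ DIM('a) / A)"
      have c2: "c\<^sup>2 = m * l ^ DIM('a) / A" using m A l by (simp add: c_def)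
      let ?u = "\<lambda>x. c * \<phi> (l *\<^sub>R x)" and ?G = "\<lambda>x. c *\<^sub>R (l *\<^sub>R D (l *\<^sub>R x))"
      have "sobolev ?u ?G" unfolding D_def by (intro sobolev_cmult sobolev_dilate \<phi> l)
      moreover have "nsq ?u = m"
        unfolding nsq_mult nsq_dilate[OF sobolev_L2(1)[OF s] l] c2 A_def[symmetric] using A l by simp
      moreover have "nsq ?G = l\<^sup>2 * B"
        unfolding nsq_scaleR nsq_dilate[OF sobolev_L2(2)[OF s] l] c2 B_def using l by (simp add: field_simps)
      moreover have "\<forall>x. norm x > max R 1 / l \<longrightarrow> ?u x = 0"
      proof (intro allI impI)
        fix x :: 'a assume "norm x > max R 1 / l"
        hence "norm (l *\<^sub>R x) > R" using l by (simp add: field_simps)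
        thus "?u x = 0" using R by simp
      qed
      moreover have "\<forall>x. norm x \<le> a / 2 / l \<longrightarrow> \<eta> * l ^ DIM('a) \<le> (?u x)\<^sup>2"
      proof (intro allI impI)
        fix x :: 'a assume "norm x \<le> a / 2 / l"
        hence "norm (l *\<^sub>R x) \<le> a / 2" using l by (simp add: field_simps)
        hence "(\<phi> 0 / 2)\<^sup>2 \<le> (\<phi> (l *\<^sub>R x))\<^sup>2" using \<phi>a \<phi>0 by (intro power_mono) auto
        hence "c\<^sup>2 * (\<phi> 0 / 2)\<^sup>2 \<le> c\<^sup>2 * (\<phi> (l *\<^sub>R x))\<^sup>2" by (rule mult_left_mono) simp
        thus "\<eta> * l ^ DIM('a) \<le> (?u x)\<^sup>2" unfolding power_mult_distrib c2 \<eta>_def by (simp add: mult_ac)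
      qed
      ultimately show "\<exists>u G. sobolev u G \<and> nsq u = m \<and> nsq G = l\<^sup>2 * B
         \<and> (\<forall>x::'a. norm x > max R 1 / l \<longrightarrow> u x = 0) \<and> (\<forall>x. norm x \<le> a / 2 / l \<longrightarrow> \<eta> * l ^ DIM('a) \<le> (u x)\<^sup>2)"
        by blast
    qed
  qed
qed

section \<open>Lower bounds for the interaction\<close>

text \<open>The preimage of a null set under the difference map is null, since each of its sections
  is a reflected translate of that null set. Almost everywhere statements on the potential thus pass
  to the double integral.\<close>

lemma AE_lborel_pair_diff:
  assumes "AE x in lborel. P (x :: 'a::euclidean_space)"
  shows "AE p in lborel \<Otimes>\<^sub>M lborel. P (fst p - snd p)"
proof -
  obtain N where N: "N \<in> null_sets lborel" "{x \<in> space lborel. \<not> P x} \<subseteq> N" using assms by (rule AE_E3) (use that in auto)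
  have [measurable]: "N \<in> sets borel" using N(1) by auto
  have "emeasure (lborel \<Otimes>\<^sub>M lborel) {p \<in> space (lborel \<Otimes>\<^sub>M lborel). fst p - snd p \<in> N}
      = (\<integral>\<^sup>+p. indicator N (fst p - snd p) \<partial>(lborel \<Otimes>\<^sub>M lborel))"
    by (subst nn_integral_indicator[symmetric], measurable) (auto intro!: nn_integral_cong simp: indicator_def space_pair_measure)
  also have "\<dots> = (\<integral>\<^sup>+x. (\<integral>\<^sup>+y. indicator N (x - y) \<partial>lborel) \<partial>(lborel :: 'a measure))"
    by (subst lborel.nn_integral_fst[symmetric]) auto
  also have "\<dots> = 0"
    using N(1) nn_integral_reflect[of "indicator N"] by (simp add: null_sets_def)
  finally have 0: "emeasure (lborel \<Otimes>\<^sub>M lborel) {p \<in> space (lborel \<Otimes>\<^sub>M lborel). fst p - snd p \<in> N} = 0" .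
  have "{p \<in> space (lborel \<Otimes>\<^sub>M lborel). fst p - snd p \<in> N} \<in> sets (lborel \<Otimes>\<^sub>M lborel)" by measurable
  with 0 have "AE p in lborel \<Otimes>\<^sub>M lborel. fst p - snd p \<notin> N"
    by (intro AE_iff_measurable[THEN iffD2]) auto
  thus ?thesis by eventually_elim (use N(2) in auto)
qed

lemma interaction_integrable_sobolev:
  fixes W :: "'a::euclidean_space \<Rightarrow> real"
  assumes d: "DIM('a) \<in> {1, 2, 3}" and W: "admissible W" and s: "sobolev u G"
  shows "integrable (lborel \<Otimes>\<^sub>M lborel) (\<lambda>(x, y). (u x)\<^sup>2 * W (x - y) * (u y)\<^sup>2)"
proof -
  obtain n where "abs_interaction (\<lambda>x. W x - truncation n W x) u \<le> ennreal (1 * nsq u * (nsq u + nsq G))"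
    using abs_interaction_truncation_small[OF d W, of 1] s by auto
  from interaction_truncation_split(2)[OF admissible_measurable[OF W] sobolev_L2(1)[OF s] this] show ?thesis by simp
qed

text \<open>Two points of the support differ by at most 2 r0 / 3 < r0, so only values of W in the
  ball where it is bounded below enter.\<close>

lemma interaction_concentrated_ge:
  fixes W :: "'a::euclidean_space \<Rightarrow> real"
  assumes d: "DIM('a) \<in> {1, 2, 3}" and W: "admissible W" and s: "sobolev u G"
    and pos: "AE x in lborel. x \<in> ball 0 r0 \<longrightarrow> c \<le> W x" and supp: "\<And>x. norm x > r0 / 3 \<Longrightarrow> u x = 0" and r0: "r0 > 0"
  shows "c * (nsq u)\<^sup>2 \<le> interaction W u"
proof -
  have ui: "integrable lborel (\<lambda>x. (u x)\<^sup>2)" using L2_integrable[OF sobolev_L2(1)[OF s]] by simp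
  have "c * (nsq u)\<^sup>2 = (\<integral>p. c * (case p of (x, y) \<Rightarrow> (u x)\<^sup>2 * (u y)\<^sup>2) \<partial>(lborel \<Otimes>\<^sub>M lborel))"
    using integral_product(2)[OF ui ui] by (simp add: nsq_def power2_eq_square)
  also have "\<dots> \<le> interaction W u"
    unfolding interaction_def
  proof (rule integral_mono_AE)
    show "integrable (lborel \<Otimes>\<^sub>M lborel) (\<lambda>p. c * (case p of (x, y) \<Rightarrow> (u x)\<^sup>2 * (u y)\<^sup>2))"
      by (rule integrable_mult_right[OF integral_product(1)[OF ui ui]])
    show "integrable (lborel \<Otimes>\<^sub>M lborel) (\<lambda>(x, y). (u x)\<^sup>2 * W (x - y) * (u y)\<^sup>2)"
      by (rule interaction_integrable_sobolev[OF d W s])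
    show "AE p in lborel \<Otimes>\<^sub>M lborel. c * (case p of (x, y) \<Rightarrow> (u x)\<^sup>2 * (u y)\<^sup>2) \<le> (case p of (x, y) \<Rightarrow> (u x)\<^sup>2 * W (x - y) * (u y)\<^sup>2)"
      using AE_lborel_pair_diff[OF pos]
    proof eventually_elim
      fix p :: "'a \<times> 'a" assume H: "fst p - snd p \<in> ball 0 r0 \<longrightarrow> c \<le> W (fst p - snd p)"
      obtain x y where p: "p = (x, y)" by force
      show "c * (case p of (x, y) \<Rightarrow> (u x)\<^sup>2 * (u y)\<^sup>2) \<le> (case p of (x, y) \<Rightarrow> (u x)\<^sup>2 * W (x - y) * (u y)\<^sup>2)"
      proof (cases "u x = 0 \<or> u y = 0")
        case False
        hence "norm x \<le> r0 / 3" "norm y \<le> r0 / 3" using supp[of x] supp[of y] by (auto simp: not_less[symmetric])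
        hence "norm (x - y) < r0" using norm_triangle_ineq4[of x y] r0 by linarith
        hence "c \<le> W (x - y)" using H by (simp add: p)
        hence "c * ((u x)\<^sup>2 * (u y)\<^sup>2) \<le> W (x - y) * ((u x)\<^sup>2 * (u y)\<^sup>2)" by (rule mult_right_mono) simp
        thus ?thesis by (simp add: p mult_ac)
      qed (auto simp: p)
    qed
  qed
  finally show ?thesis .
qed

text \<open>For nonnegative W the integral may be restricted to |x| <= \<rho> and |x - y| <=
  \<sigma>. As \<sigma> <= \<rho>, both points then lie in the ball of radius 2 \<rho>, where the
  square of u is at least t. The volume of the region is the product of two ball volumes.\<close>

lemma interaction_spread_ge:
  fixes W :: "'a::euclidean_space \<Rightarrow> real"
  assumes d: "DIM('a) \<in> {1, 2, 3}" and W: "admissible W" and s: "sobolev u G"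
    and nonneg: "AE x in lborel. 0 \<le> W x" and pos: "AE x in lborel. x \<in> ball 0 r0 \<longrightarrow> c \<le> W x" and c: "c > 0"
    and low: "\<And>x. norm x \<le> 2 * \<rho> \<Longrightarrow> t \<le> (u x)\<^sup>2" and t: "t \<ge> 0" and \<sigma>: "0 < \<sigma>" "\<sigma> < r0" "\<sigma> \<le> \<rho>"
  shows "c * t\<^sup>2 * (measure lborel (cball (0::'a) \<rho>) * measure lborel (cball (0::'a) \<sigma>)) \<le> interaction W u"
proof -
  let ?f = "\<lambda>(x, y). (u x)\<^sup>2 * W (x - y) * (u y)\<^sup>2"
  note Wm [measurable] = admissible_measurable[OF W] L2_measurable[OF sobolev_L2(1)[OF s]]
  have [measurable]: "cball z q \<in> sets (borel :: 'a measure)" for z q by simp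
  have ae: "AE p in lborel \<Otimes>\<^sub>M lborel. 0 \<le> W (fst p - snd p) \<and> (fst p - snd p \<in> ball 0 r0 \<longrightarrow> c \<le> W (fst p - snd p))"
    using AE_lborel_pair_diff[OF nonneg] AE_lborel_pair_diff[OF pos] by eventually_elim simp
  have "ennreal (c * t\<^sup>2 * (measure lborel (cball (0::'a) \<rho>) * measure lborel (cball (0::'a) \<sigma>)))
      = ennreal (c * t\<^sup>2) * (ennreal (measure lborel (cball (0::'a) \<rho>)) * ennreal (measure lborel (cball (0::'a) \<sigma>)))"
    using c by (simp add: ennreal_mult)
  also have "\<dots> = ennreal (c * t\<^sup>2) * (emeasure lborel (cball (0::'a) \<rho>) * emeasure lborel (cball (0::'a) \<sigma>))"
  proof -
    have "emeasure lborel (cball (0::'a) r) = ennreal (measure lborel (cball (0::'a) r))" for r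
      using emeasure_lborel_cball_finite[of "0::'a" r] by (intro emeasure_eq_ennreal_measure) auto
    thus ?thesis by (simp only:)
  qed
  also have "\<dots> = (\<integral>\<^sup>+x. ennreal (c * t\<^sup>2) * indicator (cball (0::'a) \<rho>) x \<partial>lborel) * (\<integral>\<^sup>+x. indicator (cball (0::'a) \<sigma>) x \<partial>lborel)"
    by (simp add: nn_integral_cmult mult.assoc)
  also have "\<dots> = (\<integral>\<^sup>+x. (\<integral>\<^sup>+y. (ennreal (c * t\<^sup>2) * indicator (cball (0::'a) \<rho>) x) * indicator (cball (0::'a) \<sigma>) (x - y) \<partial>lborel) \<partial>lborel)"
    by (rule convolution_left[symmetric]) measurable
  also have "\<dots> = (\<integral>\<^sup>+p. (case p of (x, y) \<Rightarrow> (ennreal (c * t\<^sup>2) * indicator (cball (0::'a) \<rho>) x) * indicator (cball (0::'a) \<sigma>) (x - y)) \<partial>(lborel \<Otimes>\<^sub>M lborel))"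
    by (subst lborel.nn_integral_fst[symmetric]) auto
  also have "\<dots> \<le> (\<integral>\<^sup>+p. ennreal (?f p) \<partial>(lborel \<Otimes>\<^sub>M lborel))"
  proof (rule nn_integral_mono_AE)
    show "AE p in lborel \<Otimes>\<^sub>M lborel. (case p of (x, y) \<Rightarrow> (ennreal (c * t\<^sup>2) * indicator (cball (0::'a) \<rho>) x) * indicator (cball (0::'a) \<sigma>) (x - y)) \<le> ennreal (?f p)"
      using ae
    proof eventually_elim
      fix p :: "'a \<times> 'a" assume H: "0 \<le> W (fst p - snd p) \<and> (fst p - snd p \<in> ball 0 r0 \<longrightarrow> c \<le> W (fst p - snd p))"
      obtain x y where p: "p = (x, y)" by force
      have "c * t\<^sup>2 \<le> ?f p" if "norm x \<le> \<rho>" "norm (x - y) \<le> \<sigma>"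
      proof -
        have "norm y \<le> norm x + norm (x - y)" using norm_triangle_ineq4[of x "x - y"] by simp
        hence "norm x \<le> 2 * \<rho>" "norm y \<le> 2 * \<rho>" using that \<sigma> by linarith+
        hence "t * c * t \<le> (u x)\<^sup>2 * W (x - y) * (u y)\<^sup>2"
          using H that \<sigma> t c by (intro mult_mono low mult_nonneg_nonneg) (auto simp: p)
        thus ?thesis by (simp add: p power2_eq_square mult_ac)
      qed
      thus "(case p of (x, y) \<Rightarrow> (ennreal (c * t\<^sup>2) * indicator (cball (0::'a) \<rho>) x) * indicator (cball (0::'a) \<sigma>) (x - y)) \<le> ennreal (?f p)"
        unfolding p by (cases "norm x \<le> \<rho> \<and> norm (x - y) \<le> \<sigma>") (auto intro!: ennreal_leI simp: p)
    qed
  qed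
  also have "\<dots> = ennreal (interaction W u)"
    unfolding interaction_def
    by (rule nn_integral_eq_integral[OF interaction_integrable_sobolev[OF d W s]])
      (use ae in \<open>eventually_elim, auto simp: case_prod_unfold\<close>)
  finally have le: "ennreal (c * t\<^sup>2 * (measure lborel (cball (0::'a) \<rho>) * measure lborel (cball (0::'a) \<sigma>))) \<le> ennreal (interaction W u)" .
  have "0 \<le> interaction W u" unfolding interaction_def
    by (rule integral_nonneg_AE) (use ae in \<open>eventually_elim, auto simp: case_prod_unfold\<close>)
  with le show ?thesis by simp
qed

text \<open>With zero gradient, u agrees almost everywhere with its averages over balls of all radii
  n + 1, and these tend to 0 because their squares are at most \<open>nsq u\<close> divided by the
  volume of the ball.\<close>

lemma sobolev_zero_gradient:
  fixes u :: "'a::euclidean_space \<Rightarrow> real"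
  assumes s: "sobolev u G" and 0: "nsq G = 0"
  shows "nsq u = 0"
proof -
  note u = sobolev_L2(1)[OF s]
  let ?B = "\<lambda>n. measure lborel (cball (0::'a) (real (Suc n)))"
  have "AE x in lborel. \<forall>n. u x = ball_average (real (Suc n)) u x"
    unfolding AE_all_countable
  proof
    fix n
    have "nsq (\<lambda>x. u x - ball_average (real (Suc n)) u x) = 0"
      using ball_average_approx(2)[OF _ s, of "real (Suc n)"] unfolding 0 by (intro order_antisym) simp_all
    thus "AE x in lborel. u x = ball_average (real (Suc n)) u x"
      using nsq_eq_0_iff[OF ball_average_approx(1)[OF _ s, of "real (Suc n)"]] by simp
  qed
  hence "AE x in lborel. u x = 0"
  proof eventually_elim
    fix x assume eq: "\<forall>n. u x = ball_average (real (Suc n)) u x"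
    have w: "unit_ball_vol (real DIM('a)) > 0" by simp
    have "(u x)\<^sup>2 \<le> nsq u / unit_ball_vol (real DIM('a)) * (1 / real (Suc n))" for n
    proof -
      have "(u x)\<^sup>2 \<le> nsq u / ?B n" using ball_average_square_le[OF _ u, of "real (Suc n)" x] eq by simp
      also have "?B n = unit_ball_vol (real DIM('a)) * real (Suc n) ^ DIM('a)" by (rule content_cball) simp
      also have "nsq u / \<dots> \<le> nsq u / (unit_ball_vol (real DIM('a)) * real (Suc n) ^ 1)"
        using w by (intro divide_left_mono mult_left_mono power_increasing mult_pos_pos zero_less_power) (auto simp: Suc_leI)
      finally show ?thesis by simp
    qed
    moreover have "(\<lambda>n. nsq u / unit_ball_vol (real DIM('a)) * (1 / real (Suc n))) \<longlonglongrightarrow> nsq u / unit_ball_vol (real DIM('a)) * 0"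
      by (intro tendsto_intros LIMSEQ_Suc lim_1_over_n)
    ultimately have "(u x)\<^sup>2 \<le> nsq u / unit_ball_vol (real DIM('a)) * 0"
      using LIMSEQ_le_const by blast
    thus "u x = 0" by simp
  qed
  thus ?thesis using nsq_eq_0_iff[OF u] by simp
qed

section \<open>The critical coupling\<close>

definition negative_energy :: "('a::euclidean_space \<Rightarrow> real) \<Rightarrow> real \<Rightarrow> real \<Rightarrow> bool" where
  "negative_energy W m g \<longleftrightarrow> (\<exists>u G. sobolev u G \<and> nsq u = m \<and> pair_energy W g u G < 0)"

text \<open>Negative energy forces a positive interaction, so a larger coupling lowers the energy of
  the same function further.\<close>

lemma negative_energy_mono:
  assumes "negative_energy W m g" "0 < g" "g \<le> g'"
  shows "negative_energy W m g'"
proof -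
  obtain u G where u: "sobolev u G" "nsq u = m" "pair_energy W g u G < 0" using assms by (auto simp: negative_energy_def)
  have "2 * nsq G < g * interaction W u" using u(3) by (simp add: pair_energy_def)
  hence "0 < g * interaction W u" using nsq_nonneg[of G] by linarith
  hence "0 < interaction W u" using assms(2) by (simp add: zero_less_mult_iff)
  hence "g / 4 * interaction W u \<le> g' / 4 * interaction W u" using assms(3) by (intro mult_right_mono) auto
  hence "pair_energy W g' u G < 0" using u(3) by (simp add: pair_energy_def)
  with u show ?thesis by (auto simp: negative_energy_def)
qed

text \<open>The energy of a fixed pair is continuous in the coupling. Hence no coupling with
  negative energy is minimal, which gives the strict inequality in the characterization by the
  critical coupling.\<close>

lemma negative_energy_open:
  assumes "negative_energy W m g" "0 < g"
  obtains g' where "0 < g'" "g' < g" "negative_energy W m g'"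
proof -
  obtain u G where u: "sobolev u G" "nsq u = m" "pair_energy W g u G < 0" using assms by (auto simp: negative_energy_def)
  have "((\<lambda>h. pair_energy W h u G) \<longlongrightarrow> pair_energy W g u G) (at_left g)" unfolding pair_energy_def by (intro tendsto_intros) auto
  hence "\<forall>\<^sub>F h in at_left g. pair_energy W h u G < 0" using u(3) by (intro order_tendstoD(2))
  moreover have "\<forall>\<^sub>F h in at_left g. 0 < h \<and> h < g"
    using assms(2) by (auto simp: eventually_at_left intro!: exI[of _ 0])
  ultimately have "\<forall>\<^sub>F h in at_left g. pair_energy W h u G < 0 \<and> 0 < h \<and> h < g" by eventually_elim simp
  then obtain h where "pair_energy W h u G < 0" "0 < h" "h < g"
    using eventually_happens[of _ "at_left g"] trivial_limit_at_left_real by blast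
  with u that show ?thesis by (auto simp: negative_energy_def)
qed

theorem critical_coupling:
  fixes W :: "'a::euclidean_space \<Rightarrow> real"
  assumes d: "DIM('a) \<in> {1, 2, 3}" and W: "admissible W" and m: "m > 0"
    and nonneg: "DIM('a) = 1 \<Longrightarrow> AE x in lborel. 0 \<le> W x"
    and r0: "r0 > 0" and c: "c > 0" and pos: "AE x in lborel. x \<in> ball 0 r0 \<longrightarrow> c \<le> W x"
  shows "\<exists>gstar\<ge>0. (DIM('a) = 1 \<longrightarrow> gstar = 0) \<and> (DIM('a) \<in> {2, 3} \<longrightarrow> gstar > 0) \<and>
    (\<forall>g>0. negative_energy W m g \<longleftrightarrow> g > gstar) \<and>
    (\<forall>g. 0 < g \<and> g < gstar \<longrightarrow> \<not> (\<exists>u G. sobolev u G \<and> nsq u = m \<and>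
       (\<forall>v H. sobolev v H \<longrightarrow> nsq v = m \<longrightarrow> pair_energy W g u G \<le> pair_energy W g v H)))"
proof -
  obtain R a \<eta> B where tr: "R > 0" "a > 0" "\<eta> > 0"
    "\<forall>l>0. \<exists>u G. sobolev u G \<and> nsq u = m \<and> nsq G = l\<^sup>2 * B
       \<and> (\<forall>x::'a. norm x > R / l \<longrightarrow> u x = 0) \<and> (\<forall>x. norm x \<le> a / l \<longrightarrow> \<eta> * l ^ DIM('a) \<le> (u x)\<^sup>2)"
    by (rule trial_functions[OF m, where 'a='a])
  define P where "P = {g. 0 < g \<and> negative_energy W m g}"
  define gstar where "gstar = Inf P"
  have ne: "P \<noteq> {}"
  proof -
    \<comment> \<open>Makes the support radius R / l equal to r0 / 3.\<close>
    define l where "l = 3 * R / r0"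
    have l: "l > 0" "R / l = r0 / 3" using tr(1) r0 by (auto simp: l_def)
    obtain u :: "'a \<Rightarrow> real" and G where u: "sobolev u G" "nsq u = m" "\<forall>x. norm x > R / l \<longrightarrow> u x = 0" using tr(4) l(1) by blast
    have "c * m\<^sup>2 \<le> interaction W u"
      using interaction_concentrated_ge[OF d W u(1) pos _ r0] u l by simp
    moreover have "c * m\<^sup>2 > 0" using c m by simp
    ultimately have I: "interaction W u > 0" by linarith
    \<comment> \<open>With this coupling the energy is exactly -1.\<close>
    define g where "g = (2 * nsq G + 4) / interaction W u"
    have "g > 0" using I nsq_nonneg[of G] unfolding g_def by (intro divide_pos_pos) linarith+
    moreover have "pair_energy W g u G < 0" using I nsq_nonneg[of G] by (simp add: pair_energy_def g_def)
    ultimately show ?thesis using u by (auto simp: P_def negative_energy_def)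
  qed
  have bdd: "bdd_below P" by (rule bdd_belowI[of _ 0]) (auto simp: P_def)
  have g0: "gstar \<ge> 0" unfolding gstar_def by (rule cInf_greatest[OF ne]) (auto simp: P_def)
  have iff: "negative_energy W m g \<longleftrightarrow> g > gstar" if g: "g > 0" for g
  proof
    assume "negative_energy W m g"
    then obtain g' where "0 < g'" "g' < g" "negative_energy W m g'" using negative_energy_open g by blast
    hence "gstar \<le> g'" unfolding gstar_def by (intro cInf_lower[OF _ bdd]) (auto simp: P_def)
    thus "g > gstar" using \<open>g' < g\<close> by linarith
  next
    assume "g > gstar"
    then obtain g' where "g' \<in> P" "g' < g" unfolding gstar_def using cInf_less_iff[OF ne bdd] by blast
    thus "negative_energy W m g" using negative_energy_mono[of W m g' g] by (auto simp: P_def)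
  qed
  have one: "gstar = 0" if d1: "DIM('a) = 1"
  proof (rule ccontr)
    assume "gstar \<noteq> 0"
    hence gp: "gstar > 0" using g0 by linarith
    define \<omega> where "\<omega> = unit_ball_vol (real DIM('a))"
    have \<omega>: "\<omega> > 0" unfolding \<omega>_def by simp
    define \<sigma> where "\<sigma> = r0 / 2"
    \<comment> \<open>The interaction of the trial function will be at least k l: its squared
      density is of order l^2, and the ball of radius a / (2 l) has volume of order 1 / l.\<close>
    define k where "k = c * \<eta>\<^sup>2 * (\<omega> * (a / 2)) * (\<omega> * \<sigma>)"
    have k: "k > 0" using c tr \<omega> r0 by (simp add: k_def \<sigma>_def)
    \<comment> \<open>The first entry makes \<sigma> at most half the plateau radius a / l. The
      second makes the gradient term, of order l^2, smaller than the interaction term, of order l,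
      at the coupling gstar.\<close>
    define l where "l = min (a / (2 * \<sigma>)) (gstar * k / (4 * (\<bar>B\<bar> + 1)))"
    have l: "l > 0" unfolding l_def using tr r0 gp k by (auto simp: \<sigma>_def intro!: divide_pos_pos mult_pos_pos)
    have l1: "\<sigma> \<le> a / l / 2"
    proof -
      have "l \<le> a / (2 * \<sigma>)" by (simp add: l_def)
      thus ?thesis using l r0 unfolding \<sigma>_def by (simp add: field_simps)
    qed
    have l2: "l * (\<bar>B\<bar> + 1) \<le> gstar * k / 4"
    proof -
      have "l \<le> gstar * k / (4 * (\<bar>B\<bar> + 1))" by (simp add: l_def)
      thus ?thesis by (simp add: field_simps)
    qed
    obtain u :: "'a \<Rightarrow> real" and G where u: "sobolev u G" "nsq u = m" "nsq G = l\<^sup>2 * B" "\<forall>x. norm x \<le> a / l \<longrightarrow> \<eta> * l ^ DIM('a) \<le> (u x)\<^sup>2"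
      using tr(4) l by blast
    have "c * (\<eta> * l)\<^sup>2 * (measure lborel (cball (0::'a) (a / l / 2)) * measure lborel (cball (0::'a) \<sigma>)) \<le> interaction W u"
      by (rule interaction_spread_ge[OF d W u(1) nonneg[OF d1] pos c]) (use u(4) d1 l tr(3) l1 r0 in \<open>auto simp: \<sigma>_def\<close>)
    also have "measure lborel (cball (0::'a) (a / l / 2)) = \<omega> * (a / l / 2)"
      unfolding \<omega>_def using content_cball[of "a / l / 2" "0::'a"] d1 l tr(2) by simp
    also have "measure lborel (cball (0::'a) \<sigma>) = \<omega> * \<sigma>"
      unfolding \<omega>_def using content_cball[of \<sigma> "0::'a"] d1 r0 by (simp add: \<sigma>_def)
    also have "c * (\<eta> * l)\<^sup>2 * (\<omega> * (a / l / 2) * (\<omega> * \<sigma>)) = k * l"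
      unfolding k_def using l by (simp add: power2_eq_square field_simps)
    finally have I: "k * l \<le> interaction W u" .
    have "nsq G = l * (l * B)" using u(3) by (simp add: power2_eq_square)
    also have "l * (l * B) < l * (l * (\<bar>B\<bar> + 1))" using l by (intro mult_strict_left_mono) auto
    also have "\<dots> \<le> l * (gstar * k / 4)" using l l2 by (intro mult_left_mono) auto
    finally have "nsq G < l * (gstar * k / 4)" .
    moreover have "gstar / 4 * (k * l) \<le> gstar / 4 * interaction W u" using I gp by (intro mult_left_mono) auto
    moreover have "gstar / 4 * (k * l) = l * (gstar * k / 4)" by simp
    ultimately have "nsq G < gstar / 4 * interaction W u" by linarith
    hence "pair_energy W gstar u G < 0" using nsq_nonneg[of G] unfolding pair_energy_def by linarith
    hence "negative_energy W m gstar" using u by (auto simp: negative_energy_def)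
    with iff[OF gp] show False by simp
  qed
  have two: "gstar > 0" if d23: "DIM('a) \<in> {2, 3}"
  proof -
    obtain C where C: "C > 0" "\<And>u G. sobolev u G \<Longrightarrow> abs_interaction W u \<le> ennreal (C * nsq u * nsq G)"
      using abs_interaction_bound[OF d23 W] by blast
    \<comment> \<open>At smaller couplings the kinetic term \<open>nsq G / 2\<close> absorbs g / 4
      times the interaction bound \<open>C * m * nsq G\<close>.\<close>
    have "2 / (C * m) \<le> g" if gP: "g \<in> P" for g
    proof (rule ccontr)
      assume lt: "\<not> 2 / (C * m) \<le> g"
      obtain u G where u: "sobolev u G" "nsq u = m" "pair_energy W g u G < 0" and g: "g > 0"
        using gP by (auto simp: P_def negative_energy_def)
      have "\<bar>interaction W u\<bar> \<le> C * nsq u * nsq G"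
        using interaction_integrable(2)[OF admissible_measurable[OF W] L2_measurable[OF sobolev_L2(1)[OF u(1)]] C(2)[OF u(1)]] C(1) by simp
      hence "g * interaction W u \<le> g * (C * m * nsq G)" using g u(2) by (intro mult_left_mono) auto
      also have "\<dots> = (g * (C * m)) * nsq G" by simp
      also have "\<dots> \<le> 2 * nsq G" using lt C(1) m by (intro mult_right_mono) (auto simp: field_simps)
      finally show False using u(3) by (simp add: pair_energy_def)
    qed
    hence "2 / (C * m) \<le> gstar" unfolding gstar_def by (intro cInf_greatest[OF ne])
    moreover have "2 / (C * m) > 0" using C(1) m by simp
    ultimately show ?thesis by linarith
  qed
  have nomin: False if g: "0 < g" "g < gstar" and u: "sobolev u G" "nsq u = m"
    and min: "\<And>v H. sobolev v H \<Longrightarrow> nsq v = m \<Longrightarrow> pair_energy W g u G \<le> pair_energy W g v H" for g u G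
  proof -
    \<comment> \<open>In dimension one gstar = 0 leaves no such g.\<close>
    have d23: "DIM('a) \<in> {2, 3}" using d one g by auto
    obtain C where C: "C > 0" "\<And>u G. sobolev u G \<Longrightarrow> abs_interaction W u \<le> ennreal (C * nsq u * nsq G)"
      using abs_interaction_bound[OF d23 W] by blast
    \<comment> \<open>Along dilations with l = 1 / (n + 1) the gradient term tends to 0 and, by the
      interaction bound, so does the energy; a minimizer therefore has energy at most 0.\<close>
    have up: "pair_energy W g u G \<le> (1 + g * C * m) * B * (1 / real (Suc n))" for n
    proof -
      define l where "l = 1 / real (Suc n)"
      have l: "0 < l" "l \<le> 1" by (auto simp: l_def)
      obtain v :: "'a \<Rightarrow> real" and H where v: "sobolev v H" "nsq v = m" "nsq H = l\<^sup>2 * B" using tr(4) l(1) by blast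
      have hB: "nsq H \<le> B * l"
      proof -
        have "0 \<le> l\<^sup>2 * B" using v(3) nsq_nonneg[of H] by simp
        hence "B \<ge> 0" using l by (simp add: zero_le_mult_iff)
        hence "B * (l * l) \<le> B * (l * 1)" using l by (intro mult_left_mono) auto
        thus ?thesis using v(3) by (simp add: power2_eq_square mult_ac)
      qed
      have "\<bar>interaction W v\<bar> \<le> C * nsq v * nsq H"
        using interaction_integrable(2)[OF admissible_measurable[OF W] L2_measurable[OF sobolev_L2(1)[OF v(1)]] C(2)[OF v(1)]] C(1) by simp
      hence "g * (- interaction W v) \<le> g * (C * m * nsq H)" using g v(2) by (intro mult_left_mono) auto
      moreover have "0 \<le> g * (C * m * nsq H)" using g C(1) m by simp
      moreover have "1 / 2 * h - g / 4 * i \<le> h + X" if "g * (- i) \<le> X" "0 \<le> X" "0 \<le> h" for h i X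
      proof -
        have "g / 4 * i = (g * i) / 4" "g * (- i) = - (g * i)" by simp_all
        thus ?thesis using that by linarith
      qed
      ultimately have "pair_energy W g v H \<le> nsq H + g * (C * m * nsq H)"
        unfolding pair_energy_def using nsq_nonneg[of H] by blast
      also have "\<dots> = (1 + g * C * m) * nsq H" by (simp add: algebra_simps)
      also have "\<dots> \<le> (1 + g * C * m) * (B * l)"
        using hB g C(1) m by (intro mult_left_mono add_nonneg_nonneg mult_nonneg_nonneg) auto
      finally have "pair_energy W g v H \<le> (1 + g * C * m) * (B * l)" .
      thus ?thesis using min[OF v(1,2)] by (simp add: l_def)
    qed
    have "(\<lambda>n. (1 + g * C * m) * B * (1 / real (Suc n))) \<longlonglongrightarrow> (1 + g * C * m) * B * 0"
      by (intro tendsto_intros LIMSEQ_Suc lim_1_over_n)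
    hence "pair_energy W g u G \<le> (1 + g * C * m) * B * 0" using up LIMSEQ_le_const by blast
    moreover have "\<not> pair_energy W g u G < 0" using iff[OF g(1)] g(2) u by (auto simp: negative_energy_def)
    ultimately have E: "pair_energy W g u G = 0" by simp
    have "nsq G \<noteq> 0" using sobolev_zero_gradient[OF u(1)] u(2) m by auto
    hence G: "nsq G > 0" using nsq_nonneg[of G] by linarith
    hence "g * interaction W u > 0" using E by (simp add: pair_energy_def)
    hence I: "interaction W u > 0" using g(1) by (simp add: zero_less_mult_iff)
    define h where "h = (g + gstar) / 2"
    have h: "g < h" "h < gstar" using g by (auto simp: h_def)
    have "g / 4 * interaction W u < h / 4 * interaction W u" using h I by (intro mult_strict_right_mono) auto
    hence "pair_energy W h u G < 0" using E by (simp add: pair_energy_def)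
    hence "negative_energy W m h" using u by (auto simp: negative_energy_def)
    thus False using iff[of h] h g by simp
  qed
  show ?thesis
  proof (intro exI[of _ gstar] conjI impI allI g0 one two)
    fix g :: real assume "0 < g"
    thus "negative_energy W m g = (gstar < g)" by (rule iff)
  next
    fix g assume "0 < g \<and> g < gstar"
    thus "\<not> (\<exists>u G. sobolev u G \<and> nsq u = m \<and> (\<forall>v H. sobolev v H \<longrightarrow> nsq v = m \<longrightarrow> pair_energy W g u G \<le> pair_energy W g v H))"
      using nomin by blast
  qed
qed

section \<open>Lebesgue measurable representatives\<close>

lemma lebesgue_AE_iff: "(AE x in lebesgue. P x) \<longleftrightarrow> (AE x in lborel. P x)"
  by (rule AE_completion_iff)

lemma lebesgue_borel_representative:
  fixes f :: "'a::euclidean_space \<Rightarrow> real"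
  assumes "f \<in> borel_measurable lebesgue"
  obtains g where "g \<in> borel_measurable borel" "AE x in lborel. f x = g x"
  using completion_ex_borel_measurable_real[OF assms] by auto

lemma lebesgue_integral_eq_lborel:
  fixes f g :: "'a::euclidean_space \<Rightarrow> real"
  assumes g: "g \<in> borel_measurable borel" and ae: "AE x in lborel. f x = g x"
  shows "f \<in> borel_measurable lebesgue" "integrable lebesgue f \<longleftrightarrow> integrable lborel g"
    "integral\<^sup>L lebesgue f = integral\<^sup>L lborel g"
proof -
  have gl: "g \<in> borel_measurable lebesgue" using g by (simp add: measurable_completion)
  show fl: "f \<in> borel_measurable lebesgue"
    by (rule borel_measurable_AE[OF gl]) (use ae in \<open>simp add: lebesgue_AE_iff eq_commute\<close>)
  have ae': "AE x in lebesgue. f x = g x" using ae by (simp add: lebesgue_AE_iff)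
  show "integrable lebesgue f \<longleftrightarrow> integrable lborel g"
    using integrable_cong_AE[OF fl gl ae'] integrable_completion[of g lborel] g by simp
  show "integral\<^sup>L lebesgue f = integral\<^sup>L lborel g"
    using integral_cong_AE[OF fl gl ae'] integral_completion[of g lborel] g by simp
qed

lemma Lp_space_2_iff:
  "v \<in> Lp_space (ereal 2) \<longleftrightarrow> v \<in> borel_measurable lebesgue \<and> integrable lebesgue (\<lambda>x. (v x)\<^sup>2)"
proof -
  have "\<bar>v x\<bar> powr 2 = (v x)\<^sup>2" for x by (cases "v x = 0") (auto simp: powr_numeral)
  thus ?thesis unfolding Lp_space_def by simp
qed

lemma Lp_norm_2: "(Lp_norm 2 v)\<^sup>2 = (LINT x|lebesgue. (v x)\<^sup>2)"
proof -
  have "\<bar>v x\<bar> powr 2 = (v x)\<^sup>2" for x by (cases "v x = 0") (auto simp: powr_numeral)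
  moreover have "(LINT x|lebesgue. (v x)\<^sup>2) \<ge> 0" by simp
  ultimately show ?thesis unfolding Lp_norm_def by (simp add: powr_half_sqrt)
qed

text \<open>Measurability of the gradient is given only for its components, so Borel representatives
  are chosen component by component and reassembled.\<close>

lemma H1_sobolev_representative:
  fixes v :: "'a::euclidean_space \<Rightarrow> real"
  assumes "v \<in> H1"
  obtains u G where "sobolev u G" "AE x in lborel. v x = u x"
proof -
  obtain G0 where v: "v \<in> Lp_space 2" and G0: "has_weak_gradient v G0" and GL: "\<And>b. b \<in> Basis \<Longrightarrow> (\<lambda>x. G0 x \<bullet> b) \<in> Lp_space 2"
    using assms by (auto simp: H1_def)
  obtain u where um [measurable]: "u \<in> borel_measurable borel" and vu: "AE x in lborel. v x = u x"
    using lebesgue_borel_representative v by (auto simp: Lp_space_2_iff)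
  have "\<exists>g. b \<in> Basis \<longrightarrow> g \<in> borel_measurable borel \<and> (AE x in lborel. G0 x \<bullet> b = g x)" for b
    using lebesgue_borel_representative[of "\<lambda>x. G0 x \<bullet> b"] GL[of b] by (auto simp: Lp_space_2_iff)
  then obtain g where gm [measurable]: "\<And>b. b \<in> Basis \<Longrightarrow> g b \<in> borel_measurable borel"
    and g: "\<And>b. b \<in> Basis \<Longrightarrow> AE x in lborel. G0 x \<bullet> b = g b x" by metis
  define G where "G x = (\<Sum>b\<in>Basis. g b x *\<^sub>R b)" for x
  have Gb: "G x \<bullet> b = g b x" if "b \<in> Basis" for b x
    unfolding G_def using that by (simp add: inner_sum_left inner_Basis if_distrib cong: if_cong)
  have uL: "L2 u"
  proof -
    have "AE x in lborel. (v x)\<^sup>2 = (u x)\<^sup>2" using vu by eventually_elim simp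
    from lebesgue_integral_eq_lborel(2)[OF _ this] v show ?thesis by (simp add: L2_def Lp_space_2_iff)
  qed
  have gL: "integrable lborel (\<lambda>x. (g b x)\<^sup>2)" if b: "b \<in> Basis" for b
  proof -
    have "AE x in lborel. (G0 x \<bullet> b)\<^sup>2 = (g b x)\<^sup>2" using g[OF b] by eventually_elim simp
    from lebesgue_integral_eq_lborel(2)[OF _ this] GL[OF b] gm[OF b] show ?thesis by (simp add: Lp_space_2_iff)
  qed
  have nG: "(norm (G x))\<^sup>2 = (\<Sum>b\<in>Basis. (g b x)\<^sup>2)" for x
    unfolding power2_norm_eq_inner using euclidean_inner[of "G x" "G x"] by (simp add: Gb power2_eq_square)
  have GL2: "L2 G"
    unfolding L2_def nG using gL by (auto intro!: Bochner_Integration.integrable_sum simp: G_def[abs_def])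
  have "sobolev u G"
    unfolding sobolev_def
  proof (intro conjI uL GL2 ballI allI impI)
    fix b :: 'a and \<phi> :: "'a \<Rightarrow> real" assume b: "b \<in> Basis" and \<phi>: "test_function \<phi>"
    note [measurable] = cc_measurable[OF test_function_cc[OF \<phi>]] cc_measurable[OF test_function_cc_partial[OF \<phi> b]] gm[OF b]
    have "(\<integral>x. u x * partial_deriv b \<phi> x \<partial>lborel) = (LINT x|lebesgue. v x * partial_deriv b \<phi> x)"
      by (rule lebesgue_integral_eq_lborel(3)[symmetric]) (use vu in \<open>auto elim: eventually_mono\<close>)
    also have "\<dots> = - (LINT x|lebesgue. (G0 x \<bullet> b) * \<phi> x)" using G0 b \<phi> by (auto simp: has_weak_gradient_def)
    also have "(LINT x|lebesgue. (G0 x \<bullet> b) * \<phi> x) = (\<integral>x. g b x * \<phi> x \<partial>lborel)"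
      by (rule lebesgue_integral_eq_lborel(3)) (use g[OF b] in \<open>auto elim: eventually_mono\<close>)
    finally show "(\<integral>x. u x * partial_deriv b \<phi> x \<partial>lborel) = - (\<integral>x. (G x \<bullet> b) * \<phi> x \<partial>lborel)"
      using Gb[OF b] by simp
  qed
  thus ?thesis using vu by (rule that)
qed

text \<open>\<open>locally_integrable\<close> speaks only of restrictions to compact sets;
  measurability of the whole function comes from the limit of its cut-offs by growing balls.\<close>

lemma locally_integrable_representative:
  fixes f :: "'a::euclidean_space \<Rightarrow> real"
  assumes "locally_integrable f"
  obtains g where "g \<in> borel_measurable borel" "AE x in lborel. f x = g x" "\<And>R. integrable lborel (\<lambda>x. indicator (cball 0 R) x * g x)"
proof -
  have i: "integrable lebesgue (\<lambda>x. indicator (cball 0 R) x * f x)" for R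
    using assms unfolding locally_integrable_def set_integrable_def by auto
  have "f \<in> borel_measurable lebesgue"
  proof (rule borel_measurable_LIMSEQ_real)
    show "(\<lambda>x. indicator (cball 0 (real n)) x * f x) \<in> borel_measurable lebesgue" for n
      using i[of "real n"] by (rule borel_measurable_integrable)
    fix x :: 'a
    obtain N where N: "real N \<ge> norm x" using real_arch_simple by blast
    have "\<forall>\<^sub>F n in sequentially. indicator (cball 0 (real n)) x * f x = f x"
      using eventually_ge_at_top[of N]
    proof eventually_elim
      fix n assume "N \<le> n"
      hence "norm x \<le> real n" using N by (meson of_nat_le_iff order_trans)
      thus "indicator (cball 0 (real n)) x * f x = f x" by simp
    qed
    thus "(\<lambda>n. indicator (cball 0 (real n)) x * f x) \<longlonglongrightarrow> f x" by (rule tendsto_eventually)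
  qed
  then obtain g where g: "g \<in> borel_measurable borel" "AE x in lborel. f x = g x"
    by (rule lebesgue_borel_representative)
  note [measurable] = g(1)
  have "integrable lborel (\<lambda>x. indicator (cball 0 R) x * g x)" for R
  proof -
    have m: "(\<lambda>x. indicator (cball 0 R) x * g x) \<in> borel_measurable borel"
      by (intro borel_measurable_times borel_measurable_indicator) (auto simp: g)
    have "AE x in lborel. indicator (cball 0 R) x * f x = indicator (cball 0 R) x * g x"
      using g(2) by eventually_elim simp
    from lebesgue_integral_eq_lborel(2)[OF m this] i show ?thesis by simp
  qed
  with g show ?thesis by (rule that)
qed

text \<open>Two gradients of v have the same integral against every test function, and the
  fundamental lemma applies to each component. Integrals of the chosen \<open>weak_gradient\<close>
  can thus be computed from any gradient at hand.\<close>

lemma weak_gradient_unique: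
  fixes v :: "'a::euclidean_space \<Rightarrow> real"
  assumes "has_weak_gradient v G" "has_weak_gradient v H"
  shows "AE x in lborel. G x = H x"
proof -
  have "AE x in lborel. \<forall>b\<in>Basis. G x \<bullet> b = H x \<bullet> b"
  proof (rule AE_finite_allI)
    fix b :: 'a assume b: "b \<in> Basis"
    obtain g where g: "g \<in> borel_measurable borel" "AE x in lborel. G x \<bullet> b = g x" "\<And>R. integrable lborel (\<lambda>x. indicator (cball 0 R) x * g x)"
      using assms(1) b locally_integrable_representative[of "\<lambda>x. G x \<bullet> b"] by (auto simp: has_weak_gradient_def)
    obtain h where h: "h \<in> borel_measurable borel" "AE x in lborel. H x \<bullet> b = h x" "\<And>R. integrable lborel (\<lambda>x. indicator (cball 0 R) x * h x)"
      using assms(2) b locally_integrable_representative[of "\<lambda>x. H x \<bullet> b"] by (auto simp: has_weak_gradient_def)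
    note [measurable] = g(1) h(1)
    have "AE x in lborel. g x - h x = 0"
    proof (rule AE_eq_0_if_orthogonal_to_test_functions)
      show "(\<lambda>x. g x - h x) \<in> borel_measurable borel" by measurable
      show "integrable lborel (\<lambda>x. indicator (cball 0 R) x * (g x - h x))" for R
        using Bochner_Integration.integrable_diff[OF g(3) h(3), of R R] by (simp add: right_diff_distrib)
      fix \<phi> :: "'a \<Rightarrow> real" assume \<phi>: "test_function \<phi>"
      note [measurable] = cc_measurable[OF test_function_cc[OF \<phi>]]
      obtain R where R: "\<And>x. norm x > R \<Longrightarrow> \<phi> x = 0" using test_function_cc[OF \<phi>] by (auto simp: cc_def)
      obtain M where M: "M > 0" "\<And>x. \<bar>\<phi> x\<bar> \<le> M" using cc_bounded[OF test_function_cc[OF \<phi>]] by blast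
      have ik: "integrable lborel (\<lambda>x. k x * \<phi> x)"
        if [measurable]: "k \<in> borel_measurable borel" and k: "\<And>R. integrable lborel (\<lambda>x. indicator (cball 0 R) x * k x)" for k
      proof (rule Bochner_Integration.integrable_bound[OF integrable_mult_right[OF k[of R], of M]])
        show "AE x in lborel. norm (k x * \<phi> x) \<le> norm (M * (indicator (cball 0 R) x * k x))"
        proof (rule AE_I2)
          fix x
          show "norm (k x * \<phi> x) \<le> norm (M * (indicator (cball 0 R) x * k x))"
          proof (cases "norm x \<le> R")
            case True
            have "\<bar>k x\<bar> * \<bar>\<phi> x\<bar> \<le> \<bar>k x\<bar> * M" by (rule mult_left_mono[OF M(2)]) simp
            thus ?thesis using True M(1) by (simp add: abs_mult mult.commute)
          next
            case False
            thus ?thesis using R by simp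
          qed
        qed
      qed measurable
      have "(\<integral>x. g x * \<phi> x \<partial>lborel) = (LINT x|lebesgue. (G x \<bullet> b) * \<phi> x)"
        by (rule lebesgue_integral_eq_lborel(3)[symmetric]) (use g(2) in \<open>auto elim: eventually_mono\<close>)
      also have "\<dots> = (LINT x|lebesgue. (H x \<bullet> b) * \<phi> x)" using assms b \<phi> by (simp add: has_weak_gradient_def)
      also have "\<dots> = (\<integral>x. h x * \<phi> x \<partial>lborel)"
        by (rule lebesgue_integral_eq_lborel(3)) (use h(2) in \<open>auto elim: eventually_mono\<close>)
      finally show "(\<integral>x. (g x - h x) * \<phi> x \<partial>lborel) = 0"
        using ik[OF g(1,3)] ik[OF h(1,3)] by (simp add: left_diff_distrib)
    qed
    thus "AE x in lborel. G x \<bullet> b = H x \<bullet> b" using g(2) h(2) by eventually_elim simp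
  qed simp
  thus ?thesis by eventually_elim (auto intro: euclidean_eqI)
qed

lemma L2_locally_integrable:
  fixes f u :: "'a::euclidean_space \<Rightarrow> real"
  assumes "L2 u" "AE x in lborel. f x = u x"
  shows "locally_integrable f"
  unfolding locally_integrable_def set_integrable_def
proof (intro allI impI)
  fix K :: "'a set" assume K: "compact K"
  note [measurable] = L2_measurable[OF assms(1)]
  have Kb: "K \<in> sets borel" using K by (simp add: borel_compact)
  obtain R where R: "\<And>x. x \<in> K \<Longrightarrow> norm x \<le> R" using compact_imp_bounded[OF K] by (auto simp: bounded_iff)
  have m: "(\<lambda>x. indicator K x * u x) \<in> borel_measurable borel"
    by (intro borel_measurable_times borel_measurable_indicator Kb) measurable
  have "integrable lborel (\<lambda>x. indicator K x * u x)"
    by (rule Bochner_Integration.integrable_bound[OF L2_loc_integrable[OF assms(1), of R]])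
      (use m R in \<open>auto simp: indicator_def\<close>)
  moreover have "AE x in lborel. indicator K x * f x = indicator K x * u x" using assms(2) by eventually_elim simp
  ultimately show "integrable lebesgue (\<lambda>x. indicat_real K x *\<^sub>R f x)"
    using lebesgue_integral_eq_lborel(2)[OF m] by simp
qed

lemma AE_lborel_pair:
  assumes "AE x in lborel. P (x :: 'a::euclidean_space)"
  shows "AE p in lborel \<Otimes>\<^sub>M (lborel :: 'a measure). P (fst p) \<and> P (snd p)"
proof -
  obtain N where N: "N \<in> null_sets lborel" "{x \<in> space lborel. \<not> P x} \<subseteq> N" using assms by (rule AE_E3) (use that in auto)
  have [measurable]: "N \<in> sets borel" using N(1) by auto
  have n: "AE x in lborel. x \<notin> N" using N(1) by (rule AE_not_in)
  have "AE p in lborel \<Otimes>\<^sub>M lborel. fst p \<notin> N \<and> snd p \<notin> N"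
  proof (rule lborel_pair.AE_pair_measure)
    show "{p \<in> space (lborel \<Otimes>\<^sub>M lborel). fst p \<notin> N \<and> snd p \<notin> N} \<in> sets (lborel \<Otimes>\<^sub>M lborel)" by measurable
    show "AE x in lborel. AE y in lborel. fst (x, y) \<notin> N \<and> snd (x, y) \<notin> N"
      using n by eventually_elim (use n in simp)
  qed
  thus ?thesis by eventually_elim (use N(2) in auto)
qed

text \<open>The dictionary between Borel pairs and the given notions. It covers every v equal to u
  almost everywhere, because elements of \<open>H1\<close> are functions and not classes.\<close>

lemma sobolev_imp_H1:
  fixes v u V W :: "'a::euclidean_space \<Rightarrow> real"
  assumes s: "sobolev u G" and vu: "AE x in lborel. v x = u x"
    and W: "W \<in> borel_measurable borel" and VW: "AE x in lborel. V x = W x"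
  shows "v \<in> H1" "(Lp_norm 2 v)\<^sup>2 = nsq u" "energy V g v = pair_energy W g u G"
proof -
  note L = sobolev_L2[OF s]
  note [measurable] = L2_measurable[OF L(1)] L2_measurable[OF L(2)] W
  have sq: "AE x in lborel. (v x)\<^sup>2 = (u x)\<^sup>2" using vu by eventually_elim simp
  have sqm: "(\<lambda>x. (u x)\<^sup>2) \<in> borel_measurable borel" by measurable
  have vm: "v \<in> borel_measurable lebesgue" by (rule lebesgue_integral_eq_lborel(1)[OF L2_measurable[OF L(1)] vu])
  have v2: "v \<in> Lp_space 2"
    using vm lebesgue_integral_eq_lborel(2)[OF sqm sq] L2_integrable[OF L(1)] by (simp add: Lp_space_2_iff)
  have hw: "has_weak_gradient v G"
    unfolding has_weak_gradient_def
  proof (intro conjI ballI allI impI)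
    show "locally_integrable v" by (rule L2_locally_integrable[OF L(1) vu])
    fix b :: 'a assume b: "b \<in> Basis"
    show "locally_integrable (\<lambda>x. G x \<bullet> b)" by (rule L2_locally_integrable[OF L2_inner[OF L(2), of b]]) simp
    fix \<phi> :: "'a \<Rightarrow> real" assume \<phi>: "test_function \<phi>"
    note [measurable] = cc_measurable[OF test_function_cc[OF \<phi>]] cc_measurable[OF test_function_cc_partial[OF \<phi> b]]
    have "(LINT x|lebesgue. v x * partial_deriv b \<phi> x) = (\<integral>x. u x * partial_deriv b \<phi> x \<partial>lborel)"
      by (rule lebesgue_integral_eq_lborel(3)) (use vu in \<open>auto elim: eventually_mono\<close>)
    also have "\<dots> = - (\<integral>x. (G x \<bullet> b) * \<phi> x \<partial>lborel)" by (rule sobolev_ibp[OF s b \<phi>])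
    also have "(\<integral>x. (G x \<bullet> b) * \<phi> x \<partial>lborel) = (LINT x|lebesgue. (G x \<bullet> b) * \<phi> x)"
      by (rule lebesgue_integral_eq_lborel(3)[symmetric]) auto
    finally show "(LINT x|lebesgue. v x * partial_deriv b \<phi> x) = - (LINT x|lebesgue. (G x \<bullet> b) * \<phi> x)" .
  qed
  have "(\<lambda>x. G x \<bullet> b) \<in> Lp_space 2" for b
  proof -
    have m: "(\<lambda>x. G x \<bullet> b) \<in> borel_measurable borel" "(\<lambda>x. (G x \<bullet> b)\<^sup>2) \<in> borel_measurable borel" by measurable
    show ?thesis
      using lebesgue_integral_eq_lborel(1)[OF m(1), of "\<lambda>x. G x \<bullet> b"] lebesgue_integral_eq_lborel(2)[OF m(2), of "\<lambda>x. (G x \<bullet> b)\<^sup>2"]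
        L2_integrable[OF L2_inner[OF L(2)], of b] by (simp add: Lp_space_2_iff)
  qed
  with v2 hw show "v \<in> H1" by (auto simp: H1_def)
  show "(Lp_norm 2 v)\<^sup>2 = nsq u"
    unfolding Lp_norm_2 lebesgue_integral_eq_lborel(3)[OF sqm sq] by (simp add: nsq_def)
  have "has_weak_gradient v (weak_gradient v)" unfolding weak_gradient_def by (rule someI[of "has_weak_gradient v" G, OF hw])
  hence "AE x in lborel. weak_gradient v x = G x" by (rule weak_gradient_unique[OF _ hw])
  hence "AE x in lborel. (norm (weak_gradient v x))\<^sup>2 = (norm (G x))\<^sup>2" by eventually_elim simp
  moreover have "(\<lambda>x. (norm (G x))\<^sup>2) \<in> borel_measurable borel" by measurable
  ultimately have K: "(LINT x|lebesgue. (norm (weak_gradient v x))\<^sup>2) = nsq G"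
    unfolding nsq_def by (intro lebesgue_integral_eq_lborel(3))
  \<comment> \<open>Lebesgue measure on the product space is the completion of the Borel product
    measure, so the double integral may be computed with Borel representatives.\<close>
  have "(LINT p|lebesgue. (case p of (x, y) \<Rightarrow> \<bar>v x\<bar>\<^sup>2 * V (x - y) * \<bar>v y\<bar>\<^sup>2)) = (\<integral>p. (case p of (x, y) \<Rightarrow> (u x)\<^sup>2 * W (x - y) * (u y)\<^sup>2) \<partial>lborel)"
  proof (rule lebesgue_integral_eq_lborel(3))
    have "(\<lambda>(x, y). (u x)\<^sup>2 * W (x - y) * (u y)\<^sup>2) \<in> borel_measurable (lborel \<Otimes>\<^sub>M lborel)"
      by (rule interaction_measurable[OF W L2_measurable[OF L(1)]])
    thus "(\<lambda>(x, y). (u x)\<^sup>2 * W (x - y) * (u y)\<^sup>2) \<in> borel_measurable borel" by (simp add: lborel_prod)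
    show "AE p in lborel. (case p of (x, y) \<Rightarrow> \<bar>v x\<bar>\<^sup>2 * V (x - y) * \<bar>v y\<bar>\<^sup>2) = (case p of (x, y) \<Rightarrow> (u x)\<^sup>2 * W (x - y) * (u y)\<^sup>2)"
      using AE_lborel_pair[OF vu] AE_lborel_pair_diff[OF VW] unfolding lborel_prod by eventually_elim (auto simp: case_prod_unfold)
  qed
  hence "(LINT (x, y)|lebesgue. \<bar>v x\<bar>\<^sup>2 * V (x - y) * \<bar>v y\<bar>\<^sup>2) = interaction W u" by (simp add: interaction_def lborel_prod)
  thus "energy V g v = pair_energy W g u G" unfolding energy_def pair_energy_def K by simp
qed

theorem theorem1p1:
  fixes V :: "'a::euclidean_space \<Rightarrow> real" and m :: real
  assumes dim: "DIM('a) \<in> {1, 2, 3}"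
    and mass: "m > 0"
    and V_dim1: "DIM('a) = 1 \<Longrightarrow> V \<in> Lp_space 1 \<and> (AE x in lebesgue. V x \<ge> 0)"
    and V_dim23: "DIM('a) \<in> {2, 3} \<Longrightarrow>
      V \<in> Lp_space (ereal (real DIM('a) / 2)) \<and>
      (\<forall>\<epsilon>\<in>{0<..<1}. \<exists>q::ereal. \<exists>V1 V2.
         ereal (real DIM('a) / 2) < q \<and> V1 \<in> Lp_space q \<and>
         V2 \<in> Lp_space (ereal (real DIM('a) / 2)) \<and>
         (AE x in lebesgue. V x = V1 x + V2 x) \<and>
         Lp_norm (real DIM('a) / 2) V2 < \<epsilon>)"
    and V_pos: "\<exists>r0>0. \<exists>c>0. AE x in lebesgue. x \<in> ball 0 r0 \<longrightarrow> c \<le> V x"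
  shows "\<exists>gstar\<ge>0.
      (DIM('a) = 1 \<longrightarrow> gstar = 0) \<and>
      (DIM('a) \<in> {2, 3} \<longrightarrow> gstar > 0) \<and>
      (\<forall>g>0. ground_energy V g m < 0 \<longleftrightarrow> g > gstar) \<and>
      (\<forall>g>gstar. \<exists>u. is_minimizer V g m u) \<and>
      (\<forall>g. 0 < g \<and> g < gstar \<longrightarrow> \<not> (\<exists>u. is_minimizer V g m u))"
proof -
  define p where "p = (if DIM('a) = 1 then 1 else real DIM('a) / 2)"
  have "V \<in> Lp_space (ereal p)"
    using V_dim1 V_dim23 dim by (auto simp: p_def one_ereal_def)
  hence Vm: "V \<in> borel_measurable lebesgue" and Vi: "integrable lebesgue (\<lambda>x. \<bar>V x\<bar> powr p)"
    by (auto simp: Lp_space_def)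
  obtain W where Wm [measurable]: "W \<in> borel_measurable borel" and VW: "AE x in lborel. V x = W x"
    by (rule lebesgue_borel_representative[OF Vm])
  have adm: "admissible W"
  proof -
    have ae: "AE x in lborel. \<bar>V x\<bar> powr p = \<bar>W x\<bar> powr p" using VW by eventually_elim simp
    have "(\<lambda>x. \<bar>W x\<bar> powr p) \<in> borel_measurable borel" by measurable
    from lebesgue_integral_eq_lborel(2)[OF this ae] Vi have "integrable lborel (\<lambda>x. \<bar>W x\<bar> powr p)" by simp
    thus ?thesis by (simp add: admissible_def p_def Wm)
  qed
  obtain r0 c where r0: "r0 > 0" and c: "c > 0" and "AE x in lborel. x \<in> ball 0 r0 \<longrightarrow> c \<le> V x"
    using V_pos by (auto simp: lebesgue_AE_iff)
  hence Wpos: "AE x in lborel. x \<in> ball 0 r0 \<longrightarrow> c \<le> W x" using VW by (auto elim: eventually_elim2)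
  have Wnn: "AE x in lborel. 0 \<le> W x" if "DIM('a) = 1"
  proof -
    have "AE x in lborel. 0 \<le> V x" using V_dim1[OF that] by (simp add: lebesgue_AE_iff)
    thus ?thesis using VW by eventually_elim simp
  qed
  note to_H1 = sobolev_imp_H1[OF _ _ Wm VW]
  \<comment> \<open>This turns quantification over the mass sphere into quantification over
    pairs.\<close>
  have sphere: "v \<in> mass_sphere m \<longleftrightarrow> (\<exists>u G. sobolev u G \<and> nsq u = m \<and> (AE x in lborel. v x = u x))" for v :: "'a \<Rightarrow> real"
  proof
    assume v: "v \<in> mass_sphere m"
    then obtain u G where u: "sobolev u G" "AE x in lborel. v x = u x"
      using H1_sobolev_representative by (auto simp: mass_sphere_def)
    have "nsq u = m" using to_H1(2)[OF u] v by (simp add: mass_sphere_def)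
    with u show "\<exists>u G. sobolev u G \<and> nsq u = m \<and> (AE x in lborel. v x = u x)" by blast
  next
    assume "\<exists>u G. sobolev u G \<and> nsq u = m \<and> (AE x in lborel. v x = u x)"
    then obtain u G where u: "sobolev u G" "nsq u = m" "AE x in lborel. v x = u x" by blast
    thus "v \<in> mass_sphere m" using to_H1(1,2)[OF u(1,3)] by (simp add: mass_sphere_def)
  qed
  have neg: "ground_energy V g m < 0 \<longleftrightarrow> negative_energy W m g" for g
  proof -
    have "ground_energy V g m < 0 \<longleftrightarrow> (\<exists>v\<in>mass_sphere m. energy V g v < 0)"
      by (simp add: ground_energy_def INF_less_iff)
    also have "\<dots> \<longleftrightarrow> negative_energy W m g"
    proof
      assume "\<exists>v\<in>mass_sphere m. energy V g v < 0"
      then obtain v u G where "energy V g v < 0" "sobolev u G" "nsq u = m" "AE x in lborel. v x = u x"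
        using sphere by blast
      thus "negative_energy W m g" using to_H1(3) unfolding negative_energy_def by metis
    next
      assume "negative_energy W m g"
      then obtain u G where u: "sobolev u G" "nsq u = m" "pair_energy W g u G < 0" by (auto simp: negative_energy_def)
      have "u \<in> mass_sphere m" using sphere u by auto
      moreover have "energy V g u < 0" using to_H1(3)[OF u(1), of u] u(3) by simp
      ultimately show "\<exists>v\<in>mass_sphere m. energy V g v < 0" by blast
    qed
    finally show ?thesis .
  qed
  \<comment> \<open>Attainment of the infimum in the extended reals becomes ordinary minimality,
    which can be compared pair by pair.\<close>
  have mini: "is_minimizer V g m v \<longleftrightarrow> v \<in> mass_sphere m \<and> (\<forall>w\<in>mass_sphere m. energy V g v \<le> energy V g w)" for g v
  proof -
    have "ereal (energy V g v) = ground_energy V g m \<longleftrightarrow> (\<forall>w\<in>mass_sphere m. energy V g v \<le> energy V g w)"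
      if v: "v \<in> mass_sphere m"
    proof -
      have "ground_energy V g m \<le> ereal (energy V g v)" unfolding ground_energy_def using v by (rule INF_lower)
      hence "ereal (energy V g v) = ground_energy V g m \<longleftrightarrow> ereal (energy V g v) \<le> ground_energy V g m" by auto
      also have "\<dots> \<longleftrightarrow> (\<forall>w\<in>mass_sphere m. energy V g v \<le> energy V g w)"
        by (simp add: ground_energy_def le_INF_iff)
      finally show ?thesis .
    qed
    thus ?thesis by (auto simp: is_minimizer_def)
  qed
  from critical_coupling[OF dim adm mass Wnn r0 c Wpos]
  obtain gstar where P: "gstar \<ge> 0 \<and> (DIM('a) = 1 \<longrightarrow> gstar = 0) \<and> (DIM('a) \<in> {2, 3} \<longrightarrow> gstar > 0) \<and>
    (\<forall>g>0. negative_energy W m g \<longleftrightarrow> g > gstar) \<and>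
    (\<forall>g. 0 < g \<and> g < gstar \<longrightarrow> \<not> (\<exists>u G. sobolev u G \<and> nsq u = m \<and>
       (\<forall>v H. sobolev v H \<longrightarrow> nsq v = m \<longrightarrow> pair_energy W g u G \<le> pair_energy W g v H)))"
    by (rule exE)
  note gs = P[THEN conjunct1] P[THEN conjunct2, THEN conjunct1] P[THEN conjunct2, THEN conjunct2, THEN conjunct1]
    and iff = P[THEN conjunct2, THEN conjunct2, THEN conjunct2, THEN conjunct1]
    and nomin = P[THEN conjunct2, THEN conjunct2, THEN conjunct2, THEN conjunct2]
  have ex: "\<exists>u. is_minimizer V g m u" if g: "g > gstar" for g
  proof -
    have g0: "g > 0" using g gs(1) by linarith
    obtain u0 G0 where neg0: "sobolev u0 G0" "nsq u0 = m" "pair_energy W g u0 G0 < 0"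
      using iff g0 g by (auto simp: negative_energy_def)
    show ?thesis
    proof (rule pair_energy_minimizer_exists[OF dim adm g0 mass neg0])
      fix u G assume u: "sobolev u G" "nsq u = m"
        and min: "\<And>v H. sobolev v H \<Longrightarrow> nsq v = m \<Longrightarrow> pair_energy W g u G \<le> pair_energy W g v H"
      have "energy V g u \<le> energy V g w" if "w \<in> mass_sphere m" for w
      proof -
        from sphere[THEN iffD1, OF that]
        obtain v H where v: "sobolev v H" "nsq v = m" "AE x in lborel. w x = v x" by (elim exE conjE)
        show ?thesis using min[OF v(1,2)] to_H1(3)[OF u(1), of u] to_H1(3)[OF v(1,3)] by simp
      qed
      hence "\<forall>w\<in>mass_sphere m. energy V g u \<le> energy V g w" by (rule ballI)
      moreover have "u \<in> mass_sphere m" using sphere u by auto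
      ultimately have "is_minimizer V g m u" by (simp only: mini simp_thms)
      thus "\<exists>u. is_minimizer V g m u" by (rule exI[of "\<lambda>u. is_minimizer V g m u" u])
    qed
  qed
  have nex: "\<not> (\<exists>u. is_minimizer V g m u)" if g: "0 < g" "g < gstar" for g
  proof
    assume "\<exists>u. is_minimizer V g m u"
    then obtain w where w: "w \<in> mass_sphere m" "\<And>z. z \<in> mass_sphere m \<Longrightarrow> energy V g w \<le> energy V g z" using mini by blast
    from sphere[THEN iffD1, OF w(1)]
    obtain u G where u: "sobolev u G" "nsq u = m" "AE x in lborel. w x = u x" by (elim exE conjE)
    have "pair_energy W g u G \<le> pair_energy W g v H" if v: "sobolev v H" "nsq v = m" for v H
    proof -
      have "v \<in> mass_sphere m" using sphere v by auto
      from w(2)[OF this] show ?thesis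
        using to_H1(3)[OF u(1,3)] to_H1(3)[OF v(1), of v] by simp
    qed
    with nomin g u(1,2) show False by blast
  qed
  show ?thesis using gs iff neg ex nex by (intro exI[of _ gstar]) simp
qed

end
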